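(* Let $G$ be a nontrivial connected compact abelian group. Then $\lambda(G)=\lambda(\mathbb{T})$, where $\mathbb{T}=\mathbb{R}/\mathbb{Z}$.
   Context: For a compact abelian group $G$ with normalized Haar measure $\mu$ and (multiplicative) dual group of characters $\widehat{G}$, let $\mathbb{Z}[\widehat{G}]$ denote the ring of integral linear combinations of characters, regarded as functions on $G$. For $f\in\mathbb{Z}[\widehat{G}]$, the logarithmic Mahler measure over $G$ is $\mathsf{m}_G(f)=\int_G\log|f|\,d\mu$ (with $\log 0=-\infty$, so this may equal $-\infty$). The Lehmer constant of $G$ is $\lambda(G)=\inf\{\mathsf{m}_G(f): f\in\mathbb{Z}[\widehat{G}],\ \mathsf{m}_G(f)>0\}$. *)

theory Defs
  imports "HOL-Analysis.Analysis"
begin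

definition torus_rel :: "real \<Rightarrow> real \<Rightarrow> bool" where
  "torus_rel x y \<longleftrightarrow> x - y \<in> \<int>"

lemma equivp_torus_rel: "equivp torus_rel"
proof (rule equivpI)
  show "reflp torus_rel" by (auto simp: reflp_def torus_rel_def)
  show "symp torus_rel" unfolding symp_def torus_rel_def
    by (metis Ints_minus minus_diff_eq)
  show "transp torus_rel" unfolding transp_def torus_rel_def
    by (metis Ints_add diff_add_cancel add_diff_eq)
qed

quotient_type torus = real / torus_rel
  by (rule equivp_torus_rel)

instantiation torus :: ab_group_add
begin

lift_definition zero_torus :: torus is "0::real" .
lift_definition plus_torus :: "torus \<Rightarrow> torus \<Rightarrow> torus" is "(+)"
proof -
  fix a b c d :: real
  assume "torus_rel a b" "torus_rel c d"
  then have "(a - b) + (c - d) \<in> \<int>" unfolding torus_rel_def by (rule Ints_add)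
  moreover have "(a - b) + (c - d) = (a + c) - (b + d)" by simp
  ultimately show "torus_rel (a + c) (b + d)" unfolding torus_rel_def by simp
qed
lift_definition uminus_torus :: "torus \<Rightarrow> torus" is uminus
proof -
  fix a b :: real
  assume "torus_rel a b"
  then have "- (a - b) \<in> \<int>" unfolding torus_rel_def by (rule Ints_minus)
  then show "torus_rel (- a) (- b)" unfolding torus_rel_def by simp
qed
lift_definition minus_torus :: "torus \<Rightarrow> torus \<Rightarrow> torus" is "(-)"
proof -
  fix a b c d :: real
  assume "torus_rel a b" "torus_rel c d"
  then have "(a - b) - (c - d) \<in> \<int>" unfolding torus_rel_def by (rule Ints_diff)
  moreover have "(a - b) - (c - d) = (a - c) - (b - d)" by simp
  ultimately show "torus_rel (a - c) (b - d)" unfolding torus_rel_def by simp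
qed

lemma torus_rel_refl: "torus_rel x x"
  by (simp add: torus_rel_def)

instance
proof
  fix a b c :: torus
  show "a + b + c = a + (b + c)"
    by transfer (simp add: torus_rel_refl add.assoc)
  show "a + b = b + a"
    by transfer (simp add: torus_rel_refl add.commute)
  show "0 + a = a"
    by transfer (simp add: torus_rel_refl)
  show "- a + a = 0"
    by transfer (simp add: torus_rel_refl)
  show "a - b = a + - b"
    by transfer (simp add: torus_rel_refl)
qed

end

instantiation torus :: topological_space
begin

definition open_torus :: "torus set \<Rightarrow> bool" where
  "open_torus U \<longleftrightarrow> open {x::real. abs_torus x \<in> U}"

instance
proof
  show "open (UNIV :: torus set)" by (simp add: open_torus_def)
  fix S T :: "torus set"
  assume "open S" "open T"
  then show "open (S \<inter> T)"
  proof -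
    have "{x::real. abs_torus x \<in> S \<inter> T} = {x. abs_torus x \<in> S} \<inter> {x. abs_torus x \<in> T}"
      by blast
    then show ?thesis using \<open>open S\<close> \<open>open T\<close> unfolding open_torus_def
      by (simp only: open_Int)
  qed
next
  fix K :: "torus set set"
  assume "\<forall>S\<in>K. open S"
  then have "open (\<Union>S\<in>K. {x::real. abs_torus x \<in> S})"
    unfolding open_torus_def by blast
  moreover have "(\<Union>S\<in>K. {x::real. abs_torus x \<in> S}) = {x. abs_torus x \<in> \<Union>K}"
    by blast
  ultimately show "open (\<Union>K)" unfolding open_torus_def by simp
qed

end

definition is_haar :: "'g::{ab_group_add, topological_space} measure \<Rightarrow> bool" where
  "is_haar M \<longleftrightarrow> space M = UNIV \<and> emeasure M UNIV = 1 \<and> sets M = sets borel \<and>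
     (\<forall>x. \<forall>A \<in> sets borel. emeasure M ((\<lambda>y. x + y) ` A) = emeasure M A)"

definition characters :: "('g::{ab_group_add, topological_space} \<Rightarrow> complex) set" where
  "characters = {\<gamma>. continuous_on UNIV \<gamma> \<and> (\<forall>x. cmod (\<gamma> x) = 1) \<and>
                    (\<forall>x y. \<gamma> (x + y) = \<gamma> x * \<gamma> y)}"

text \<open>The ring Z[dual G] of integral linear combinations of characters, as functions on G.\<close>
definition int_char_poly :: "('g::{ab_group_add, topological_space} \<Rightarrow> complex) set" where
  "int_char_poly = {f. \<exists>F (c :: ('g \<Rightarrow> complex) \<Rightarrow> int). finite F \<and> F \<subseteq> characters \<and>
                        f = (\<lambda>x. \<Sum>\<gamma>\<in>F. of_int (c \<gamma>) * \<gamma> x)}"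

text \<open>Logarithmic Mahler measure m_G(f) = integral of log|f| (log 0 = -infinity), as an
  extended real: positive part minus negative part.\<close>
definition mahler :: "'g measure \<Rightarrow> ('g \<Rightarrow> complex) \<Rightarrow> ereal" where
  "mahler M f =
     enn2ereal (\<integral>\<^sup>+x. (if f x = 0 then 0 else ennreal (max 0 (ln (cmod (f x))))) \<partial>M)
   - enn2ereal (\<integral>\<^sup>+x. (if f x = 0 then \<infinity> else ennreal (max 0 (- ln (cmod (f x))))) \<partial>M)"

definition lehmer :: "'g::{ab_group_add, topological_space} measure \<Rightarrow> ereal" where
  "lehmer M = Inf {mahler M f | f. f \<in> int_char_poly \<and> mahler M f > 0}"

end

theory Submission
  imports Defs
begin

text \<open>
  If \<open>G\<close> has torsion-free dual and \<open>H\<close> has a character \<open>\<eta>\<close> of infinite order, then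
  \<open>\<lambda>(H) \<le> \<lambda>(G)\<close>; connected groups have torsion-free dual, so two applications give the theorem as
  soon as \<open>G\<close> has a nontrivial character.

  For the inequality, let \<open>f = \<Sum> c \<gamma>\<close> with \<open>m\<^sub>G(f) > 0\<close>. Torsion-freeness yields integers \<open>m(\<gamma>)\<close> that
  satisfy exactly the same relations of bounded length as the characters \<open>\<gamma>\<close>, so finitely many
  moments of \<open>|f|\<^sup>2\<close> agree with those of \<open>|g|\<^sup>2\<close>, \<open>g(z) = \<Sum> c z\<^bsup>m(\<gamma>)\<^esup>\<close>. By Weierstrass approximation
  the truncated Mahler measures of \<open>f\<close> and \<open>g\<close> are close, and Lawton's bound for the measure of the set where
  \<open>|g|\<close> is small, which depends only on the number of terms, removes the truncation uniformly.
  Finally \<open>g\<close> and \<open>g \<circ> \<eta>\<close> have the same Mahler measure since all their moments agree.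

  A nontrivial character is \<open>P / P(0)\<close> for a minimal hermitian idempotent \<open>P\<close> of the convolution algebra
  \<open>C(G)\<close> with \<open>\<integral> P = 0\<close>.
\<close>

section \<open>Lawton's estimate\<close>

text \<open>The obstacle is the singularity of the logarithm at zeros: agreement of finitely many
  moments does not control it, so \<open>m(g)\<close> could fall far below \<open>m(f)\<close>, even
  to a nonpositive value, and \<open>g\<close> would be lost for the infimum. Only \<open>g\<close>
  needs a uniform estimate. It is chosen after the truncation level, so the estimate may not depend
  on its exponents. Integrality enters here: a nonzero integer leading coefficient has modulus at
  least 1. For the fixed \<open>f\<close>, truncation overestimates and converges, which is enough.
  A nontrivial character is indispensable: with a trivial dual the ring would consist of integer
  constants, and \<lambda> would be log 2. Its existence is a spectral problem: translations commute
  with convolution by a hermitian function, and a function whose translates are all multiples of it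
  is a character up to scaling.\<close>

lemma has_real_derivative_Re_cis:
  "((\<lambda>t. Re (c * cis (k * t))) has_real_derivative Re (c * \<i> * of_real k * cis (k * t))) (at t within S)"
proof -
  have "(\<lambda>t. Re (c * cis (k * t))) = (\<lambda>t. Re c * cos (k * t) - Im c * sin (k * t))"
    by (auto simp: fun_eq_iff)
  then show ?thesis
    by (auto intro!: derivative_eq_intros simp: algebra_simps)
qed

lemma cis_2pi_inj:
  assumes "s \<in> {0..<1}" "t \<in> {0..<1}" "cis (2 * pi * s) = cis (2 * pi * t)"
  shows "s = t"
proof -
  have "cis (2 * pi * s - 2 * pi * t) = 1"
    using assms(3) by (simp flip: cis_divide)
  then have "cos (2 * pi * s - 2 * pi * t) = 1"
    by (simp add: complex_eq_iff)
  then obtain n :: int where "2 * pi * s - 2 * pi * t = of_int n * 2 * pi"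
    using cos_one_2pi_int by (metis (no_types, lifting))
  then have "2 * pi * (s - t) = 2 * pi * of_int n"
    by (simp add: algebra_simps)
  then have n: "s - t = of_int n"
    by (subst (asm) mult_cancel_left) auto
  then have "\<bar>real_of_int n\<bar> < 1" using assms(1,2) by auto
  then have "n = 0" by linarith
  then show ?thesis using n by simp
qed

text \<open>On the unit circle conjugation is inversion, so the equation becomes a polynomial
  equation of degree at most \<open>2 * N\<close> in \<open>cis (2 * pi * t)\<close>. It is not the
  zero polynomial because no frequency is 0, which leaves the middle coefficient equal to
  \<open>- 2 * c\<close>.\<close>

lemma trig_zeros:
  fixes b :: "nat \<Rightarrow> complex" and c :: real
  assumes "finite A" "A \<subseteq> {1..N}" "c \<noteq> 0"
  defines "Z \<equiv> {t \<in> {0..<1}. Re (\<Sum>n\<in>A. b n * cis (2 * pi * real n * t)) = c}"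
  shows "finite Z" "card Z \<le> 2 * N"
proof -
  \<comment> \<open>At a point \<open>z\<close> of the circle this is \<open>2 * z ^ N\<close> times
    the difference of the real part and \<open>c\<close>.\<close>
  define R where "R = (\<Sum>n\<in>A. monom (b n) (N + n) + monom (cnj (b n)) (N - n)) - monom (of_real (2 * c)) N"
  have "coeff R N = - of_real (2 * c)"
  proof -
    have "(\<Sum>n\<in>A. coeff (monom (b n) (N + n) + monom (cnj (b n)) (N - n)) N) = 0"
      using assms(2) by (intro sum.neutral) (auto simp: subset_eq)
    then show ?thesis by (simp add: R_def coeff_sum)
  qed
  then have R0: "R \<noteq> 0" using \<open>c \<noteq> 0\<close> by auto
  have deg: "degree R \<le> 2 * N"
    unfolding R_def using assms(2)
    by (intro degree_diff_le degree_sum_le degree_add_le order.trans[OF degree_monom_le] assms(1)) auto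
  have root: "poly R (cis (2 * pi * t)) = 0" if "t \<in> Z" for t
  proof -
    define z where "z = cis (2 * pi * t)"
    have zn: "cis (2 * pi * real n * t) = z ^ n" for n
      unfolding z_def Complex.DeMoivre by (rule arg_cong[where f = cis]) simp
    have zz: "z * cnj z = 1" by (simp add: z_def cis_cnj cis_mult)
    have zN: "z ^ (N - n) = z ^ N * cnj z ^ n" if "n \<in> A" for n
    proof -
      have "N = (N - n) + n" using that assms(2) by auto
      then have "z ^ N * cnj z ^ n = z ^ (N - n) * (z ^ n * cnj z ^ n)"
        by (metis mult.assoc power_add)
      also have "z ^ n * cnj z ^ n = 1" by (metis power_mult_distrib zz power_one)
      finally show ?thesis by simp
    qed
    let ?q = "\<Sum>n\<in>A. b n * z ^ n"
    have "poly R z = (\<Sum>n\<in>A. b n * z ^ (N + n) + cnj (b n) * z ^ (N - n)) - of_real (2 * c) * z ^ N"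
      by (simp add: R_def poly_sum poly_monom)
    also have "(\<Sum>n\<in>A. b n * z ^ (N + n) + cnj (b n) * z ^ (N - n)) = (\<Sum>n\<in>A. z ^ N * (b n * z ^ n + cnj (b n * z ^ n)))"
      by (intro sum.cong) (auto simp: zN power_add algebra_simps)
    also have "\<dots> = z ^ N * (?q + cnj ?q)"
      by (simp add: sum_distrib_left sum.distrib algebra_simps)
    also have "?q + cnj ?q = of_real (2 * Re ?q)" by (rule complex_add_cnj)
    also have "Re ?q = c" using that by (simp only: Z_def mem_Collect_eq zn)
    finally show ?thesis by (simp add: z_def)
  qed
  have inj: "inj_on (\<lambda>t. cis (2 * pi * t)) Z"
    by (rule inj_onI) (auto simp: Z_def intro: cis_2pi_inj)
  have sub: "(\<lambda>t. cis (2 * pi * t)) ` Z \<subseteq> {z. poly R z = 0}" using root by auto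
  have fin: "finite {z. poly R z = 0}" using R0 by (rule poly_roots_finite)
  show "finite Z" using inj sub fin finite_imageD finite_subset by metis
  have "card Z = card ((\<lambda>t. cis (2 * pi * t)) ` Z)" using inj by (simp add: card_image)
  also have "\<dots> \<le> card {z. poly R z = 0}" using sub fin by (rule card_mono[rotated])
  also have "\<dots> \<le> degree R" using R0 by (rule card_poly_roots_bound)
  finally show "card Z \<le> 2 * N" using deg by simp
qed

text \<open>Replaces a set of bounded diameter by an interval of that length, so that the
  measurability of the pieces below never has to be discussed.\<close>

lemma subset_interval_of_diameter:
  fixes E :: "real set"
  assumes "\<And>s t. s \<in> E \<Longrightarrow> t \<in> E \<Longrightarrow> s < t \<Longrightarrow> t - s \<le> d" "d \<ge> 0"
  shows "\<exists>a. E \<subseteq> {a..a + d}"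
proof (cases "E = {}")
  case False
  then obtain x where x: "x \<in> E" by auto
  have bd: "bdd_below E" using assms(1)[of _ x] assms(2)
    by (intro bdd_belowI[of _ "x - d"]) (smt (verit) x)
  have "E \<subseteq> {Inf E..Inf E + d}"
  proof
    fix t assume t: "t \<in> E"
    have "t - d \<le> Inf E"
    proof (rule cInf_greatest[OF False])
      fix s assume "s \<in> E"
      then show "t - d \<le> s" using assms(1)[of s t] assms(2) t by (cases "s < t") auto
    qed
    then show "t \<in> {Inf E..Inf E + d}" using cInf_lower[OF t bd] by auto
  qed
  then show ?thesis by blast
qed simp

text \<open>The zeros of \<open>v - c\<close> cut the set into \<open>m + 1\<close> pieces; on each of them \<open>u\<close> increases with
  slope at least \<open>c\<close> while staying in \<open>[-y, y]\<close>, so the piece has diameter at most \<open>2y/c\<close>.\<close>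

lemma emeasure_small_with_large_derivative:
  fixes u v :: "real \<Rightarrow> real"
  assumes der: "\<And>t. (u has_real_derivative v t) (at t)"
    and cont: "continuous_on UNIV v"
    and "c > 0" "y \<ge> 0"
    and fin: "finite {t \<in> {0..<1}. v t = c}" and card: "card {t \<in> {0..<1}. v t = c} \<le> m"
  shows "emeasure lborel {t \<in> {0..<1}. \<bar>u t\<bar> \<le> y \<and> v t > c} \<le> ennreal (real (m + 1) * (2 * y / c))"
proof -
  define Z where "Z = {t \<in> {0..<1}. v t = c}"
  define E where "E = {t \<in> {0..<1}. \<bar>u t\<bar> \<le> y \<and> v t > c}"
  \<comment> \<open>The piece that starts at \<open>z\<close>: no zero of \<open>v - c\<close> lies
    between \<open>z\<close> and its points. Here \<open>z\<close> runs through the zeros and the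
    left end 0.\<close>
  define P where "P z = {t \<in> E. z \<le> t \<and> Z \<inter> {z<..t} = {}}" for z
  have d0: "2 * y / c \<ge> 0" using assms by simp
  have diam: "t - s \<le> 2 * y / c" if "s \<in> P z" "t \<in> P z" "s < t" for s t z
  proof -
    \<comment> \<open>If \<open>v\<close> dropped to \<open>c\<close> between two points of one
      piece, the intermediate value theorem would put a zero after \<open>s\<close>, hence inside
      the piece.\<close>
    have gt: "v r > c" if rst: "r \<in> {s..t}" for r
    proof (rule ccontr)
      assume "\<not> c < v r"
      then have "v r \<le> c" "c \<le> v t" using \<open>t \<in> P z\<close> by (auto simp: P_def E_def)
      moreover have "continuous_on {r..t} v" using cont continuous_on_subset by blast
      ultimately obtain r' where "r' \<in> {r..t}" "v r' = c"
        using IVT'[of v r c t] rst by auto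
      moreover have "r' \<noteq> s" using \<open>v r' = c\<close> \<open>s \<in> P z\<close> by (auto simp: P_def E_def)
      ultimately have "s < r'" "r' \<le> t" "v r' = c"
        using rst by auto
      moreover have "0 \<le> s" "z \<le> s" "t < 1"
        using \<open>s \<in> P z\<close> \<open>t \<in> P z\<close> by (auto simp: P_def E_def)
      ultimately have "r' \<in> Z \<inter> {z<..t}" by (simp add: Z_def)
      then show False using \<open>t \<in> P z\<close> by (auto simp: P_def)
    qed
    obtain r where r: "s < r" "r < t" "u t - u s = (t - s) * v r"
      using MVT2[OF \<open>s < t\<close>, of u v] der by auto
    have "(t - s) * c \<le> (t - s) * v r"
      using gt[of r] r \<open>s < t\<close> by (intro mult_left_mono) auto
    also have "\<dots> \<le> 2 * y" using r(3) that by (auto simp: P_def E_def)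
    finally show ?thesis using \<open>c > 0\<close> by (simp add: field_simps)
  qed
  have "\<exists>a. P z \<subseteq> {a..a + 2 * y / c}" for z
    by (rule subset_interval_of_diameter) (use diam d0 in blast)+
  then obtain a where a: "\<And>z. P z \<subseteq> {a z..a z + 2 * y / c}" by metis
  have "E \<subseteq> (\<Union>z\<in>insert 0 Z. P z)"
  proof
    fix t assume t: "t \<in> E"
    define z where "z = Max (insert 0 {z \<in> Z. z \<le> t})"
    have "finite Z" using fin by (simp add: Z_def)
    then have fz: "finite (insert 0 {z \<in> Z. z \<le> t})" by simp
    have "z \<in> insert 0 {z \<in> Z. z \<le> t}" unfolding z_def using fz by (intro Max_in) auto
    moreover have "w \<le> z" if "w \<in> Z" "w \<le> t" for w
      unfolding z_def using fz that by (intro Max_ge) auto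
    moreover have "0 \<le> t" using t by (simp add: E_def)
    ultimately have "z \<in> insert 0 Z" "z \<le> t" "Z \<inter> {z<..t} = {}" by (auto simp: not_le[symmetric])
    then have "z \<in> insert 0 Z" "t \<in> P z" using t by (auto simp: P_def)
    then show "t \<in> (\<Union>z\<in>insert 0 Z. P z)" by blast
  qed
  also have "\<dots> \<subseteq> (\<Union>z\<in>insert 0 Z. {a z..a z + 2 * y / c})" using a by blast
  finally have "emeasure lborel E \<le> emeasure lborel (\<Union>z\<in>insert 0 Z. {a z..a z + 2 * y / c})"
    using fin by (intro emeasure_mono sets.finite_UN) (auto simp: Z_def)
  also have "\<dots> \<le> (\<Sum>z\<in>insert 0 Z. emeasure lborel {a z..a z + 2 * y / c})"
    using fin by (intro emeasure_subadditive_finite) (auto simp: Z_def)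
  also have "\<dots> = (\<Sum>z\<in>insert 0 Z. ennreal (2 * y / c))"
    using d0 by (intro sum.cong) auto
  also have "\<dots> = ennreal (real (card (insert 0 Z)) * (2 * y / c))"
    using d0 by (simp add: ennreal_of_nat_eq_real_of_nat flip: ennreal_mult)
  also have "\<dots> \<le> ennreal (real (m + 1) * (2 * y / c))"
    using card card_insert_le_m1[of "Suc m" Z 0] d0 fin
    by (intro ennreal_leI mult_right_mono) (auto simp: Z_def card_insert_if)
  finally show ?thesis by (simp add: E_def)
qed

text \<open>Differentiation removes the constant \<open>b0\<close>, so the derivative has
  frequencies in \<open>{1..N}\<close> only and takes the value \<open>c\<close> at most
  \<open>2 * N\<close> times.\<close>

lemma emeasure_trig_poly_large_derivative:
  fixes b :: "nat \<Rightarrow> complex"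
  assumes "finite A" "A \<subseteq> {1..N}" "c > 0" "y \<ge> 0"
  shows "emeasure lborel {t \<in> {0..<1}. \<bar>Re (b0 + (\<Sum>n\<in>A. b n * cis (2 * pi * real n * t)))\<bar> \<le> y
      \<and> Re (\<Sum>n\<in>A. b n * \<i> * of_real (2 * pi * real n) * cis (2 * pi * real n * t)) > c}
    \<le> ennreal (real (2 * N + 1) * (2 * y / c))"
proof (rule emeasure_small_with_large_derivative)
  fix t :: real
  show "((\<lambda>t. Re (b0 + (\<Sum>n\<in>A. b n * cis (2 * pi * real n * t)))) has_real_derivative
    Re (\<Sum>n\<in>A. b n * \<i> * of_real (2 * pi * real n) * cis (2 * pi * real n * t))) (at t)"
    unfolding plus_complex.sel Re_sum
    by (rule DERIV_cong[OF DERIV_add[OF DERIV_const DERIV_sum[OF has_real_derivative_Re_cis]]]) simp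
next
  show "continuous_on UNIV (\<lambda>t. Re (\<Sum>n\<in>A. b n * \<i> * of_real (2 * pi * real n) * cis (2 * pi * real n * t)))"
    by (intro continuous_intros)
  show "finite {t \<in> {0..<1}. Re (\<Sum>n\<in>A. b n * \<i> * of_real (2 * pi * real n) * cis (2 * pi * real n * t)) = c}"
    by (rule trig_zeros[OF assms(1,2)]) (use assms in auto)
  show "card {t \<in> {0..<1}. Re (\<Sum>n\<in>A. b n * \<i> * of_real (2 * pi * real n) * cis (2 * pi * real n * t)) = c} \<le> 2 * N"
    by (rule trig_zeros[OF assms(1,2)]) (use assms in auto)
qed (use assms in auto)

text \<open>After a shift of the exponents the lowest term is constant, so the
  derivative, normalised by the degree, has one term less and still a leading coefficient of
  modulus at least 1.\<close>

lemma lawton_step: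
  fixes a :: "nat \<Rightarrow> complex"
  assumes "finite A" "A \<noteq> {}" "A \<subseteq> {1..}" "y > 0" "s > 0"
  defines "N \<equiv> Max A"
  shows "emeasure lborel {t \<in> {0..<1}. cmod (a0 + (\<Sum>n\<in>A. a n * cis (2 * pi * real n * t))) \<le> y}
    \<le> emeasure lborel {t \<in> {0..<1}. cmod (\<Sum>n\<in>A. (a n * of_real (real n / real N)) * cis (2 * pi * real n * t)) \<le> s}
      + ennreal (8 * y / s)"
proof -
  define q where "q t = a0 + (\<Sum>n\<in>A. a n * cis (2 * pi * real n * t))" for t
  define q1 where "q1 t = (\<Sum>n\<in>A. (a n * of_real (real n / real N)) * cis (2 * pi * real n * t))" for t
  \<comment> \<open>The derivative of \<open>q\<close> has modulus
    \<open>2 * pi * N * cmod (q1 t)\<close>; where \<open>cmod (q1 t) > s\<close> this exceeds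
    \<open>2 * c\<close>, so its real or its imaginary part exceeds \<open>c\<close> in
    modulus.\<close>
  define c where "c = pi * real N * s"
  have sub: "A \<subseteq> {1..N}" using assms by (auto simp: N_def)
  have "N \<in> A" unfolding N_def using assms by simp
  then have N1: "N \<ge> 1" using sub by auto
  have c0: "c > 0" using N1 \<open>s > 0\<close> by (simp add: c_def)
  define E where "E w = {t \<in> {0..<1}. \<bar>Re (w * a0 + (\<Sum>n\<in>A. (w * a n) * cis (2 * pi * real n * t)))\<bar> \<le> y
      \<and> Re (\<Sum>n\<in>A. (w * a n) * \<i> * of_real (2 * pi * real n) * cis (2 * pi * real n * t)) > c}" for w
  \<comment> \<open>Multiplication by these four units brings each of the two parts, with either
    sign, into the position of the real part. They account for the constant 8 as four times
    2.\<close>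
  define W where "W = {1, -1, \<i>, -\<i>}"
  have Ew: "emeasure lborel (E w) \<le> ennreal (2 * y / s)" for w
  proof -
    have "emeasure lborel (E w) \<le> ennreal (real (2 * N + 1) * (2 * y / c))"
      unfolding E_def by (rule emeasure_trig_poly_large_derivative) (use assms sub c0 in auto)
    also have "\<dots> \<le> ennreal (2 * y / s)"
    proof (rule ennreal_leI)
      \<comment> \<open>The number of pieces grows with \<open>N\<close>, but so does the slope
        \<open>c\<close>; the degree cancels from the bound.\<close>
      have "real (2 * N + 1) \<le> pi * real N"
      proof -
        have "real (2 * N + 1) \<le> 3 * real N" using N1 by simp
        also have "\<dots> \<le> pi * real N" using pi_gt3 by (intro mult_right_mono) auto
        finally show ?thesis .
      qed
      then have "real (2 * N + 1) * (2 * y / c) \<le> (pi * real N) * (2 * y / c)"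
        using \<open>y > 0\<close> c0 by (intro mult_right_mono) auto
      also have "\<dots> = 2 * y / s" using N1 by (simp add: c_def)
      finally show "real (2 * N + 1) * (2 * y / c) \<le> 2 * y / s" .
    qed
    finally show ?thesis .
  qed
  have qw: "w * a0 + (\<Sum>n\<in>A. (w * a n) * cis (2 * pi * real n * t)) = w * q t" for w t
    by (simp add: q_def distrib_left sum_distrib_left mult.assoc)
  have q1w: "(\<Sum>n\<in>A. (w * a n) * \<i> * of_real (2 * pi * real n) * cis (2 * pi * real n * t))
      = w * (\<i> * of_real (2 * pi * real N) * q1 t)" for w t
    using N1 by (simp add: q1_def sum_distrib_left field_simps)
  have cover: "{t \<in> {0..<1}. cmod (q t) \<le> y} \<subseteq> {t \<in> {0..<1}. cmod (q1 t) \<le> s} \<union> (\<Union>w\<in>W. E w)"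
  proof
    fix t assume t: "t \<in> {t \<in> {0..<1}. cmod (q t) \<le> y}"
    show "t \<in> {t \<in> {0..<1}. cmod (q1 t) \<le> s} \<union> (\<Union>w\<in>W. E w)"
    proof (cases "cmod (q1 t) \<le> s")
      case False
      define d where "d = \<i> * of_real (2 * pi * real N) * q1 t"
      have "2 * c < cmod d" using False N1 by (simp add: d_def c_def norm_mult)
      also have "\<dots> \<le> \<bar>Re d\<bar> + \<bar>Im d\<bar>" by (rule cmod_le)
      finally have "\<exists>w\<in>W. Re (w * d) > c" by (auto simp: W_def)
      then obtain w where w: "w \<in> W" "Re (w * d) > c" by blast
      have "cmod w = 1" using w(1) by (auto simp: W_def)
      then have "\<bar>Re (w * q t)\<bar> \<le> cmod (q t)"
        using abs_Re_le_cmod[of "w * q t"] by (simp add: norm_mult)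
      then have "t \<in> E w" using t w(2) unfolding E_def mem_Collect_eq qw q1w d_def by auto
      then show ?thesis using w(1) by blast
    qed (use t in auto)
  qed
  have [measurable]: "q1 \<in> borel_measurable borel"
    unfolding q1_def by (intro borel_measurable_continuous_onI continuous_intros)
  have [measurable]: "E w \<in> sets borel" for w
  proof -
    have [measurable]: "(\<lambda>t. Re (w * a0 + (\<Sum>n\<in>A. (w * a n) * cis (2 * pi * real n * t)))) \<in> borel_measurable borel"
      by (intro borel_measurable_continuous_onI continuous_intros)
    have [measurable]: "(\<lambda>t. Re (\<Sum>n\<in>A. (w * a n) * \<i> * of_real (2 * pi * real n) * cis (2 * pi * real n * t))) \<in> borel_measurable borel"
      by (intro borel_measurable_continuous_onI continuous_intros)
    show ?thesis unfolding E_def by measurable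
  qed
  have "emeasure lborel {t \<in> {0..<1}. cmod (q t) \<le> y}
      \<le> emeasure lborel ({t \<in> {0..<1}. cmod (q1 t) \<le> s} \<union> (\<Union>w\<in>W. E w))"
    using cover by (rule emeasure_mono) (simp add: W_def)
  also have "\<dots> \<le> emeasure lborel {t \<in> {0..<1}. cmod (q1 t) \<le> s} + emeasure lborel (\<Union>w\<in>W. E w)"
    by (intro emeasure_subadditive) (auto simp: W_def)
  also have "emeasure lborel (\<Union>w\<in>W. E w) \<le> (\<Sum>w\<in>W. emeasure lborel (E w))"
    by (intro emeasure_subadditive_finite) (auto simp: W_def)
  also have "\<dots> \<le> (\<Sum>w\<in>W. ennreal (2 * y / s))"
    by (intro sum_mono Ew)
  also have "\<dots> = ennreal (real (card W) * (2 * y / s))"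
    using assms by (simp add: ennreal_of_nat_eq_real_of_nat flip: ennreal_mult)
  also have "\<dots> \<le> ennreal (8 * y / s)"
  proof (rule ennreal_leI)
    have "card W \<le> 4" unfolding W_def by (simp add: card_insert_if)
    then have "real (card W) * (2 * y / s) \<le> 4 * (2 * y / s)"
      using assms by (intro mult_right_mono) auto
    then show "real (card W) * (2 * y / s) \<le> 8 * y / s" by simp
  qed
  finally show ?thesis by (simp add: q_def q1_def add_left_mono)
qed

lemma emeasure_unit_interval_subset_le: "emeasure lborel {t \<in> {0..<1::real}. Q t} \<le> 1"
proof -
  have "emeasure lborel {t \<in> {0..<1::real}. Q t} \<le> emeasure lborel {0..<1::real}"
    by (intro emeasure_mono) auto
  then show ?thesis by simp
qed

text \<open>Taking \<open>s\<close> as the square root of \<open>y\<close> in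
  \<open>lawton_step\<close> makes the extra term \<open>8 * y / s\<close> equal to
  \<open>8 * s\<close>. Each further term therefore halves the exponent and adds 8 to the constant,
  which gives \<delta> = 2^(1-k) and C = 8k - 7. The clause \<open>\<delta> \<le> 1\<close> is
  carried along to compare the two powers of \<open>y\<close> for \<open>y < 1\<close>.\<close>

lemma lawton:
  assumes "k \<ge> 1"
  shows "\<exists>C>0. \<exists>\<delta>>0. \<delta> \<le> 1 \<and> (\<forall>A (a :: nat \<Rightarrow> complex) y. finite A \<longrightarrow> card A = k \<longrightarrow> cmod (a (Max A)) \<ge> 1 \<longrightarrow> y > 0 \<longrightarrow>
    emeasure lborel {t \<in> {0..<1}. cmod (\<Sum>n\<in>A. a n * cis (2 * pi * real n * t)) \<le> y} \<le> ennreal (C * y powr \<delta>))"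
  using assms
proof (induction k rule: nat_induct_at_least)
  case base
  have "emeasure lborel {t \<in> {0..<1}. cmod (\<Sum>n\<in>A. a n * cis (2 * pi * real n * t)) \<le> y} \<le> ennreal (1 * y powr 1)"
    if A: "finite A" "card A = 1" "cmod (a (Max A)) \<ge> 1" "y > 0" for A and a :: "nat \<Rightarrow> complex" and y
  proof (cases "y < 1")
    case True
    obtain n where n: "A = {n}" using A(2) by (auto simp: card_1_singleton_iff)
    have "{t \<in> {0..<1}. cmod (\<Sum>n\<in>A. a n * cis (2 * pi * real n * t)) \<le> y} = {}"
      using A True n by (auto simp: norm_mult)
    then show ?thesis by (simp only: emeasure_empty zero_le)
  next
    case False
    then have "1 \<le> ennreal (1 * y powr 1)" using A by simp
    then show ?thesis by (rule order.trans[OF emeasure_unit_interval_subset_le])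
  qed
  then show ?case by (intro exI[of _ 1] conjI) auto
next
  case (Suc k)
  then obtain C \<delta> where C: "C > 0" "\<delta> > 0" "\<delta> \<le> 1" and
    "\<forall>A (a :: nat \<Rightarrow> complex) y. finite A \<longrightarrow> card A = k \<longrightarrow> cmod (a (Max A)) \<ge> 1 \<longrightarrow> y > 0 \<longrightarrow>
      emeasure lborel {t \<in> {0..<1}. cmod (\<Sum>n\<in>A. a n * cis (2 * pi * real n * t)) \<le> y} \<le> ennreal (C * y powr \<delta>)"
    by (elim exE conjE)
  note IH = this(4)[rule_format]
  have "emeasure lborel {t \<in> {0..<1}. cmod (\<Sum>n\<in>A. a n * cis (2 * pi * real n * t)) \<le> y} \<le> ennreal ((C + 8) * y powr (\<delta> / 2))"
    if A: "finite A" "card A = Suc k" "cmod (a (Max A)) \<ge> 1" "y > 0" for A and a :: "nat \<Rightarrow> complex" and y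
  proof (cases "y < 1")
    case True
    define j where "j = Min A"
    define B where "B = (\<lambda>n. n - j) ` (A - {j})"
    have "A \<noteq> {}" using A by auto
    then have jA: "j \<in> A" and jle: "\<And>n. n \<in> A \<Longrightarrow> j \<le> n" using A by (auto simp: j_def)
    have inj: "inj_on (\<lambda>n. n - j) (A - {j})" using jle by (intro inj_onI) (metis DiffD1 eq_diff_iff)
    have finB: "finite B" using A by (simp add: B_def)
    have cardB: "card B = k" using A jA inj by (simp add: B_def card_image)
    have B1: "B \<subseteq> {1..}" using jle by (auto simp: B_def) (metis le_neq_implies_less Suc_leI zero_less_diff)
    have "B \<noteq> {}" using cardB Suc.hyps by auto
    have MA: "Max A \<in> A - {j}"
    proof -
      obtain b where "b \<in> B" using \<open>B \<noteq> {}\<close> by blast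
      then obtain n where n: "n \<in> A" "n \<noteq> j" by (auto simp: B_def)
      then have "j < n" using jle[of n] by simp
      also have "n \<le> Max A" using n A by simp
      finally show ?thesis using A \<open>A \<noteq> {}\<close> by simp
    qed
    have MB: "Max B = Max A - j"
      using MA A by (intro Max_eqI) (auto simp: B_def diff_le_mono)
    have N1: "Max B \<ge> 1" using B1 Max_in[OF finB \<open>B \<noteq> {}\<close>] by auto
    define a' where "a' n = a (n + j)" for n
    have sumB: "(\<Sum>n\<in>A. a n * cis (2 * pi * real n * t))
        = cis (2 * pi * real j * t) * (a j + (\<Sum>n\<in>B. a' n * cis (2 * pi * real n * t)))" for t
    proof -
      have "(\<Sum>n\<in>B. a' n * cis (2 * pi * real n * t)) = (\<Sum>n\<in>A - {j}. a n * cis (2 * pi * real (n - j) * t))"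
        unfolding B_def using inj jle by (subst sum.reindex) (auto simp: a'_def intro!: sum.cong)
      moreover have "cis (2 * pi * real j * t) * (\<Sum>n\<in>A - {j}. a n * cis (2 * pi * real (n - j) * t))
          = (\<Sum>n\<in>A - {j}. a n * cis (2 * pi * real n * t))"
        unfolding sum_distrib_left
      proof (intro sum.cong refl)
        fix n assume "n \<in> A - {j}"
        then have "j \<le> n" using jle by auto
        then have "2 * pi * real j * t + 2 * pi * real (n - j) * t = 2 * pi * real n * t"
          by (simp add: algebra_simps)
        then have "cis (2 * pi * real j * t) * cis (2 * pi * real (n - j) * t) = cis (2 * pi * real n * t)"
          by (simp add: cis_mult)
        then show "cis (2 * pi * real j * t) * (a n * cis (2 * pi * real (n - j) * t)) = a n * cis (2 * pi * real n * t)"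
          by (metis mult.left_commute)
      qed
      ultimately show ?thesis
        using A(1) jA by (simp add: sum.remove[of A j] distrib_left mult.commute)
    qed
    have "emeasure lborel {t \<in> {0..<1}. cmod (\<Sum>n\<in>A. a n * cis (2 * pi * real n * t)) \<le> y}
        = emeasure lborel {t \<in> {0..<1}. cmod (a j + (\<Sum>n\<in>B. a' n * cis (2 * pi * real n * t))) \<le> y}"
      by (simp add: sumB norm_mult)
    also have "\<dots> \<le> emeasure lborel {t \<in> {0..<1}. cmod (\<Sum>n\<in>B. (a' n * of_real (real n / real (Max B))) * cis (2 * pi * real n * t)) \<le> y powr (1/2)}
        + ennreal (8 * y / y powr (1/2))"
      using A finB \<open>B \<noteq> {}\<close> B1 by (intro lawton_step) auto
    also have "emeasure lborel {t \<in> {0..<1}. cmod (\<Sum>n\<in>B. (a' n * of_real (real n / real (Max B))) * cis (2 * pi * real n * t)) \<le> y powr (1/2)}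
        \<le> ennreal (C * (y powr (1/2)) powr \<delta>)"
    proof (rule IH[OF finB cardB])
      \<comment> \<open>The normalising factor \<open>n / Max B\<close> is 1 at the top exponent, so
        the leading coefficient is unchanged.\<close>
      have "Max B + j = Max A" using MB MA jle[of "Max A"] by auto
      then show "1 \<le> cmod (a' (Max B) * of_real (real (Max B) / real (Max B)))"
        using N1 A(3) by (simp add: a'_def)
    qed (use A in auto)
    also have "ennreal (C * (y powr (1/2)) powr \<delta>) + ennreal (8 * y / y powr (1/2))
        = ennreal (C * y powr (\<delta>/2) + 8 * y powr (1/2))"
    proof -
      have "y / y powr (1/2) = y powr (1/2)"
        using A(4) by (simp add: powr_half_sqrt real_div_sqrt)
      then have "8 * y / y powr (1/2) = 8 * y powr (1/2)" by (metis times_divide_eq_right)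
      then show ?thesis using C A by (simp add: powr_powr mult.commute)
    qed
    also have "\<dots> \<le> ennreal ((C + 8) * y powr (\<delta> / 2))"
    proof (rule ennreal_leI)
      have "y powr (1/2) \<le> y powr (\<delta>/2)" using C A True by (intro powr_mono') auto
      then show "C * y powr (\<delta>/2) + 8 * y powr (1/2) \<le> (C + 8) * y powr (\<delta> / 2)"
        by (simp add: algebra_simps)
    qed
    finally show ?thesis by (simp add: add_right_mono)
  next
    case False
    then have "1 \<le> y powr (\<delta>/2)" using C by (simp add: ge_one_powr_ge_zero)
    then have "1 * 1 \<le> (C + 8) * y powr (\<delta> / 2)" using C by (intro mult_mono) auto
    then have "1 \<le> ennreal ((C + 8) * y powr (\<delta> / 2))" by simp
    then show ?thesis by (rule order.trans[OF emeasure_unit_interval_subset_le])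
  qed
  then show ?case using C by (intro exI[of _ "C + 8"] conjI exI[of _ "\<delta> / 2"]) auto
qed

section \<open>Truncated Mahler measures\<close>

text \<open>The cut-off turns log 0 into \<open>- n\<close>, so for bounded measurable
  \<open>f\<close> on a finite measure space this is a genuine real integral, and the integrand is a
  continuous function of the squared modulus.\<close>

definition trunc_mahler :: "'a measure \<Rightarrow> nat \<Rightarrow> ('a \<Rightarrow> complex) \<Rightarrow> real" where
  "trunc_mahler M n f = (\<integral>x. ln (max (exp (- real n)) (cmod (f x))) \<partial>M)"

lemma max_exp_pos: "0 < max (exp a) (r :: real)"
  by (simp add: less_max_iff_disj)

lemma ln_max_exp_bounds:
  assumes "0 \<le> r" "r \<le> L"
  shows "- real n \<le> ln (max (exp (- real n)) r)" "ln (max (exp (- real n)) r) \<le> ln (max 1 L)"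
proof -
  have "ln (exp (- real n)) \<le> ln (max (exp (- real n)) r)" by (rule ln_mono) auto
  then show "- real n \<le> ln (max (exp (- real n)) r)" by simp
  have "exp (- real n) \<le> 1" by simp
  then show "ln (max (exp (- real n)) r) \<le> ln (max 1 L)"
    using assms by (intro ln_mono max_exp_pos max.mono)
qed

lemma integrable_ln_max_exp:
  assumes "finite_measure M" and [measurable]: "f \<in> borel_measurable M"
    and "\<And>x. x \<in> space M \<Longrightarrow> cmod (f x) \<le> L"
  shows "integrable M (\<lambda>x. ln (max (exp (- real n)) (cmod (f x))))"
proof -
  interpret finite_measure M by fact
  show ?thesis
  proof (rule integrable_const_bound)
    show "AE x in M. norm (ln (max (exp (- real n)) (cmod (f x)))) \<le> real n + ln (max 1 L)"
    proof (rule AE_I2)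
      fix x assume "x \<in> space M"
      then have "- real n \<le> ln (max (exp (- real n)) (cmod (f x)))"
        "ln (max (exp (- real n)) (cmod (f x))) \<le> ln (max 1 L)"
        using assms(3) by (auto intro!: ln_max_exp_bounds)
      moreover have "0 \<le> ln (max 1 L)" by simp
      ultimately show "norm (ln (max (exp (- real n)) (cmod (f x)))) \<le> real n + ln (max 1 L)"
        unfolding real_norm_def abs_le_iff by linarith
    qed
  qed measurable
qed

text \<open>The truncated logarithm is the positive part minus the negative part capped at
  \<open>n\<close>. Monotone convergence handles the latter, and the positive part has a finite
  integral by the bound \<open>L\<close>, so the difference of limits makes sense in
  \<open>ereal\<close>.\<close>

lemma trunc_mahler_tendsto_mahler:
  assumes "finite_measure M" and [measurable]: "f \<in> borel_measurable M"
    and bound: "\<And>x. x \<in> space M \<Longrightarrow> cmod (f x) \<le> L"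
  shows "(\<lambda>n. ereal (trunc_mahler M n f)) \<longlonglongrightarrow> mahler M f"
proof -
  interpret finite_measure M by fact
  define h where "h n x = (if f x = 0 then real n else min (real n) (max 0 (- ln (cmod (f x)))))" for n x
  define g where "g x = max 0 (ln (cmod (f x)))" for x
  have [measurable]: "h n \<in> borel_measurable M" for n unfolding h_def by measurable
  have [measurable]: "g \<in> borel_measurable M" unfolding g_def by measurable
  have h0: "h n x \<ge> 0" for n x by (simp add: h_def)
  have g0: "g x \<ge> 0" for x by (simp add: g_def)
  have inth: "integrable M (h n)" for n
    by (rule integrable_const_bound[of _ "real n"]) (auto simp: h_def)
  have intg: "integrable M g"
  proof (rule integrable_const_bound[of _ "ln (max 1 L)"])
    show "AE x in M. norm (g x) \<le> ln (max 1 L)"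
    proof (rule AE_I2)
      fix x assume "x \<in> space M"
      then have "ln (cmod (f x)) \<le> ln (max 1 L)" if "f x \<noteq> 0"
        using bound[of x] that by (intro ln_mono) auto
      then show "norm (g x) \<le> ln (max 1 L)"
        by (cases "f x = 0") (simp_all add: g_def)
    qed
  qed measurable
  have split: "ln (max (exp (- real n)) (cmod (f x))) = g x - h n x" for n x
  proof (cases "f x = 0")
    case False
    define l where "l = ln (cmod (f x))"
    have "max (exp (- real n)) (cmod (f x)) = exp (max (- real n) l)"
    proof -
      have "cmod (f x) = exp l" using False by (simp add: l_def)
      then show ?thesis by (simp add: max_def)
    qed
    then have "ln (max (exp (- real n)) (cmod (f x))) = max (- real n) l" by simp
    then show ?thesis using False by (auto simp: g_def h_def l_def)
  qed (simp add: g_def h_def max_def)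
  have tr: "trunc_mahler M n f = integral\<^sup>L M g - integral\<^sup>L M (h n)" for n
    unfolding trunc_mahler_def split using intg inth by simp
  have nnh: "enn2ereal (\<integral>\<^sup>+x. ennreal (h n x) \<partial>M) = ereal (integral\<^sup>L M (h n))" for n
    using inth h0 by (subst nn_integral_eq_integral) (auto simp: integral_nonneg)
  have nng: "enn2ereal (\<integral>\<^sup>+x. (if f x = 0 then 0 else ennreal (max 0 (ln (cmod (f x))))) \<partial>M) = ereal (integral\<^sup>L M g)"
  proof -
    have "(\<integral>\<^sup>+x. (if f x = 0 then 0 else ennreal (max 0 (ln (cmod (f x))))) \<partial>M) = (\<integral>\<^sup>+x. ennreal (g x) \<partial>M)"
      by (intro nn_integral_cong) (auto simp: g_def)
    then show ?thesis
      using intg g0 by (simp add: nn_integral_eq_integral integral_nonneg)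
  qed
  have mono: "incseq (\<lambda>n x. ennreal (h n x))"
    by (intro incseq_SucI le_funI ennreal_leI) (auto simp: h_def)
  have sup: "(SUP n. ennreal (h n x)) = (if f x = 0 then \<infinity> else ennreal (max 0 (- ln (cmod (f x)))))" for x
  proof (cases "f x = 0")
    case True
    then show ?thesis using ennreal_SUP_of_nat_eq_top by (simp add: h_def ennreal_of_nat_eq_real_of_nat[symmetric])
  next
    case False
    define l where "l = max 0 (- ln (cmod (f x)))"
    obtain N :: nat where N: "l \<le> real N" using real_arch_simple by blast
    have "(SUP n. ennreal (h n x)) = ennreal l"
    proof (rule antisym)
      show "(SUP n. ennreal (h n x)) \<le> ennreal l"
        using False by (intro SUP_least ennreal_leI) (auto simp: h_def l_def)
      have "h N x = l" using N False by (auto simp: h_def l_def)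
      then show "ennreal l \<le> (SUP n. ennreal (h n x))" by (metis SUP_upper UNIV_I)
    qed
    then show ?thesis using False by (simp add: l_def)
  qed
  have "(\<lambda>n. \<integral>\<^sup>+x. ennreal (h n x) \<partial>M) \<longlonglongrightarrow> (SUP n. \<integral>\<^sup>+x. ennreal (h n x) \<partial>M)"
    using mono by (intro LIMSEQ_SUP) (auto simp: incseq_def le_fun_def intro!: nn_integral_mono)
  also have "(SUP n. \<integral>\<^sup>+x. ennreal (h n x) \<partial>M) = (\<integral>\<^sup>+x. (SUP n. ennreal (h n x)) \<partial>M)"
    using mono by (subst nn_integral_monotone_convergence_SUP) auto
  finally have "(\<lambda>n. enn2ereal (\<integral>\<^sup>+x. ennreal (h n x) \<partial>M))
      \<longlonglongrightarrow> enn2ereal (\<integral>\<^sup>+x. (if f x = 0 then \<infinity> else ennreal (max 0 (- ln (cmod (f x))))) \<partial>M)"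
    unfolding sup by (rule tendsto_enn2erealI)
  then have "(\<lambda>n. ereal (integral\<^sup>L M g) - enn2ereal (\<integral>\<^sup>+x. ennreal (h n x) \<partial>M))
      \<longlonglongrightarrow> ereal (integral\<^sup>L M g) - enn2ereal (\<integral>\<^sup>+x. (if f x = 0 then \<infinity> else ennreal (max 0 (- ln (cmod (f x))))) \<partial>M)"
    by (intro tendsto_diff_ereal_general tendsto_const) auto
  then show ?thesis by (simp add: nnh nng mahler_def tr)
qed

text \<open>The two integrands differ only where \<open>cmod (f x) \<le> exp (- n)\<close>. There
  one equals \<open>- n\<close> and the other is at least \<open>- n - 1\<close>, so the gap is at
  most the measure of that set.\<close>

lemma trunc_mahler_Suc:
  assumes "finite_measure M" and [measurable]: "f \<in> borel_measurable M"
    and bound: "\<And>x. x \<in> space M \<Longrightarrow> cmod (f x) \<le> L"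
  shows "trunc_mahler M (Suc n) f \<le> trunc_mahler M n f"
    "trunc_mahler M n f - trunc_mahler M (Suc n) f \<le> measure M {x \<in> space M. cmod (f x) \<le> exp (- real n)}"
proof -
  interpret finite_measure M by fact
  have int: "integrable M (\<lambda>x. ln (max (exp (- real n)) (cmod (f x))))" for n
    by (rule integrable_ln_max_exp) (use assms in auto)
  have le: "ln (max (exp (- real (Suc n))) r) \<le> ln (max (exp (- real n)) r)" for r
    by (intro ln_mono max_exp_pos max.mono) auto
  show "trunc_mahler M (Suc n) f \<le> trunc_mahler M n f"
    unfolding trunc_mahler_def by (intro integral_mono int le)
  let ?A = "{x \<in> space M. cmod (f x) \<le> exp (- real n)}"
  have "trunc_mahler M n f - trunc_mahler M (Suc n) f
      = (\<integral>x. ln (max (exp (- real n)) (cmod (f x))) - ln (max (exp (- real (Suc n))) (cmod (f x))) \<partial>M)"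
    unfolding trunc_mahler_def by (intro Bochner_Integration.integral_diff[symmetric] int)
  also have "\<dots> \<le> (\<integral>x. indicat_real ?A x \<partial>M)"
  proof (rule integral_mono)
    fix x assume x: "x \<in> space M"
    show "ln (max (exp (- real n)) (cmod (f x))) - ln (max (exp (- real (Suc n))) (cmod (f x))) \<le> indicat_real ?A x"
    proof (cases "cmod (f x) \<le> exp (- real n)")
      case True
      then have "ln (max (exp (- real n)) (cmod (f x))) = - real n" by (simp add: max_def)
      moreover have "- real (Suc n) \<le> ln (max (exp (- real (Suc n))) (cmod (f x)))"
        using ln_max_exp_bounds(1)[of "cmod (f x)" "cmod (f x)" "Suc n"] by simp
      ultimately show ?thesis using True x by simp
    next
      case False
      moreover have "exp (- real (Suc n)) \<le> exp (- real n)" by simp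
      ultimately have "max (exp (- real n)) (cmod (f x)) = cmod (f x)" "max (exp (- real (Suc n))) (cmod (f x)) = cmod (f x)"
        by linarith+
      then show ?thesis by simp
    qed
  qed (intro Bochner_Integration.integrable_diff int integrable_real_indicator; simp add: less_top[symmetric])+
  also have "\<dots> = measure M ?A" by simp
  finally show "trunc_mahler M n f - trunc_mahler M (Suc n) f \<le> measure M ?A" .
qed

lemma mahler_le_trunc_mahler:
  assumes "finite_measure M" "f \<in> borel_measurable M"
    and "\<And>x. x \<in> space M \<Longrightarrow> cmod (f x) \<le> L"
  shows "mahler M f \<le> ereal (trunc_mahler M n f)"
proof (rule decseq_ge)
  show "decseq (\<lambda>n. ereal (trunc_mahler M n f))"
    using trunc_mahler_Suc(1)[OF assms] by (intro decseq_SucI) simp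
  show "(\<lambda>n. ereal (trunc_mahler M n f)) \<longlonglongrightarrow> mahler M f"
    by (rule trunc_mahler_tendsto_mahler[OF assms])
qed

text \<open>The gaps between consecutive levels are bounded by a geometric sequence of ratio
  \<open>exp (- \<delta>)\<close>; the subtracted term is the sum of its tail from \<open>n\<close>
  on.\<close>

lemma trunc_mahler_le_mahler:
  assumes "finite_measure M" "f \<in> borel_measurable M"
    and "\<And>x. x \<in> space M \<Longrightarrow> cmod (f x) \<le> L"
    and small: "\<And>y. y > 0 \<Longrightarrow> measure M {x \<in> space M. cmod (f x) \<le> y} \<le> C * y powr \<delta>"
    and "C > 0" "\<delta> > 0"
  shows "ereal (trunc_mahler M n f - C * exp (- \<delta>) ^ n / (1 - exp (- \<delta>))) \<le> mahler M f"
proof -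
  define e where "e = exp (- \<delta>)"
  have e: "0 < e" "e < 1" using \<open>\<delta> > 0\<close> by (auto simp: e_def)
  have step: "trunc_mahler M k f - trunc_mahler M (Suc k) f \<le> C * e ^ k" for k
  proof -
    have "exp (- real k) powr \<delta> = e ^ k" by (simp add: e_def powr_def mult.commute flip: exp_of_nat_mult)
    then show ?thesis
      using trunc_mahler_Suc(2)[OF assms(1-3), of k] small[of "exp (- real k)"] by simp
  qed
  have "trunc_mahler M n f - trunc_mahler M (n + k) f \<le> C * e ^ n * (1 - e ^ k) / (1 - e)" for k
  proof (induction k)
    case (Suc k)
    have "C * e ^ n * (1 - e ^ k) / (1 - e) + C * e ^ (n + k) = C * e ^ n * (1 - e ^ Suc k) / (1 - e)"
      using e by (simp add: divide_simps power_add) (simp add: algebra_simps)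
    then show ?case using Suc step[of "n + k"] by simp
  qed simp
  moreover have "C * e ^ n * (1 - e ^ k) / (1 - e) \<le> C * e ^ n / (1 - e)" for k
    using e \<open>C > 0\<close> by (intro divide_right_mono) (auto simp: mult_le_cancel_left1)
  ultimately have "trunc_mahler M n f - C * e ^ n / (1 - e) \<le> trunc_mahler M (n + k) f" for k
    by (smt (verit))
  then have "\<forall>k. ereal (trunc_mahler M n f - C * e ^ n / (1 - e)) \<le> ereal (trunc_mahler M (k + n) f)"
    by (simp add: add.commute)
  moreover have "(\<lambda>k. ereal (trunc_mahler M (k + n) f)) \<longlonglongrightarrow> mahler M f"
    by (rule LIMSEQ_ignore_initial_segment[OF trunc_mahler_tendsto_mahler[OF assms(1-3)]])
  ultimately show ?thesis unfolding e_def by (intro LIMSEQ_le_const) auto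
qed

text \<open>\<open>J\<close> is the degree of a polynomial approximating the truncated logarithm of
  the square root on the interval from 0 to \<open>L\<close> squared. It is fixed before the
  measures and functions are, which allows the second function to be constructed afterwards from its
  moments.\<close>

lemma trunc_mahler_determined_by_moments:
  assumes "e > 0"
  shows "\<exists>J::nat. \<forall>(M :: 'a measure) (M' :: 'b measure) f f'.
    emeasure M (space M) = 1 \<longrightarrow> emeasure M' (space M') = 1 \<longrightarrow>
    f \<in> borel_measurable M \<longrightarrow> f' \<in> borel_measurable M' \<longrightarrow>
    (\<forall>x\<in>space M. cmod (f x) \<le> L) \<longrightarrow> (\<forall>x\<in>space M'. cmod (f' x) \<le> L) \<longrightarrow>
    (\<forall>j\<le>J. (\<integral>x. ((cmod (f x))\<^sup>2) ^ j \<partial>M) = (\<integral>x. ((cmod (f' x))\<^sup>2) ^ j \<partial>M')) \<longrightarrow>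
    \<bar>trunc_mahler M n f - trunc_mahler M' n f'\<bar> \<le> e"
proof -
  define h where "h s = ln (max (exp (- real n)) (sqrt s))" for s
  have "continuous_on {0..L\<^sup>2} h"
    unfolding h_def by (intro continuous_intros) (use max_exp_pos in \<open>auto simp: less_le\<close>)
  then obtain p where p: "real_polynomial_function p" "\<And>s. s \<in> {0..L\<^sup>2} \<Longrightarrow> \<bar>h s - p s\<bar> < e / 2"
    using Stone_Weierstrass_real_polynomial_function[of "{0..L\<^sup>2}" h "e / 2"] \<open>e > 0\<close> by auto
  obtain a J where pa: "p = (\<lambda>s. \<Sum>i\<le>J. a i * s ^ i)"
    using p(1) unfolding real_polynomial_function_iff_sum by blast
  \<comment> \<open>Stated for a type of points of its own, because it is used for both measures.
    Each side contributes half of the error.\<close>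
  have approx: "\<bar>trunc_mahler M n f - (\<Sum>i\<le>J. a i * (\<integral>x. ((cmod (f x))\<^sup>2) ^ i \<partial>M))\<bar> \<le> e / 2"
    if M: "emeasure M (space M) = 1" and [measurable]: "f \<in> borel_measurable M"
      and L: "\<forall>x\<in>space M. cmod (f x) \<le> L" for M :: "'z measure" and f
  proof -
    interpret finite_measure M by (rule finite_measureI) (simp add: M)
    have M1: "measure M (space M) = 1" using M by (simp add: measure_def)
    have int: "integrable M (\<lambda>x. ((cmod (f x))\<^sup>2) ^ i)" for i
    proof (rule integrable_const_bound[of _ "(L\<^sup>2) ^ i"])
      show "AE x in M. norm (((cmod (f x))\<^sup>2) ^ i) \<le> (L\<^sup>2) ^ i"
        using L by (intro AE_I2) (auto intro!: power_mono)
    qed measurable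
    have intl: "integrable M (\<lambda>x. ln (max (exp (- real n)) (cmod (f x))))"
      by (rule integrable_ln_max_exp[where L = L]) (use L finite_measure_axioms in auto)
    have intp: "integrable M (\<lambda>x. p ((cmod (f x))\<^sup>2))"
      unfolding pa by (intro Bochner_Integration.integrable_sum integrable_mult_right int)
    have "(\<Sum>i\<le>J. a i * (\<integral>x. ((cmod (f x))\<^sup>2) ^ i \<partial>M)) = (\<integral>x. p ((cmod (f x))\<^sup>2) \<partial>M)"
      unfolding pa using int by (subst Bochner_Integration.integral_sum) auto
    then have "\<bar>trunc_mahler M n f - (\<Sum>i\<le>J. a i * (\<integral>x. ((cmod (f x))\<^sup>2) ^ i \<partial>M))\<bar>
        = \<bar>\<integral>x. ln (max (exp (- real n)) (cmod (f x))) - p ((cmod (f x))\<^sup>2) \<partial>M\<bar>"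
      unfolding trunc_mahler_def by (simp add: Bochner_Integration.integral_diff[OF intl intp])
    also have "\<dots> \<le> (\<integral>x. \<bar>ln (max (exp (- real n)) (cmod (f x))) - p ((cmod (f x))\<^sup>2)\<bar> \<partial>M)"
      by (rule integral_abs_bound)
    also have "\<dots> \<le> (\<integral>x. e / 2 \<partial>M)"
    proof (rule integral_mono)
      fix x assume "x \<in> space M"
      then have "(cmod (f x))\<^sup>2 \<in> {0..L\<^sup>2}" using L by (auto intro!: power_mono)
      from p(2)[OF this] show "\<bar>ln (max (exp (- real n)) (cmod (f x))) - p ((cmod (f x))\<^sup>2)\<bar> \<le> e / 2"
        by (simp add: h_def)
    qed (use intl intp in auto)
    also have "\<dots> = e / 2" by (simp add: M1)
    finally show ?thesis .
  qed
  show ?thesis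
  proof (intro exI[of _ J] allI impI)
    fix M :: "'a measure" and M' :: "'b measure" and f f'
    assume A: "emeasure M (space M) = 1" "emeasure M' (space M') = 1" "f \<in> borel_measurable M" "f' \<in> borel_measurable M'"
      "\<forall>x\<in>space M. cmod (f x) \<le> L" "\<forall>x\<in>space M'. cmod (f' x) \<le> L"
      and m: "\<forall>j\<le>J. (\<integral>x. ((cmod (f x))\<^sup>2) ^ j \<partial>M) = (\<integral>x. ((cmod (f' x))\<^sup>2) ^ j \<partial>M')"
    have "(\<Sum>i\<le>J. a i * (\<integral>x. ((cmod (f x))\<^sup>2) ^ i \<partial>M)) = (\<Sum>i\<le>J. a i * (\<integral>x. ((cmod (f' x))\<^sup>2) ^ i \<partial>M'))"
      using m by (intro sum.cong) auto
    with approx[OF A(1,3,5)] approx[OF A(2,4,6)]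
    show "\<bar>trunc_mahler M n f - trunc_mahler M' n f'\<bar> \<le> e" by linarith
  qed
qed

section \<open>Moments of integer combinations as sums over monomials\<close>

lemma power_int_sum:
  fixes z :: "'a::field"
  assumes "z \<noteq> 0"
  shows "z powi (\<Sum>k\<in>A. e k) = (\<Prod>k\<in>A. z powi e k)"
  using assms by (induction A rule: infinite_finite_induct) (auto simp: power_int_add)

definition monomial :: "'i set \<Rightarrow> ('i \<Rightarrow> 'a \<Rightarrow> complex) \<Rightarrow> ('i \<Rightarrow> int) \<Rightarrow> 'a \<Rightarrow> complex" where
  "monomial F \<phi> a x = (\<Prod>i\<in>F. \<phi> i x powi a i)"

text \<open>The exponent vector of the product of \<open>\<phi> (p 0)\<close>, \<open>cnj (\<phi> (p 1))\<close>, \<open>\<phi> (p 2)\<close>, ...\<close>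

definition path_vec :: "nat \<Rightarrow> (nat \<Rightarrow> 'i) \<Rightarrow> 'i \<Rightarrow> int" where
  "path_vec n p i = (\<Sum>k | k < n \<and> p k = i. if even k then 1 else -1)"

text \<open>The left side is a product of \<open>2 * j\<close> factors, alternately the sum and its
  conjugate. A function \<open>p\<close> selects one term from each factor; conjugates of unimodular
  values are inverses, and collecting equal indices produces the exponent vector.\<close>

lemma norm_power_expand:
  fixes c :: "'i \<Rightarrow> int" and \<phi> :: "'i \<Rightarrow> 'a \<Rightarrow> complex"
  assumes "finite F" and norm1: "\<And>i. i \<in> F \<Longrightarrow> cmod (\<phi> i x) = 1"
  shows "complex_of_real (((cmod (\<Sum>i\<in>F. of_int (c i) * \<phi> i x))\<^sup>2) ^ j)
    = (\<Sum>p\<in>PiE {..<2 * j} (\<lambda>_. F). (\<Prod>k<2 * j. of_int (c (p k))) * monomial F \<phi> (path_vec (2 * j) p) x)"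
proof -
  define s where "s k = (if even k then 1 else -1 :: int)" for k :: nat
  define z where "z = (\<Sum>i\<in>F. of_int (c i) * \<phi> i x)"
  have inv: "cnj (\<phi> i x) = \<phi> i x powi (-1)" if "i \<in> F" for i
  proof -
    have "\<phi> i x * cnj (\<phi> i x) = 1" using norm1[OF that] by (simp flip: complex_norm_square)
    moreover have "\<phi> i x \<noteq> 0" using norm1[OF that] by auto
    ultimately show ?thesis by (simp add: field_simps power_int_minus)
  qed
  have "complex_of_real (((cmod z)\<^sup>2) ^ j) = (z * cnj z) ^ j"
    by (metis complex_norm_square of_real_power)
  also have "\<dots> = (\<Prod>k<2 * j. if even k then z else cnj z)"
    by (induction j) (auto simp: mult_ac)
  also have "\<dots> = (\<Prod>k<2 * j. \<Sum>i\<in>F. of_int (c i) * \<phi> i x powi s k)"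
    by (intro prod.cong) (auto simp: z_def s_def inv)
  also have "\<dots> = (\<Sum>p\<in>PiE {..<2 * j} (\<lambda>_. F). \<Prod>k<2 * j. of_int (c (p k)) * \<phi> (p k) x powi s k)"
    using assms(1) by (intro prod_sum_PiE) auto
  also have "\<dots> = (\<Sum>p\<in>PiE {..<2 * j} (\<lambda>_. F). (\<Prod>k<2 * j. of_int (c (p k))) * monomial F \<phi> (path_vec (2 * j) p) x)"
  proof (intro sum.cong refl)
    fix p assume p: "p \<in> PiE {..<2 * j} (\<lambda>_. F)"
    have "monomial F \<phi> (path_vec (2 * j) p) x = (\<Prod>i\<in>F. \<Prod>k | k \<in> {..<2 * j} \<and> p k = i. \<phi> i x powi s k)"
      unfolding monomial_def
    proof (intro prod.cong refl)
      fix i assume "i \<in> F"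
      then have "\<phi> i x \<noteq> 0" using norm1 by fastforce
      then show "\<phi> i x powi path_vec (2 * j) p i = (\<Prod>k | k \<in> {..<2 * j} \<and> p k = i. \<phi> i x powi s k)"
        unfolding path_vec_def s_def by (subst power_int_sum) auto
    qed
    also have "\<dots> = (\<Prod>i\<in>F. \<Prod>k | k \<in> {..<2 * j} \<and> p k = i. \<phi> (p k) x powi s k)"
      by (intro prod.cong) auto
    also have "\<dots> = (\<Prod>k<2 * j. \<phi> (p k) x powi s k)"
      using p assms(1) by (intro prod.group) auto
    finally show "(\<Prod>k<2 * j. of_int (c (p k)) * \<phi> (p k) x powi s k)
        = (\<Prod>k<2 * j. of_int (c (p k))) * monomial F \<phi> (path_vec (2 * j) p) x"
      by (simp add: prod.distrib)
  qed
  finally show ?thesis by (simp add: z_def)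
qed

lemma moment_expand:
  fixes c :: "'i \<Rightarrow> int" and \<phi> :: "'i \<Rightarrow> 'a \<Rightarrow> complex"
  assumes "finite F" "finite_measure M"
    and norm1: "\<And>i x. i \<in> F \<Longrightarrow> cmod (\<phi> i x) = 1"
    and [measurable]: "\<And>i. i \<in> F \<Longrightarrow> \<phi> i \<in> borel_measurable M"
  shows "complex_of_real (\<integral>x. ((cmod (\<Sum>i\<in>F. of_int (c i) * \<phi> i x))\<^sup>2) ^ j \<partial>M)
    = (\<Sum>p\<in>PiE {..<2 * j} (\<lambda>_. F). (\<Prod>k<2 * j. of_int (c (p k))) * (\<integral>x. monomial F \<phi> (path_vec (2 * j) p) x \<partial>M))"
proof -
  interpret finite_measure M by fact
  have meas: "monomial F \<phi> a \<in> borel_measurable M" for a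
    unfolding monomial_def power_int_def by measurable
  have int: "integrable M (monomial F \<phi> a)" for a
  proof (rule integrable_const_bound[of _ 1])
    show "AE x in M. cmod (monomial F \<phi> a x) \<le> 1"
      by (intro AE_I2) (simp add: monomial_def prod_norm[symmetric] norm_power_int norm1)
  qed (rule meas)
  have expand: "complex_of_real (((cmod (\<Sum>i\<in>F. of_int (c i) * \<phi> i x))\<^sup>2) ^ j)
    = (\<Sum>p\<in>PiE {..<2 * j} (\<lambda>_. F). (\<Prod>k<2 * j. of_int (c (p k))) * monomial F \<phi> (path_vec (2 * j) p) x)" for x
    by (rule norm_power_expand[OF assms(1)]) (rule norm1)
  show ?thesis
    unfolding integral_complex_of_real[symmetric] expand
    by (subst Bochner_Integration.integral_sum) (auto intro!: integrable_mult_right int)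
qed

section \<open>Comparison of Mahler measures on different groups\<close>

text \<open>A finitely generated torsion-free abelian group, presented as the quotient of the
  integer vectors on \<open>F\<close> by a saturated subgroup \<open>K\<close>, has homomorphisms to the integers that do not
  vanish on a prescribed finite set of nonzero elements.\<close>

lemma exists_separating_weights:
  fixes K :: "('i \<Rightarrow> int) set"
  assumes "finite F"
    and zero: "(\<lambda>_. 0) \<in> K"
    and diff: "\<And>a b. a \<in> K \<Longrightarrow> b \<in> K \<Longrightarrow> (\<lambda>i. a i - b i) \<in> K"
    and sat: "\<And>a (n::int). n \<noteq> 0 \<Longrightarrow> (\<lambda>i. n * a i) \<in> K \<Longrightarrow> a \<in> K"
    and "finite S" "\<And>a i. a \<in> S \<Longrightarrow> i \<notin> F \<Longrightarrow> a i = 0"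
  shows "\<exists>m. \<forall>a\<in>S. a \<in> K \<longleftrightarrow> (\<Sum>i\<in>F. a i * m i) = 0"
  using assms(1,5,6)
proof (induction F arbitrary: S rule: finite_induct)
  case empty
  then have "a = (\<lambda>_. 0)" if "a \<in> S" for a using that by (auto simp: fun_eq_iff)
  then show ?case using zero by auto
next
  case (insert d F)
  have add: "(\<lambda>i. a i + b i) \<in> K" if "a \<in> K" "b \<in> K" for a b
    using diff[OF that(1) diff[OF zero that(2)]] by simp
  have natmult: "(\<lambda>i. int n * a i) \<in> K" if "a \<in> K" for a n
  proof (induction n)
    case (Suc n)
    then show ?case using add[OF that Suc] by (simp add: distrib_right)
  qed (use zero in simp)
  have mult: "(\<lambda>i. n * a i) \<in> K" if "a \<in> K" for a and n :: int
    using natmult[OF that, of "nat \<bar>n\<bar>"] diff[OF zero natmult[OF that, of "nat \<bar>n\<bar>"]]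
    by (cases "n \<ge> 0") auto
  have sum_insert: "(\<Sum>i\<in>insert d F. a i * m i) = a d * m d + (\<Sum>i\<in>F. a i * m i)" for a m :: "'i \<Rightarrow> int"
    using insert by simp
  show ?case
  proof (cases "\<exists>r\<in>K. r d \<noteq> 0 \<and> (\<forall>i. i \<notin> insert d F \<longrightarrow> r i = 0)")
    case True
    then obtain r where r: "r \<in> K" "r d \<noteq> 0" "\<And>i. i \<notin> insert d F \<Longrightarrow> r i = 0" by blast
    \<comment> \<open>Eliminates the coordinate \<open>d\<close> with the relation \<open>r\<close>.
      Saturation of \<open>K\<close> cancels the factor \<open>r d\<close>, so \<open>red a\<close>
      lies in \<open>K\<close> exactly when \<open>a\<close> does.\<close>
    define red where "red a = (\<lambda>i. r d * a i - a d * r i)" for a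
    have redK: "red a \<in> K \<longleftrightarrow> a \<in> K" for a
    proof
      assume "red a \<in> K"
      then have "(\<lambda>i. red a i + a d * r i) \<in> K" using add mult[OF r(1)] by blast
      then have "(\<lambda>i. r d * a i) \<in> K" by (simp add: red_def)
      then show "a \<in> K" using sat r(2) by blast
    next
      assume "a \<in> K"
      then show "red a \<in> K" unfolding red_def using diff mult r(1) by blast
    qed
    have "\<exists>m. \<forall>a\<in>red ` S. a \<in> K \<longleftrightarrow> (\<Sum>i\<in>F. a i * m i) = 0"
    proof (rule insert.IH)
      fix a i assume "a \<in> red ` S" "i \<notin> F"
      then show "a i = 0" using insert.prems(2) r(3) by (cases "i = d") (auto simp: red_def)
    qed (use insert.prems in auto)
    then obtain m where m: "\<And>a. a \<in> S \<Longrightarrow> red a \<in> K \<longleftrightarrow> (\<Sum>i\<in>F. red a i * m i) = 0" by blast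
    \<comment> \<open>The weights on \<open>F\<close> are scaled by \<open>r d\<close> and the
      weight at \<open>d\<close> is adjusted so that pairing \<open>a\<close> with \<open>m'\<close>
      equals pairing \<open>red a\<close> with \<open>m\<close>.\<close>
    define m' where "m' = (\<lambda>i. if i = d then - (\<Sum>i\<in>F. r i * m i) else r d * m i)"
    have "(\<Sum>i\<in>insert d F. a i * m' i) = (\<Sum>i\<in>F. red a i * m i)" for a
    proof -
      have "(\<Sum>i\<in>F. a i * m' i) = (\<Sum>i\<in>F. a i * (r d * m i))"
        using insert.hyps by (intro sum.cong) (auto simp: m'_def)
      then show ?thesis unfolding sum_insert
        by (simp add: m'_def red_def algebra_simps sum_subtractf sum_distrib_left)
    qed
    then show ?thesis using m redK by (intro exI[of _ m']) simp
  next
    case False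
    define S0 where "S0 = {a \<in> S. a d = 0}"
    have "\<exists>m. \<forall>a\<in>S0. a \<in> K \<longleftrightarrow> (\<Sum>i\<in>F. a i * m i) = 0"
    proof (rule insert.IH)
      fix a i assume "a \<in> S0" "i \<notin> F"
      then show "a i = 0" using insert.prems(2) by (cases "i = d") (auto simp: S0_def)
    qed (use insert.prems in \<open>auto simp: S0_def\<close>)
    then obtain m where m: "\<And>a. a \<in> S0 \<Longrightarrow> a \<in> K \<longleftrightarrow> (\<Sum>i\<in>F. a i * m i) = 0" by blast
    \<comment> \<open>No relation involves \<open>d\<close>, so the vectors of \<open>S\<close> with
      a nonzero entry at \<open>d\<close> lie outside \<open>K\<close>. A weight at \<open>d\<close>
      larger than all their sums over \<open>F\<close> keeps the pairing nonzero.\<close>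
    define B where "B = 1 + (\<Sum>a\<in>S. \<bar>\<Sum>i\<in>F. a i * m i\<bar>)"
    define m' where "m' = m(d := B)"
    have s': "(\<Sum>i\<in>insert d F. a i * m' i) = a d * B + (\<Sum>i\<in>F. a i * m i)" for a
    proof -
      have "(\<Sum>i\<in>F. a i * m' i) = (\<Sum>i\<in>F. a i * m i)"
        using insert.hyps by (intro sum.cong) (auto simp: m'_def)
      then show ?thesis unfolding sum_insert by (simp add: m'_def)
    qed
    have "a \<in> K \<longleftrightarrow> (\<Sum>i\<in>insert d F. a i * m' i) = 0" if a: "a \<in> S" for a
    proof (cases "a d = 0")
      case True
      then show ?thesis using m[of a] a by (simp add: s' S0_def)
    next
      case nz: False
      have "a \<notin> K" using False nz insert.prems(2)[OF a] by blast
      have "\<bar>\<Sum>i\<in>F. a i * m i\<bar> \<le> (\<Sum>a\<in>S. \<bar>\<Sum>i\<in>F. a i * m i\<bar>)"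
        using a insert.prems(1) by (intro member_le_sum) auto
      also have "\<dots> < B" by (simp add: B_def)
      also have "B \<le> \<bar>a d\<bar> * B"
      proof -
        have "B \<ge> 0" by (auto simp: B_def intro: add_nonneg_nonneg sum_nonneg)
        then have "1 * B \<le> \<bar>a d\<bar> * B" using nz by (intro mult_right_mono) auto
        then show ?thesis by simp
      qed
      also have "\<bar>a d\<bar> * B = \<bar>a d * B\<bar>"
        by (simp add: abs_mult B_def sum_nonneg)
      finally have "(\<Sum>i\<in>insert d F. a i * m' i) \<noteq> 0" unfolding s' by linarith
      then show ?thesis using \<open>a \<notin> K\<close> by simp
    qed
    then show ?thesis by blast
  qed
qed

section \<open>Lebesgue measure on the unit interval as a model of the circle\<close>

definition unit_interval :: "real measure" where
  "unit_interval = restrict_space lborel {0..1}"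

lemma emeasure_unit_interval: "emeasure unit_interval (space unit_interval) = 1"
  by (simp add: unit_interval_def emeasure_restrict_space space_restrict_space)

lemma finite_measure_unit_interval: "finite_measure unit_interval"
  by (rule finite_measureI) (simp add: emeasure_unit_interval)

lemma measurable_unit_interval:
  fixes f :: "real \<Rightarrow> complex"
  assumes "continuous_on UNIV f"
  shows "f \<in> borel_measurable unit_interval"
  unfolding unit_interval_def
  by (intro measurable_restrict_space1) (use assms borel_measurable_continuous_onI in auto)

lemma integral_cis_unit_interval:
  "(\<integral>t. cis (2 * pi * real_of_int n * t) \<partial>unit_interval) = (if n = 0 then 1 else 0)"
proof (cases "n = 0")
  case True
  then show ?thesis
    using emeasure_unit_interval by (simp add: measure_def)
next
  case False
  define k where "k = 2 * pi * real_of_int n"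
  have k0: "k \<noteq> 0" using False by (simp add: k_def)
  have k1: "cis k = 1" unfolding k_def by (rule cis_multiple_2pi) simp
  have "(\<integral>t. cis (k * t) \<partial>unit_interval) = (\<integral>t. indicator {0..1} t *\<^sub>R cis (k * t) \<partial>lborel)"
    unfolding unit_interval_def by (subst integral_restrict_space) auto
  also have "\<dots> = cis (k * 1) / (\<i> * of_real k) - cis (k * 0) / (\<i> * of_real k)"
  proof (rule integral_FTC_Icc)
    fix t :: real
    show "((\<lambda>t. cis (k * t) / (\<i> * of_real k)) has_vector_derivative cis (k * t)) (at t within {0..1})"
      unfolding cis_conv_exp using k0
      by (auto intro!: derivative_eq_intros has_vector_derivative_real_field simp: field_simps)
  qed (simp, intro continuous_intros)
  also have "\<dots> = 0" by (simp add: k1)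
  finally show ?thesis using False by (simp add: k_def)
qed

text \<open>Factoring out the lowest exponent, a function of modulus 1, leads back to natural
  exponents. The constants precede \<open>c\<close> and \<open>m\<close>, so one pair serves every
  choice of weights; a nonzero integer has modulus at least 1, which supplies the bound on the
  leading coefficient.\<close>

lemma lawton_unit_interval:
  fixes F :: "'i set"
  assumes "finite F" "F \<noteq> {}"
  shows "\<exists>C>0. \<exists>\<delta>>0. \<forall>(c :: 'i \<Rightarrow> int) (m :: 'i \<Rightarrow> int) y. inj_on m F \<longrightarrow> (\<forall>i\<in>F. c i \<noteq> 0) \<longrightarrow> y > 0 \<longrightarrow>
    measure unit_interval {t \<in> space unit_interval. cmod (\<Sum>i\<in>F. of_int (c i) * cis (2 * pi * real_of_int (m i) * t)) \<le> y}
      \<le> C * y powr \<delta>"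
proof -
  have "card F \<ge> 1" using assms by (simp add: Suc_le_eq card_gt_0_iff)
  from lawton[OF this] obtain C \<delta> where C: "C > 0" "\<delta> > 0" and
    "\<forall>A (a :: nat \<Rightarrow> complex) y. finite A \<longrightarrow> card A = card F \<longrightarrow> cmod (a (Max A)) \<ge> 1 \<longrightarrow> y > 0 \<longrightarrow>
    emeasure lborel {t \<in> {0..<1}. cmod (\<Sum>n\<in>A. a n * cis (2 * pi * real n * t)) \<le> y} \<le> ennreal (C * y powr \<delta>)"
    by (elim exE conjE)
  note law = this(3)[rule_format]
  have "measure unit_interval {t \<in> space unit_interval. cmod (\<Sum>i\<in>F. of_int (c i) * cis (2 * pi * real_of_int (m i) * t)) \<le> y}
      \<le> C * y powr \<delta>" if m: "inj_on m F" and c: "\<forall>i\<in>F. c i \<noteq> 0" and y: "y > 0" for c m :: "'i \<Rightarrow> int" and y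
  proof -
    define j where "j = Min (m ` F)"
    have jle: "j \<le> m i" if "i \<in> F" for i using that assms by (simp add: j_def)
    define \<nu> where "\<nu> i = nat (m i - j)" for i
    have inj: "inj_on \<nu> F"
    proof (rule inj_onI)
      fix i i' assume i: "i \<in> F" "i' \<in> F" "\<nu> i = \<nu> i'"
      then have "m i = m i'" using jle[of i] jle[of i'] by (simp add: \<nu>_def)
      then show "i = i'" using m i by (simp add: inj_on_def)
    qed
    define a where "a n = complex_of_int (c (the_inv_into F \<nu> n))" for n
    have a: "a (\<nu> i) = of_int (c i)" if "i \<in> F" for i
      using that inj by (simp add: a_def the_inv_into_f_f)
    have eq: "(\<Sum>i\<in>F. of_int (c i) * cis (2 * pi * real_of_int (m i) * t))
        = cis (2 * pi * real_of_int j * t) * (\<Sum>n\<in>\<nu> ` F. a n * cis (2 * pi * real n * t))" for t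
    proof -
      have 1: "(\<Sum>n\<in>\<nu> ` F. a n * cis (2 * pi * real n * t)) = (\<Sum>i\<in>F. of_int (c i) * cis (2 * pi * real (\<nu> i) * t))"
        using inj a by (subst sum.reindex) auto
      have 2: "cis (2 * pi * real_of_int j * t) * (of_int (c i) * cis (2 * pi * real (\<nu> i) * t))
          = of_int (c i) * cis (2 * pi * real_of_int (m i) * t)" if "i \<in> F" for i
      proof -
        have "2 * pi * real_of_int j * t + 2 * pi * real (\<nu> i) * t = 2 * pi * real_of_int (m i) * t"
          using jle[OF that] by (simp add: \<nu>_def algebra_simps)
        then have "cis (2 * pi * real_of_int j * t) * cis (2 * pi * real (\<nu> i) * t) = cis (2 * pi * real_of_int (m i) * t)"
          by (simp add: cis_mult)
        then show ?thesis by (metis mult.left_commute)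
      qed
      show ?thesis unfolding 1 sum_distrib_left by (intro sum.cong refl 2[symmetric])
    qed
    define q where "q t = (\<Sum>n\<in>\<nu> ` F. a n * cis (2 * pi * real n * t))" for t
    have [measurable]: "q \<in> borel_measurable borel"
      unfolding q_def by (intro borel_measurable_continuous_onI continuous_intros)
    have "Max (\<nu> ` F) \<in> \<nu> ` F" using assms by (intro Max_in) auto
    then obtain i where "i \<in> F" "Max (\<nu> ` F) = \<nu> i" by blast
    then have "cmod (a (Max (\<nu> ` F))) = real_of_int \<bar>c i\<bar>" "\<bar>c i\<bar> \<ge> 1" using a c by auto
    then have lc: "cmod (a (Max (\<nu> ` F))) \<ge> 1" by linarith
    have law': "emeasure lborel {t \<in> {0..<1}. cmod (q t) \<le> y} \<le> ennreal (C * y powr \<delta>)"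
      unfolding q_def by (rule law) (use assms inj lc y in \<open>auto simp: card_image\<close>)
    have "emeasure unit_interval {t \<in> space unit_interval. cmod (\<Sum>i\<in>F. of_int (c i) * cis (2 * pi * real_of_int (m i) * t)) \<le> y}
        = emeasure lborel {t \<in> {0..1}. cmod (q t) \<le> y}"
      unfolding unit_interval_def by (subst emeasure_restrict_space) (auto simp: space_restrict_space eq norm_mult q_def)
    also have "\<dots> \<le> emeasure lborel ({t \<in> {0..<1}. cmod (q t) \<le> y} \<union> {1})"
      by (rule emeasure_mono) auto
    also have "\<dots> \<le> emeasure lborel {t \<in> {0..<1}. cmod (q t) \<le> y} + emeasure lborel {1::real}"
      by (rule emeasure_subadditive) auto
    also have "\<dots> \<le> ennreal (C * y powr \<delta>)" using law' by simp
    finally show ?thesis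
      using C by (simp add: measure_def enn2real_leI)
  qed
  then show ?thesis using C by blast
qed

section \<open>Haar measure and the orthogonality of characters\<close>

context
  fixes M :: "'g::{ab_group_add, topological_space} measure"
  assumes haar: "is_haar M"
    and translation: "\<And>x::'g. continuous_on UNIV ((+) x)"
begin

text \<open>\<open>is_haar\<close> speaks of images and \<open>distr\<close> of preimages; the
  preimage under translation by \<open>x\<close> is the image under translation by
  \<open>- x\<close>.\<close>

lemma haar_translation_invariant:
  "distr M M ((+) x) = M"
proof (rule measure_eqI)
  have sets: "sets M = sets borel" and space: "space M = UNIV" using haar by (auto simp: is_haar_def)
  have meas: "(+) x \<in> measurable M M"
    using borel_measurable_continuous_onI[OF translation[of x]] sets measurable_cong_sets by blast
  show "sets (distr M M ((+) x)) = sets M" by simp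
  fix A assume A: "A \<in> sets (distr M M ((+) x))"
  then have "emeasure (distr M M ((+) x)) A = emeasure M ((+) x -` A)"
    using meas space by (simp add: emeasure_distr)
  also have "(+) x -` A = (+) (- x) ` A" 
  proof (intro set_eqI iffI)
    fix y assume "y \<in> (+) x -` A"
    then show "y \<in> (+) (- x) ` A" by (intro image_eqI[of _ _ "x + y"]) auto
  qed auto
  also have "emeasure M ((+) (- x) ` A) = emeasure M A"
  proof -
    have "A \<in> sets borel" using A sets by simp
    then show ?thesis using haar unfolding is_haar_def by blast
  qed
  finally show "emeasure (distr M M ((+) x)) A = emeasure M A" .
qed

lemma character_measurable:
  assumes "\<gamma> \<in> characters" shows "\<gamma> \<in> borel_measurable M"
proof -
  have "\<gamma> \<in> borel_measurable borel"
    using assms by (intro borel_measurable_continuous_onI) (simp add: characters_def)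
  then show ?thesis using haar by (simp add: is_haar_def cong: measurable_cong_sets)
qed

text \<open>Translation by a point \<open>x\<close> with \<open>\<gamma> x \<noteq> 1\<close>
  multiplies the integral by \<open>\<gamma> x\<close> and yet leaves it unchanged, so it
  vanishes.\<close>

lemma integral_character:
  assumes \<gamma>: "\<gamma> \<in> characters"
  shows "(\<integral>x. \<gamma> x \<partial>M) = (if \<gamma> = (\<lambda>_. 1) then 1 else 0)"
proof (cases "\<gamma> = (\<lambda>_. 1)")
  case True
  then show ?thesis using haar by (simp add: is_haar_def measure_def)
next
  case False
  then obtain x where x: "\<gamma> x \<noteq> 1" by auto
  have sets: "sets M = sets borel" using haar by (auto simp: is_haar_def)
  have meas: "(+) x \<in> measurable M M"
    using borel_measurable_continuous_onI[OF translation[of x]] sets measurable_cong_sets by blast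
  have "(\<integral>y. \<gamma> y \<partial>M) = (\<integral>y. \<gamma> y \<partial>distr M M ((+) x))" by (simp add: haar_translation_invariant)
  also have "\<dots> = (\<integral>y. \<gamma> (x + y) \<partial>M)"
    by (rule integral_distr[OF meas character_measurable[OF \<gamma>]])
  also have "\<dots> = \<gamma> x * (\<integral>y. \<gamma> y \<partial>M)" using \<gamma> by (simp add: characters_def)
  finally show ?thesis using x False by simp
qed

end

lemma one_character: "(\<lambda>_. 1) \<in> characters"
  by (simp add: characters_def)

lemma character_nonzero: "\<gamma> \<in> characters \<Longrightarrow> \<gamma> x \<noteq> 0"
  unfolding characters_def by (metis (mono_tags, lifting) mem_Collect_eq norm_zero zero_neq_one)

lemma character_mult:
  assumes "\<gamma> \<in> characters" "\<gamma>' \<in> characters"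
  shows "(\<lambda>x. \<gamma> x * \<gamma>' x) \<in> characters"
proof -
  have "continuous_on UNIV (\<lambda>x. \<gamma> x * \<gamma>' x)"
    using assms by (intro continuous_on_mult) (auto simp: characters_def)
  then show ?thesis using assms by (simp add: characters_def norm_mult)
qed

lemma character_power_int:
  assumes "\<gamma> \<in> characters"
  shows "(\<lambda>x. \<gamma> x powi n) \<in> characters"
proof -
  have "continuous_on UNIV (\<lambda>x. \<gamma> x powi n)"
    using assms character_nonzero[OF assms] by (intro continuous_on_power_int) (auto simp: characters_def)
  then show ?thesis using assms by (simp add: characters_def norm_power_int power_int_mult_distrib)
qed

lemma monomial_character:
  assumes "finite F" "F \<subseteq> characters"
  shows "monomial F (\<lambda>\<gamma>. \<gamma>) a \<in> characters"
  using assms unfolding monomial_def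
  by (induction F rule: finite_induct) (auto simp: one_character intro!: character_mult character_power_int)

section \<open>Transfer of Mahler measures through moments\<close>

lemma moment_eq_of_monomials:
  fixes c :: "'i \<Rightarrow> int" and \<phi> :: "'i \<Rightarrow> 'a \<Rightarrow> complex" and \<psi> :: "'i \<Rightarrow> 'b \<Rightarrow> complex"
  assumes "finite F" "finite_measure M" "finite_measure M'"
    and "\<And>i x. i \<in> F \<Longrightarrow> cmod (\<phi> i x) = 1" "\<And>i x. i \<in> F \<Longrightarrow> cmod (\<psi> i x) = 1"
    and "\<And>i. i \<in> F \<Longrightarrow> \<phi> i \<in> borel_measurable M" "\<And>i. i \<in> F \<Longrightarrow> \<psi> i \<in> borel_measurable M'"
    and eq: "\<And>p. p \<in> PiE {..<2 * j} (\<lambda>_. F) \<Longrightarrow>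
      (\<integral>x. monomial F \<phi> (path_vec (2 * j) p) x \<partial>M) = (\<integral>x. monomial F \<psi> (path_vec (2 * j) p) x \<partial>M')"
  shows "(\<integral>x. ((cmod (\<Sum>i\<in>F. of_int (c i) * \<phi> i x))\<^sup>2) ^ j \<partial>M) = (\<integral>x. ((cmod (\<Sum>i\<in>F. of_int (c i) * \<psi> i x))\<^sup>2) ^ j \<partial>M')"
proof -
  have "complex_of_real (\<integral>x. ((cmod (\<Sum>i\<in>F. of_int (c i) * \<phi> i x))\<^sup>2) ^ j \<partial>M)
      = (\<Sum>p\<in>PiE {..<2 * j} (\<lambda>_. F). (\<Prod>k<2 * j. of_int (c (p k))) * (\<integral>x. monomial F \<phi> (path_vec (2 * j) p) x \<partial>M))"
    using assms by (intro moment_expand) auto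
  also have "\<dots> = (\<Sum>p\<in>PiE {..<2 * j} (\<lambda>_. F). (\<Prod>k<2 * j. of_int (c (p k))) * (\<integral>x. monomial F \<psi> (path_vec (2 * j) p) x \<partial>M'))"
    by (intro sum.cong refl arg_cong2[where f = "(*)"] eq)
  also have "\<dots> = complex_of_real (\<integral>x. ((cmod (\<Sum>i\<in>F. of_int (c i) * \<psi> i x))\<^sup>2) ^ j \<partial>M')"
    using assms by (intro moment_expand[symmetric]) auto
  finally show ?thesis by (simp only: of_real_eq_iff)
qed

lemma norm_int_comb_le:
  assumes "\<And>i. i \<in> F \<Longrightarrow> cmod (\<phi> i x) = 1"
  shows "cmod (\<Sum>i\<in>F. of_int (c i) * \<phi> i x) \<le> (\<Sum>i\<in>F. real_of_int \<bar>c i\<bar>)"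
  using assms by (intro sum_norm_le) (simp add: norm_mult)

lemma monomial_cis:
  "monomial F (\<lambda>i t. cis (2 * pi * real_of_int (m i) * t)) a t = cis (2 * pi * real_of_int (\<Sum>i\<in>F. a i * m i) * t)"
proof (induction F rule: infinite_finite_induct)
  case (insert i F)
  have "cis (2 * pi * real_of_int (m i) * t) powi a i = cis (2 * pi * real_of_int (a i * m i) * t)"
    by (simp add: cis_power_int mult_ac)
  with insert show ?case
    by (simp add: monomial_def cis_mult distrib_left distrib_right)
qed (simp_all add: monomial_def)

lemma finite_measure_haar: "is_haar M \<Longrightarrow> finite_measure M"
  by (rule finite_measureI) (auto simp: is_haar_def)

text \<open>A monomial in powers of \<open>\<eta>\<close> is a power of \<open>\<eta>\<close>; by
  infinite order its integral is 1 if the exponent is 0 and 0 otherwise. The exponentials on the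
  interval follow the same rule with the same exponent.\<close>

lemma mahler_of_infinite_order_character:
  fixes M :: "'g::{ab_group_add, topological_space} measure" and c m :: "'i \<Rightarrow> int"
  assumes haar: "is_haar M" and translation: "\<And>x::'g. continuous_on UNIV ((+) x)"
    and \<eta>: "\<eta> \<in> characters" and inf: "\<forall>n::int. n \<noteq> 0 \<longrightarrow> (\<lambda>x. \<eta> x powi n) \<noteq> (\<lambda>_. 1)"
    and F: "finite F"
  shows "mahler M (\<lambda>x. \<Sum>i\<in>F. of_int (c i) * \<eta> x powi m i)
    = mahler unit_interval (\<lambda>t. \<Sum>i\<in>F. of_int (c i) * cis (2 * pi * real_of_int (m i) * t))"
proof -
  let ?\<phi> = "\<lambda>i x. \<eta> x powi m i" and ?\<psi> = "\<lambda>i t. cis (2 * pi * real_of_int (m i) * t)"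
  let ?f = "\<lambda>x. \<Sum>i\<in>F. of_int (c i) * ?\<phi> i x" and ?g = "\<lambda>t. \<Sum>i\<in>F. of_int (c i) * ?\<psi> i t"
  define L where "L = (\<Sum>i\<in>F. real_of_int \<bar>c i\<bar>)"
  have meas1: "?\<phi> i \<in> borel_measurable M" for i
    by (rule character_measurable[OF haar translation character_power_int[OF \<eta>]])
  have meas2: "?\<psi> i \<in> borel_measurable unit_interval" for i
    by (intro measurable_unit_interval continuous_intros)
  have n1: "cmod (?\<phi> i x) = 1" for i x using \<eta> by (simp add: characters_def norm_power_int)
  have n2: "cmod (?\<psi> i t) = 1" for i t by simp
  have f: "?f \<in> borel_measurable M" "\<forall>x\<in>space M. cmod (?f x) \<le> L"
    using meas1 norm_int_comb_le[of F ?\<phi>, OF n1] by (auto simp: L_def)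
  have g: "?g \<in> borel_measurable unit_interval" "\<forall>t\<in>space unit_interval. cmod (?g t) \<le> L"
    using meas2 norm_int_comb_le[of F ?\<psi>, OF n2] by (auto simp: L_def)
  have mono: "monomial F ?\<phi> a x = \<eta> x powi (\<Sum>i\<in>F. a i * m i)" for a x
    using character_nonzero[OF \<eta>] by (simp add: monomial_def power_int_sum power_int_mult[symmetric] mult.commute)
  have int: "(\<integral>x. monomial F ?\<phi> a x \<partial>M) = (\<integral>x. monomial F ?\<psi> a x \<partial>unit_interval)" for a
    unfolding mono monomial_cis integral_cis_unit_interval
      integral_character[OF haar translation character_power_int[OF \<eta>]]
    using inf[rule_format, of "\<Sum>i\<in>F. a i * m i"] by auto
  have mom: "(\<integral>x. ((cmod (?f x))\<^sup>2) ^ j \<partial>M) = (\<integral>x. ((cmod (?g x))\<^sup>2) ^ j \<partial>unit_interval)" for j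
    by (rule moment_eq_of_monomials[OF F finite_measure_haar[OF haar] finite_measure_unit_interval n1 n2 meas1 meas2 int])
  have "trunc_mahler M n ?f = trunc_mahler unit_interval n ?g" for n
  proof (rule ccontr)
    \<comment> \<open>The moments determine truncated measures up to any tolerance; half of the
      supposed gap contradicts the gap.\<close>
    define d where "d = \<bar>trunc_mahler M n ?f - trunc_mahler unit_interval n ?g\<bar>"
    assume "trunc_mahler M n ?f \<noteq> trunc_mahler unit_interval n ?g"
    then have "d > 0" by (simp add: d_def)
    then obtain J where J: "\<forall>(M :: 'g measure) (M' :: real measure) f f'.
      emeasure M (space M) = 1 \<longrightarrow> emeasure M' (space M') = 1 \<longrightarrow>
      f \<in> borel_measurable M \<longrightarrow> f' \<in> borel_measurable M' \<longrightarrow>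
      (\<forall>x\<in>space M. cmod (f x) \<le> L) \<longrightarrow> (\<forall>x\<in>space M'. cmod (f' x) \<le> L) \<longrightarrow>
      (\<forall>j\<le>J. (\<integral>x. ((cmod (f x))\<^sup>2) ^ j \<partial>M) = (\<integral>x. ((cmod (f' x))\<^sup>2) ^ j \<partial>M')) \<longrightarrow>
      \<bar>trunc_mahler M n f - trunc_mahler M' n f'\<bar> \<le> d / 2"
      using trunc_mahler_determined_by_moments[of "d / 2" L n] by auto
    have "emeasure M (space M) = 1" using haar by (auto simp: is_haar_def)
    then have "d \<le> d / 2" unfolding d_def[symmetric] using f g mom emeasure_unit_interval
      unfolding d_def by (intro J[rule_format, unfolded d_def]) auto
    then show False using \<open>d > 0\<close> by simp
  qed
  then show ?thesis
    using trunc_mahler_tendsto_mahler[OF finite_measure_haar[OF haar] f(1), of L] f(2)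
      trunc_mahler_tendsto_mahler[OF finite_measure_unit_interval g(1), of L] g(2)
    by (intro LIMSEQ_unique[of "\<lambda>n. ereal (trunc_mahler unit_interval n ?g)"]) auto
qed

text \<open>The lattice \<open>K\<close> of relations is saturated because a monomial in characters
  is a character: if a nonzero power of it is trivial, torsion-freeness makes it trivial
  itself.\<close>

lemma torsion_free_weights:
  fixes F :: "('g::{ab_group_add, topological_space} \<Rightarrow> complex) set"
  assumes F: "finite F" "F \<subseteq> characters"
    and tf: "\<forall>(\<gamma> :: 'g \<Rightarrow> complex)\<in>characters. \<forall>n::int. n \<noteq> 0 \<longrightarrow> (\<lambda>x. \<gamma> x powi n) = (\<lambda>_. 1) \<longrightarrow> \<gamma> = (\<lambda>_. 1)"
  shows "\<exists>m. inj_on m F \<and> (\<forall>j\<le>J. \<forall>p\<in>PiE {..<2 * j} (\<lambda>_. F).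
    monomial F (\<lambda>\<gamma>. \<gamma>) (path_vec (2 * j) p) = (\<lambda>_. 1) \<longleftrightarrow> (\<Sum>\<gamma>\<in>F. path_vec (2 * j) p \<gamma> * m \<gamma>) = 0)"
proof -
  define K where "K = {a. monomial F (\<lambda>\<gamma>. \<gamma>) a = (\<lambda>_. 1)}"
  define e where "e \<gamma> \<gamma>' = (\<lambda>\<beta>. (if \<beta> = \<gamma> then 1 else 0) - (if \<beta> = \<gamma>' then 1 else 0 :: int))" for \<gamma> \<gamma>' :: "'g \<Rightarrow> complex"
  \<comment> \<open>The differences of unit vectors are added to the path vectors to force
    \<open>m\<close> to be injective: equal weights would make two distinct characters
    equal.\<close>
  define S where "S = (\<Union>j\<le>J. path_vec (2 * j) ` PiE {..<2 * j} (\<lambda>_. F)) \<union> (\<lambda>(\<gamma>, \<gamma>'). e \<gamma> \<gamma>') ` (F \<times> F)"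
  have nz: "\<gamma> x \<noteq> 0" if "\<gamma> \<in> F" for \<gamma> x using that F character_nonzero by blast
  have "\<exists>m. \<forall>a\<in>S. a \<in> K \<longleftrightarrow> (\<Sum>\<gamma>\<in>F. a \<gamma> * m \<gamma>) = 0"
  proof (rule exists_separating_weights[OF F(1)])
    show "(\<lambda>_. 0) \<in> K" by (simp add: K_def monomial_def fun_eq_iff)
  next
    fix a b assume "a \<in> K" "b \<in> K"
    moreover have "monomial F (\<lambda>\<gamma>. \<gamma>) (\<lambda>i. a i - b i) x = monomial F (\<lambda>\<gamma>. \<gamma>) a x / monomial F (\<lambda>\<gamma>. \<gamma>) b x" for x
      using nz by (simp add: monomial_def power_int_diff prod_dividef cong: prod.cong)
    ultimately show "(\<lambda>i. a i - b i) \<in> K" by (auto simp: K_def)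
  next
    fix a and n :: int assume n: "n \<noteq> 0" "(\<lambda>i. n * a i) \<in> K"
    have "monomial F (\<lambda>\<gamma>. \<gamma>) (\<lambda>i. n * a i) = (\<lambda>x. monomial F (\<lambda>\<gamma>. \<gamma>) a x powi n)"
      unfolding monomial_def
      by (induction F rule: infinite_finite_induct) (auto simp: fun_eq_iff power_int_mult_distrib power_int_mult mult.commute[of n])
    then show "a \<in> K" using tf[rule_format, OF monomial_character[OF F] n(1)] n(2) by (simp add: K_def)
  next
    show "finite S" using F by (auto simp: S_def intro!: finite_PiE)
  next
    fix a \<gamma> assume "a \<in> S" "\<gamma> \<notin> F"
    then show "a \<gamma> = 0" by (auto simp: S_def e_def path_vec_def PiE_def Pi_def intro!: sum.neutral)
  qed
  then obtain m where m: "\<And>a. a \<in> S \<Longrightarrow> a \<in> K \<longleftrightarrow> (\<Sum>\<gamma>\<in>F. a \<gamma> * m \<gamma>) = 0" by blast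
  have "inj_on m F"
  proof (rule inj_onI, rule ccontr)
    fix \<gamma> \<gamma>' assume g: "\<gamma> \<in> F" "\<gamma>' \<in> F" "m \<gamma> = m \<gamma>'" "\<gamma> \<noteq> \<gamma>'"
    have "e \<gamma> \<gamma>' \<in> S" using g by (auto simp: S_def)
    moreover have "(\<Sum>\<beta>\<in>F. e \<gamma> \<gamma>' \<beta> * m \<beta>) = 0"
      using g F by (simp add: e_def left_diff_distrib sum_subtractf if_distrib[of "\<lambda>u. u * _"] cong: if_cong)
    ultimately have "monomial F (\<lambda>\<gamma>. \<gamma>) (e \<gamma> \<gamma>') = (\<lambda>_. 1)" using m by (simp add: K_def)
    moreover have "monomial F (\<lambda>\<gamma>. \<gamma>) (e \<gamma> \<gamma>') x = \<gamma> x / \<gamma>' x" for x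
    proof -
      have "monomial F (\<lambda>\<gamma>. \<gamma>) (e \<gamma> \<gamma>') x = (\<Prod>\<beta>\<in>F. (if \<beta> = \<gamma> then \<beta> x else 1) / (if \<beta> = \<gamma>' then \<beta> x else 1))"
        unfolding monomial_def using nz g(4) by (intro prod.cong) (auto simp: e_def power_int_minus field_simps)
      then show ?thesis using g F by (simp add: prod_dividef)
    qed
    ultimately have "\<gamma> x / \<gamma>' x = 1" for x by metis
    then have "\<gamma> = \<gamma>'" using nz[OF g(2)] by (intro ext) (simp add: divide_eq_1_iff)
    then show False using g by simp
  qed
  moreover have "path_vec (2 * j) p \<in> S" if "j \<le> J" "p \<in> PiE {..<2 * j} (\<lambda>_. F)" for j p
    using that by (auto simp: S_def)
  ultimately show ?thesis using m by (intro exI[of _ m]) (auto simp: K_def)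
qed

text \<open>The order of choices carries the proof: the tolerance comes from
  \<open>\<epsilon>\<close> and the measure of \<open>f\<close>, Lawton's constants from
  \<open>F\<close>, then the truncation level, then the number of moments, and the weights
  last.\<close>

lemma mahler_approx_unit_interval:
  fixes M :: "'g::{ab_group_add, topological_space} measure" and c :: "('g \<Rightarrow> complex) \<Rightarrow> int"
  assumes haar: "is_haar M" and translation: "\<And>x::'g. continuous_on UNIV ((+) x)"
    and tf: "\<forall>(\<gamma> :: 'g \<Rightarrow> complex)\<in>characters. \<forall>n::int. n \<noteq> 0 \<longrightarrow> (\<lambda>x. \<gamma> x powi n) = (\<lambda>_. 1) \<longrightarrow> \<gamma> = (\<lambda>_. 1)"
    and F: "finite F" "F \<subseteq> characters" "F \<noteq> {}" "\<forall>\<gamma>\<in>F. c \<gamma> \<noteq> 0"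
    and pos: "mahler M (\<lambda>x. \<Sum>\<gamma>\<in>F. of_int (c \<gamma>) * \<gamma> x) > 0" and "\<epsilon> > 0"
  obtains m where "inj_on m F"
    "mahler unit_interval (\<lambda>t. \<Sum>\<gamma>\<in>F. of_int (c \<gamma>) * cis (2 * pi * real_of_int (m \<gamma>) * t)) > 0"
    "mahler unit_interval (\<lambda>t. \<Sum>\<gamma>\<in>F. of_int (c \<gamma>) * cis (2 * pi * real_of_int (m \<gamma>) * t))
      \<le> mahler M (\<lambda>x. \<Sum>\<gamma>\<in>F. of_int (c \<gamma>) * \<gamma> x) + ereal \<epsilon>"
proof -
  define f where "f x = (\<Sum>\<gamma>\<in>F. of_int (c \<gamma>) * \<gamma> x)" for x
  define g where "g m t = (\<Sum>\<gamma>\<in>F. of_int (c \<gamma>) * cis (2 * pi * real_of_int (m \<gamma>) * t))" for m t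
  define L where "L = (\<Sum>\<gamma>\<in>F. real_of_int \<bar>c \<gamma>\<bar>)"
  have meas: "\<gamma> \<in> borel_measurable M" if "\<gamma> \<in> F" for \<gamma>
    using that F by (intro character_measurable[OF haar translation]) auto
  have measI: "(\<lambda>t. cis (2 * pi * real_of_int k * t)) \<in> borel_measurable unit_interval" for k
    by (intro measurable_unit_interval continuous_intros)
  have n1: "cmod (\<gamma> x) = 1" if "\<gamma> \<in> F" for \<gamma> x using that F by (auto simp: characters_def)
  have fm: "f \<in> borel_measurable M" unfolding f_def using meas by (intro borel_measurable_sum borel_measurable_times) auto
  have fL: "cmod (f x) \<le> L" for x unfolding f_def L_def using n1 by (rule norm_int_comb_le)
  have gm: "g m \<in> borel_measurable unit_interval" for m
    unfolding g_def using measI by (intro borel_measurable_sum borel_measurable_times) auto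
  have gL: "cmod (g m t) \<le> L" for m t unfolding g_def L_def by (rule norm_int_comb_le) simp
  note fin = finite_measure_haar[OF haar]
  note limf = trunc_mahler_tendsto_mahler[OF fin fm fL]
  have "mahler M f < \<infinity>"
    using mahler_le_trunc_mahler[OF fin fm fL, of 0] by (simp add: less_top[symmetric] top_ereal_def) force
  then obtain a where a: "mahler M f = ereal a" "a > 0"
    using pos unfolding f_def[abs_def, symmetric] by (cases "mahler M f") auto
  \<comment> \<open>Two errors of size \<open>d\<close> occur on each side: at most
    \<open>2 * d \<le> \<epsilon>\<close> is added above, and \<open>a - 2 * d\<close> remains
    positive below.\<close>
  define d where "d = min (\<epsilon> / 2) (a / 4)"
  have d: "d > 0" "2 * d \<le> \<epsilon>" "2 * d < a" using a(2) \<open>\<epsilon> > 0\<close> by (auto simp: d_def)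
  obtain C \<delta> where C: "C > 0" "\<delta> > 0" and
    "\<forall>(c :: ('g \<Rightarrow> complex) \<Rightarrow> int) m y. inj_on m F \<longrightarrow> (\<forall>i\<in>F. c i \<noteq> 0) \<longrightarrow> y > 0 \<longrightarrow>
      measure unit_interval {t \<in> space unit_interval. cmod (\<Sum>i\<in>F. of_int (c i) * cis (2 * pi * real_of_int (m i) * t)) \<le> y}
      \<le> C * y powr \<delta>"
    using lawton_unit_interval[OF F(1,3)] by (elim exE conjE)
  note law = this(3)[rule_format]
  have "(\<lambda>n. C * exp (- \<delta>) ^ n / (1 - exp (- \<delta>))) \<longlonglongrightarrow> C * 0 / (1 - exp (- \<delta>))"
    using C by (intro tendsto_intros LIMSEQ_power_zero) auto
  then have "\<forall>\<^sub>F n in sequentially. C * exp (- \<delta>) ^ n / (1 - exp (- \<delta>)) < d"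
    using d(1) by (intro order_tendstoD(2)) auto
  moreover have "\<forall>\<^sub>F n in sequentially. ereal (trunc_mahler M n f) < ereal (a + d)"
    using limf a d(1) by (intro order_tendstoD(2)) auto
  ultimately have "\<forall>\<^sub>F n in sequentially. C * exp (- \<delta>) ^ n / (1 - exp (- \<delta>)) < d \<and> trunc_mahler M n f < a + d"
    by eventually_elim simp
  then obtain n where n: "C * exp (- \<delta>) ^ n / (1 - exp (- \<delta>)) < d" "trunc_mahler M n f < a + d"
    using eventually_happens'[OF sequentially_bot] by blast
  obtain J where J: "\<forall>(M :: 'g measure) (M' :: real measure) f f'.
      emeasure M (space M) = 1 \<longrightarrow> emeasure M' (space M') = 1 \<longrightarrow>
      f \<in> borel_measurable M \<longrightarrow> f' \<in> borel_measurable M' \<longrightarrow>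
      (\<forall>x\<in>space M. cmod (f x) \<le> L) \<longrightarrow> (\<forall>x\<in>space M'. cmod (f' x) \<le> L) \<longrightarrow>
      (\<forall>j\<le>J. (\<integral>x. ((cmod (f x))\<^sup>2) ^ j \<partial>M) = (\<integral>x. ((cmod (f' x))\<^sup>2) ^ j \<partial>M')) \<longrightarrow>
      \<bar>trunc_mahler M n f - trunc_mahler M' n f'\<bar> \<le> d"
    using trunc_mahler_determined_by_moments[OF d(1), of L n] by (elim exE)
  obtain m where m: "inj_on m F" and rel: "\<And>j p. j \<le> J \<Longrightarrow> p \<in> PiE {..<2 * j} (\<lambda>_. F) \<Longrightarrow>
    monomial F (\<lambda>\<gamma>. \<gamma>) (path_vec (2 * j) p) = (\<lambda>_. 1) \<longleftrightarrow> (\<Sum>\<gamma>\<in>F. path_vec (2 * j) p \<gamma> * m \<gamma>) = 0"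
    using torsion_free_weights[OF F(1,2) tf, where J = J] by auto
  have mom: "(\<integral>x. ((cmod (f x))\<^sup>2) ^ j \<partial>M) = (\<integral>x. ((cmod (g m x))\<^sup>2) ^ j \<partial>unit_interval)" if "j \<le> J" for j
    unfolding f_def g_def
  proof (rule moment_eq_of_monomials[OF F(1) fin finite_measure_unit_interval])
    fix p assume p: "p \<in> PiE {..<2 * j} (\<lambda>_. F)"
    show "(\<integral>x. monomial F (\<lambda>\<gamma>. \<gamma>) (path_vec (2 * j) p) x \<partial>M)
        = (\<integral>x. monomial F (\<lambda>\<gamma> t. cis (2 * pi * real_of_int (m \<gamma>) * t)) (path_vec (2 * j) p) x \<partial>unit_interval)"
      unfolding integral_character[OF haar translation monomial_character[OF F(1,2)]] monomial_cis
        integral_cis_unit_interval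
      using rel[OF that p] by simp
  qed (use n1 meas measI in auto)
  have close: "\<bar>trunc_mahler M n f - trunc_mahler unit_interval n (g m)\<bar> \<le> d"
  proof (rule J[rule_format])
    show "emeasure M (space M) = 1" using haar by (auto simp: is_haar_def)
  qed (use emeasure_unit_interval fm gm fL gL mom in auto)
  have "mahler unit_interval (g m) \<le> ereal (trunc_mahler unit_interval n (g m))"
    by (rule mahler_le_trunc_mahler[OF finite_measure_unit_interval gm gL])
  also have "\<dots> \<le> ereal (a + \<epsilon>)" using close n(2) d by simp
  finally have up: "mahler unit_interval (g m) \<le> ereal (a + \<epsilon>)" .
  \<comment> \<open>The truncated measure of \<open>f\<close> is never below \<open>a\<close>, so
    the small values of \<open>f\<close> cost nothing; only the tail of \<open>g m\<close> is
    subtracted.\<close>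
  have "ereal a \<le> ereal (trunc_mahler M n f)"
    unfolding a(1)[symmetric] by (rule mahler_le_trunc_mahler[OF fin fm fL])
  then have "ereal 0 < ereal (trunc_mahler unit_interval n (g m) - C * exp (- \<delta>) ^ n / (1 - exp (- \<delta>)))"
    using close n(1) d by simp
  also have "\<dots> \<le> mahler unit_interval (g m)"
    by (rule trunc_mahler_le_mahler[OF finite_measure_unit_interval gm gL _ C])
      (use law[OF m] F(4) in \<open>simp add: g_def\<close>)
  finally have "mahler unit_interval (g m) > 0" by (simp add: zero_ereal_def)
  with m up show thesis
    using a(1) unfolding f_def[abs_def] g_def[abs_def] by (intro that) auto
qed

text \<open>Each competitor on the first group is matched, up to \<open>\<epsilon>\<close>, by a
  positive competitor on the second, obtained by substituting \<open>\<eta>\<close> into the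
  polynomial on the circle. Both groups enter only through Haar measure and continuous translations,
  so that \<open>torus\<close> can take either place.\<close>

lemma lehmer_le:
  fixes M :: "'g::{ab_group_add, topological_space} measure"
    and M' :: "'h::{ab_group_add, topological_space} measure"
  assumes "is_haar M" "\<And>x::'g. continuous_on UNIV ((+) x)"
    and tf: "\<forall>(\<gamma> :: 'g \<Rightarrow> complex)\<in>characters. \<forall>n::int. n \<noteq> 0 \<longrightarrow> (\<lambda>x. \<gamma> x powi n) = (\<lambda>_. 1) \<longrightarrow> \<gamma> = (\<lambda>_. 1)"
    and "is_haar M'" "\<And>x::'h. continuous_on UNIV ((+) x)"
    and \<eta>: "\<eta> \<in> (characters :: ('h \<Rightarrow> complex) set)"
    and inf: "\<forall>n::int. n \<noteq> 0 \<longrightarrow> (\<lambda>x. \<eta> x powi n) \<noteq> (\<lambda>_. 1)"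
  shows "lehmer M' \<le> lehmer M"
  unfolding lehmer_def[of M]
proof (rule Inf_greatest, clarify)
  fix f :: "'g \<Rightarrow> complex" assume "f \<in> int_char_poly" and pos: "mahler M f > 0"
  then obtain F0 and c :: "('g \<Rightarrow> complex) \<Rightarrow> int" where F0: "finite F0" "F0 \<subseteq> characters"
    and f0: "f = (\<lambda>x. \<Sum>\<gamma>\<in>F0. of_int (c \<gamma>) * \<gamma> x)"
    by (auto simp: int_char_poly_def)
  \<comment> \<open>Zero coefficients are dropped because Lawton's estimate asks for nonzero
    integers.\<close>
  define F where "F = {\<gamma> \<in> F0. c \<gamma> \<noteq> 0}"
  have F: "finite F" "F \<subseteq> characters" "\<forall>\<gamma>\<in>F. c \<gamma> \<noteq> 0" using F0 by (auto simp: F_def)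
  have f: "f = (\<lambda>x. \<Sum>\<gamma>\<in>F. of_int (c \<gamma>) * \<gamma> x)"
    unfolding f0 using F0 by (intro ext sum.mono_neutral_right) (auto simp: F_def)
  have "F \<noteq> {}"
  proof
    assume "F = {}"
    then have "mahler M f = - \<infinity>"
      using assms(1) unfolding f mahler_def by (simp add: is_haar_def zero_ennreal.rep_eq)
    then show False using pos by simp
  qed
  show "lehmer M' \<le> mahler M f"
  proof (rule ereal_le_epsilon2)
    fix \<epsilon> :: real assume "\<epsilon> > 0"
    obtain m where m: "inj_on m F"
      "mahler unit_interval (\<lambda>t. \<Sum>\<gamma>\<in>F. of_int (c \<gamma>) * cis (2 * pi * real_of_int (m \<gamma>) * t)) > 0"
      "mahler unit_interval (\<lambda>t. \<Sum>\<gamma>\<in>F. of_int (c \<gamma>) * cis (2 * pi * real_of_int (m \<gamma>) * t)) \<le> mahler M f + ereal \<epsilon>"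
      using mahler_approx_unit_interval[OF assms(1,2) tf F(1,2) \<open>F \<noteq> {}\<close> F(3) pos[unfolded f] \<open>\<epsilon> > 0\<close>]
      unfolding f by blast
    define h where "h x = (\<Sum>\<gamma>\<in>F. of_int (c \<gamma>) * \<eta> x powi m \<gamma>)" for x
    have mh: "mahler M' h = mahler unit_interval (\<lambda>t. \<Sum>\<gamma>\<in>F. of_int (c \<gamma>) * cis (2 * pi * real_of_int (m \<gamma>) * t))"
      unfolding h_def by (rule mahler_of_infinite_order_character[OF assms(4,5) \<eta> inf F(1)])
    \<comment> \<open>Distinct weights give distinct powers of \<open>\<eta>\<close>, so reindexing
      along \<open>\<pi>\<close> exhibits \<open>h\<close> as a combination over a set of characters
      without collisions.\<close>
    define \<pi> where "\<pi> \<gamma> = (\<lambda>x. \<eta> x powi m \<gamma>)" for \<gamma>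
    have inj: "inj_on \<pi> F"
    proof (rule inj_onI)
      fix \<gamma> \<gamma>' assume g: "\<gamma> \<in> F" "\<gamma>' \<in> F" "\<pi> \<gamma> = \<pi> \<gamma>'"
      have "\<eta> x powi (m \<gamma> - m \<gamma>') = 1" for x
        using fun_cong[OF g(3), of x] character_nonzero[OF \<eta>, of x] by (simp add: \<pi>_def power_int_diff)
      then have "m \<gamma> = m \<gamma>'" using inf[rule_format, of "m \<gamma> - m \<gamma>'"] by auto
      then show "\<gamma> = \<gamma>'" using m(1) g by (simp add: inj_on_def)
    qed
    have heq: "h = (\<lambda>x. \<Sum>\<beta>\<in>\<pi> ` F. of_int (c (the_inv_into F \<pi> \<beta>)) * \<beta> x)"
      using inj by (simp add: sum.reindex the_inv_into_f_f h_def fun_eq_iff) (simp add: \<pi>_def)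
    have sub: "\<pi> ` F \<subseteq> characters" using character_power_int[OF \<eta>] by (auto simp: \<pi>_def)
    have "h \<in> int_char_poly"
      unfolding int_char_poly_def mem_Collect_eq
      by (intro exI[of _ "\<pi> ` F"] exI[of _ "\<lambda>\<beta>. c (the_inv_into F \<pi> \<beta>)"] conjI finite_imageI F(1) sub heq)
    moreover have "mahler M' h > 0" using m(2) mh by simp
    ultimately have "lehmer M' \<le> mahler M' h"
      unfolding lehmer_def by (intro Inf_lower) blast
    also have "\<dots> \<le> mahler M f + ereal \<epsilon>" using m(3) mh by simp
    finally show "lehmer M' \<le> mahler M f + ereal \<epsilon>" .
  qed
qed

section \<open>Existence of nontrivial characters\<close>

locale compact_haar =
  fixes M :: "'g::{topological_ab_group_add, t2_space} measure"
  assumes compact_space: "compact (UNIV :: 'g set)"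
    and translation_invariant: "\<And>x. distr M M ((+) x) = M"
    and sets_M: "sets M = sets borel"
    and emeasure_space: "emeasure M UNIV = 1"
begin

lemma space_M: "space M = UNIV"
  using sets_eq_imp_space_eq[OF sets_M] by simp

sublocale finite_measure M
  by (rule finite_measureI) (simp add: space_M emeasure_space)

lemma measure_space: "measure M UNIV = 1"
  using emeasure_space by (simp add: measure_def)

lemma measurable_cont:
  fixes f :: "'g \<Rightarrow> 'b::topological_space"
  assumes "continuous_on UNIV f" shows "f \<in> borel_measurable M"
  using borel_measurable_continuous_onI[OF assms] sets_M by (simp cong: measurable_cong_sets)

lemma bounded_cont:
  fixes f :: "'g \<Rightarrow> 'b::real_normed_vector"
  assumes "continuous_on UNIV f"
  obtains B where "B > 0" "\<And>x. norm (f x) \<le> B"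
  using compact_imp_bounded[OF compact_continuous_image[OF assms compact_space]]
  by (auto simp: bounded_pos)

lemma integrable_cont:
  fixes f :: "'g \<Rightarrow> 'b::{banach, second_countable_topology}"
  assumes "continuous_on UNIV f" shows "integrable M f"
proof -
  obtain B where "\<And>x. norm (f x) \<le> B" using bounded_cont[OF assms] by blast
  then show ?thesis by (intro integrable_const_bound[of _ B] measurable_cont assms) auto
qed

lemma norm_integral_le:
  fixes f :: "'g \<Rightarrow> complex"
  assumes "continuous_on UNIV f" "\<And>x. norm (f x) \<le> B"
  shows "norm (\<integral>x. f x \<partial>M) \<le> B"
proof -
  have "norm (\<integral>x. f x \<partial>M) \<le> (\<integral>x. norm (f x) \<partial>M)" by (rule integral_norm_bound)
  also have "\<dots> \<le> (\<integral>x. B \<partial>M)"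
    using assms by (intro integral_mono integrable_cont continuous_on_norm) auto
  finally show ?thesis by (simp add: space_M measure_space)
qed

lemma continuous_on_shift:
  fixes f :: "'g \<Rightarrow> 'b::topological_space"
  assumes "continuous_on UNIV f" "continuous_on S g" shows "continuous_on S (\<lambda>x. f (g x))"
  using assms by (rule continuous_on_compose2) auto

lemma measurable_translate: "(+) x \<in> measurable M M"
proof -
  have "(+) x \<in> borel_measurable M" by (intro measurable_cont continuous_intros)
  then show ?thesis using sets_M by (simp cong: measurable_cong_sets)
qed

lemma integral_translate:
  fixes f :: "'g \<Rightarrow> complex"
  assumes "continuous_on UNIV f"
  shows "(\<integral>y. f (x + y) \<partial>M) = (\<integral>y. f y \<partial>M)"
proof -
  have "(\<integral>y. f (x + y) \<partial>M) = (\<integral>y. f y \<partial>distr M M ((+) x))"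
    by (rule integral_distr[OF measurable_translate measurable_cont[OF assms], symmetric])
  then show ?thesis by (simp add: translation_invariant)
qed

text \<open>Finitely many translates of \<open>U\<close> cover the compact group, and all have the
  measure of \<open>U\<close>.\<close>

lemma emeasure_open_pos:
  assumes "open U" "x0 \<in> U" shows "emeasure M U \<noteq> 0"
proof
  assume U0: "emeasure M U = 0"
  define V where "V x = (\<lambda>y. x + y) -` U" for x
  have op: "open (V x)" for x
    unfolding V_def using assms(1)
    by (intro open_vimage continuous_intros)
  have "UNIV \<subseteq> (\<Union>x\<in>UNIV. V x)"
  proof
    fix y show "y \<in> (\<Union>x\<in>UNIV. V x)"
      using assms(2) by (auto simp: V_def intro!: exI[of _ "x0 - y"])
  qed
  then obtain S where S: "finite S" "UNIV \<subseteq> (\<Union>x\<in>S. V x)"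
    using compactE_image[OF compact_space, of UNIV V] op by auto
  have Vx: "emeasure M (V x) = 0" for x
  proof -
    have "emeasure (distr M M ((+) x)) U = emeasure M (V x)"
      using assms(1) sets_M measurable_translate by (subst emeasure_distr) (auto simp: V_def space_M)
    then show ?thesis using U0 by (simp add: translation_invariant)
  qed
  have "emeasure M UNIV \<le> emeasure M (\<Union>x\<in>S. V x)"
    using S op sets_M by (intro emeasure_mono) auto
  also have "\<dots> \<le> (\<Sum>x\<in>S. emeasure M (V x))"
    using S op sets_M by (intro emeasure_subadditive_finite) auto
  finally show False using emeasure_space Vx by simp
qed

text \<open>By compactness \<open>F x\<close> tends to \<open>F x0\<close> uniformly in
  \<open>y\<close>. The argument uses neighbourhoods throughout, since the topology of the group
  need not be described by sequences.\<close>

lemma continuous_integral: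
  fixes F :: "'g \<Rightarrow> 'g \<Rightarrow> complex"
  assumes F: "continuous_on UNIV (\<lambda>p. F (fst p) (snd p))"
  shows "continuous_on UNIV (\<lambda>x. \<integral>y. F x y \<partial>M)"
  unfolding continuous_on_topological
proof (intro ballI allI impI)
  fix x0 :: 'g and B assume B: "open B" "(\<integral>y. F x0 y \<partial>M) \<in> B"
  have Fx: "continuous_on UNIV (F x)" for x
    using continuous_on_compose2[OF F, of UNIV "\<lambda>y. (x, y)"] by (simp add: continuous_on_Pair)
  obtain e where e: "e > 0" "ball (\<integral>y. F x0 y \<partial>M) e \<subseteq> B" using B open_contains_ball by blast
  obtain X0 where X0: "x0 \<in> X0" "open X0" "\<forall>x\<in>X0 \<inter> UNIV. \<forall>t\<in>UNIV. dist ((\<lambda>p. F (fst p) (snd p)) (x, t)) ((\<lambda>p. F (fst p) (snd p)) (x0, t)) \<le> e / 2"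
    by (rule continuous_on_prod_compactE[of UNIV UNIV "\<lambda>p. F (fst p) (snd p)" x0 "e / 2"])
      (use F compact_space e in auto)
  have "(\<integral>y. F x y \<partial>M) \<in> B" if "x \<in> X0" for x
  proof -
    have "norm (\<integral>y. F x y - F x0 y \<partial>M) \<le> e / 2"
      using X0(3) that Fx by (intro norm_integral_le continuous_on_diff) (auto simp: dist_norm)
    then have "dist (\<integral>y. F x0 y \<partial>M) (\<integral>y. F x y \<partial>M) \<le> e / 2"
      using Fx by (simp add: Bochner_Integration.integral_diff integrable_cont dist_norm norm_minus_commute)
    then show ?thesis using e by (intro subsetD[OF e(2)]) auto
  qed
  then show "\<exists>A. open A \<and> x0 \<in> A \<and> (\<forall>y\<in>UNIV. y \<in> A \<longrightarrow> (\<integral>ya. F y ya \<partial>M) \<in> B)"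
    using X0 by blast
qed

text \<open>Fubini for continuous functions. The library version does not apply, since the Borel sets
  of \<open>G \<times> G\<close> need not be generated by rectangles; the integrals are compared
  with the same Riemann sum instead.\<close>

lemma integral_swap:
  fixes F :: "'g \<Rightarrow> 'g \<Rightarrow> complex"
  assumes F: "continuous_on UNIV (\<lambda>p. F (fst p) (snd p))"
  shows "(\<integral>x. \<integral>y. F x y \<partial>M \<partial>M) = (\<integral>y. \<integral>x. F x y \<partial>M \<partial>M)"
proof -
  have Fx: "continuous_on UNIV (F x)" for x
    using continuous_on_compose2[OF F, of UNIV "\<lambda>y. (x, y)"] by (simp add: continuous_on_Pair)
  have Fy: "continuous_on UNIV (\<lambda>x. F x y)" for y
    using continuous_on_compose2[OF F, of UNIV "\<lambda>x. (x, y)"] by (simp add: continuous_on_Pair)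
  have F': "continuous_on UNIV (\<lambda>p. F (snd p) (fst p))"
    using continuous_on_compose2[OF F, of UNIV "\<lambda>p. (snd p, fst p)"]
    by (simp add: continuous_on_Pair continuous_on_fst continuous_on_snd)
  define G where "G y = (\<integral>x. F x y \<partial>M)" for y
  have G: "continuous_on UNIV G" unfolding G_def by (rule continuous_integral[OF F'])
  have H: "continuous_on UNIV (\<lambda>x. \<integral>y. F x y \<partial>M)" by (rule continuous_integral[OF F])
  have "norm ((\<integral>x. \<integral>y. F x y \<partial>M \<partial>M) - (\<integral>y. G y \<partial>M)) \<le> 2 * e" if e: "e > 0" for e
  proof -
    \<comment> \<open>Compactness in \<open>x\<close> makes the oscillation bound uniform, so one
      cover serves all the functions \<open>F x\<close>.\<close>
    have "\<exists>X0. y \<in> X0 \<and> open X0 \<and> (\<forall>y'\<in>X0. \<forall>x. dist (F x y') (F x y) \<le> e)" for y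
    proof -
      obtain X0 where "y \<in> X0" "open X0" "\<forall>y'\<in>X0 \<inter> UNIV. \<forall>x\<in>UNIV. dist ((\<lambda>p. F (snd p) (fst p)) (y', x)) ((\<lambda>p. F (snd p) (fst p)) (y, x)) \<le> e"
        by (rule continuous_on_prod_compactE[of UNIV UNIV "\<lambda>p. F (snd p) (fst p)" y e])
          (use F' compact_space e in auto)
      then show ?thesis by auto
    qed
    then obtain V where V: "\<And>y. y \<in> V y" "\<And>y. open (V y)" "\<And>y y' x. y' \<in> V y \<Longrightarrow> dist (F x y') (F x y) \<le> e"
      by metis
    have "UNIV \<subseteq> (\<Union>y\<in>UNIV. V y)" using V(1) by blast
    then obtain S where S: "finite S" "UNIV \<subseteq> (\<Union>y\<in>S. V y)"
      using compactE_image[OF compact_space, of UNIV V] V(2) by auto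
    obtain ys where ys: "set ys = S" using finite_list[OF S(1)] by blast
    define n where "n = length ys"
    \<comment> \<open>Disjointing the finite subcover gives a measurable partition whose weights and
      sample points do not depend on \<open>x\<close>.\<close>
    define E where "E = disjointed (\<lambda>i. if i < n then V (ys ! i) else {})"
    have EV: "E i \<subseteq> V (ys ! i)" if "i < n" for i
      using disjointed_subset[of "\<lambda>i. if i < n then V (ys ! i) else {}" i] that by (simp add: E_def)
    have Emeas: "E i \<in> sets M" for i
    proof -
      have "range (\<lambda>i. if i < n then V (ys ! i) else {}) \<subseteq> sets M" using V(2) sets_M by auto
      then show ?thesis unfolding E_def using sets.range_disjointed_sets by blast
    qed
    have disj: "disjoint_family E" unfolding E_def by (rule disjoint_family_disjointed)
    have cover: "\<exists>i<n. y \<in> E i" for y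
    proof -
      have "y \<in> (\<Union>i. if i < n then V (ys ! i) else {})"
        using S(2) ys by (auto simp: n_def in_set_conv_nth) (metis UNIV_I UN_E in_set_conv_nth subsetD)
      then have "y \<in> (\<Union>i. E i)" by (simp add: E_def UN_disjointed_eq)
      then obtain i where i: "y \<in> E i" by blast
      then have "y \<in> (if i < n then V (ys ! i) else {})"
        unfolding E_def using disjointed_subset[of "\<lambda>i. if i < n then V (ys ! i) else {}" i] by blast
      then show ?thesis using i by (cases "i < n") auto
    qed
    define w where "w i = measure M (E i)" for i
    \<comment> \<open>Used for every \<open>F x\<close> and for \<open>G\<close>, which puts both
      iterated integrals within \<open>e\<close> of the same sum.\<close>
    have riemann: "norm ((\<integral>y. h y \<partial>M) - (\<Sum>i<n. w i *\<^sub>R h (ys ! i))) \<le> e"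
      if h: "continuous_on UNIV h" and close: "\<And>i y. i < n \<Longrightarrow> y \<in> V (ys ! i) \<Longrightarrow> dist (h y) (h (ys ! i)) \<le> e"
      for h :: "'g \<Rightarrow> complex"
    proof -
      define s where "s y = (\<Sum>i<n. indicat_real (E i) y *\<^sub>R h (ys ! i))" for y
      have ints: "integrable M s"
        unfolding s_def using Emeas by (intro Bochner_Integration.integrable_sum integrable_scaleR_left integrable_real_indicator) (auto simp: less_top[symmetric])
      have "(\<integral>y. s y \<partial>M) = (\<Sum>i<n. w i *\<^sub>R h (ys ! i))"
        unfolding s_def w_def using Emeas sets.sets_into_space[OF Emeas]
        by (subst Bochner_Integration.integral_sum) (auto simp: less_top[symmetric] Int_absorb2 space_M)
      then have "(\<integral>y. h y \<partial>M) - (\<Sum>i<n. w i *\<^sub>R h (ys ! i)) = (\<integral>y. h y - s y \<partial>M)"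
        using ints integrable_cont[OF h] by simp
      also have "norm \<dots> \<le> (\<integral>y. norm (h y - s y) \<partial>M)" by (rule integral_norm_bound)
      also have "\<dots> \<le> (\<integral>y. e \<partial>M)"
      proof (rule integral_mono)
        fix y
        obtain i where i: "i < n" "y \<in> E i" using cover by blast
        have "s y = (\<Sum>j<n. if j = i then h (ys ! i) else 0)"
          unfolding s_def
        proof (intro sum.cong refl)
          fix j assume "j \<in> {..<n}"
          show "indicat_real (E j) y *\<^sub>R h (ys ! j) = (if j = i then h (ys ! i) else 0)"
            using i disjoint_family_onD[OF disj, of i j] by (cases "j = i") (auto simp: indicator_def)
        qed
        also have "\<dots> = h (ys ! i)" using i by simp
        finally show "norm (h y - s y) \<le> e" using close[OF i(1)] EV[OF i(1)] i(2) by (auto simp: dist_norm)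
      qed (use ints integrable_cont[OF h] in auto)
      finally show ?thesis by (simp add: space_M measure_space)
    qed
    have "norm ((\<integral>x. (\<integral>y. F x y \<partial>M) - (\<Sum>i<n. w i *\<^sub>R F x (ys ! i)) \<partial>M)) \<le> e"
      using Fy by (intro norm_integral_le riemann Fx V continuous_intros H) auto
    also have "(\<integral>x. (\<integral>y. F x y \<partial>M) - (\<Sum>i<n. w i *\<^sub>R F x (ys ! i)) \<partial>M)
        = (\<integral>x. (\<integral>y. F x y \<partial>M) \<partial>M) - (\<Sum>i<n. w i *\<^sub>R G (ys ! i))"
    proof -
      have "(\<integral>x. (\<Sum>i<n. w i *\<^sub>R F x (ys ! i)) \<partial>M) = (\<Sum>i<n. w i *\<^sub>R G (ys ! i))"
        unfolding G_def using Fy by (subst Bochner_Integration.integral_sum) (auto intro!: integrable_cont continuous_intros)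
      moreover have "integrable M (\<lambda>x. \<Sum>i<n. w i *\<^sub>R F x (ys ! i))"
        using Fy by (intro integrable_cont continuous_intros) auto
      ultimately show ?thesis using integrable_cont[OF H] by (simp add: Bochner_Integration.integral_diff)
    qed
    finally have 1: "norm ((\<integral>x. \<integral>y. F x y \<partial>M \<partial>M) - (\<Sum>i<n. w i *\<^sub>R G (ys ! i))) \<le> e" .
    have 2: "norm ((\<integral>y. G y \<partial>M) - (\<Sum>i<n. w i *\<^sub>R G (ys ! i))) \<le> e"
    proof (rule riemann[OF G])
      fix i y assume "i < n" "y \<in> V (ys ! i)"
      then have "norm (\<integral>x. F x y - F x (ys ! i) \<partial>M) \<le> e"
        using Fy V(3) by (intro norm_integral_le continuous_on_diff) (auto simp: dist_norm)
      then show "dist (G y) (G (ys ! i)) \<le> e"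
        using Fy by (simp add: G_def dist_norm Bochner_Integration.integral_diff integrable_cont)
    qed
    show ?thesis using norm_triangle_ineq4[of "(\<integral>x. \<integral>y. F x y \<partial>M \<partial>M) - (\<Sum>i<n. w i *\<^sub>R G (ys ! i))" "(\<integral>y. G y \<partial>M) - (\<Sum>i<n. w i *\<^sub>R G (ys ! i))"] 1 2
      by simp
  qed
  then have "norm ((\<integral>x. \<integral>y. F x y \<partial>M \<partial>M) - (\<integral>y. G y \<partial>M)) \<le> 0 + d" if "d > 0" for d :: real
    using that by (metis add_0 field_sum_of_halves half_gt_zero mult_2)
  then have "norm ((\<integral>x. \<integral>y. F x y \<partial>M \<partial>M) - (\<integral>y. G y \<partial>M)) \<le> 0"
    by (rule field_le_epsilon)
  then show ?thesis by (simp add: G_def)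
qed

text \<open>Invariance under inversion comes from averaging \<open>f (z - y)\<close> over both
  variables: integrating over \<open>z\<close> first gives the integral of \<open>f\<close>,
  integrating over \<open>y\<close> first gives that of the reflection.\<close>

lemma integral_reflect:
  fixes f :: "'g \<Rightarrow> complex"
  assumes f: "continuous_on UNIV f"
  shows "(\<integral>y. f (x - y) \<partial>M) = (\<integral>y. f y \<partial>M)"
proof -
  have neg: "continuous_on UNIV (\<lambda>y. f (- y))"
    by (intro continuous_on_shift[OF f] continuous_intros)
  have tr: "(\<integral>y. f (z - y) \<partial>M) = (\<integral>y. f (- y) \<partial>M)" for z
    using integral_translate[OF neg, of "- z"] by simp
  have "(\<integral>z. \<integral>y. f (z - y) \<partial>M \<partial>M) = (\<integral>y. \<integral>z. f (z - y) \<partial>M \<partial>M)"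
    by (intro integral_swap continuous_on_shift[OF f] continuous_intros)
  moreover have "(\<integral>z. f (z - y) \<partial>M) = (\<integral>z. f z \<partial>M)" for y
    using integral_translate[OF f, of "- y"] by (simp add: add.commute)
  ultimately show ?thesis by (simp add: tr space_M measure_space)
qed

section \<open>The convolution algebra of continuous functions\<close>

definition conv :: "('g \<Rightarrow> complex) \<Rightarrow> ('g \<Rightarrow> complex) \<Rightarrow> 'g \<Rightarrow> complex" where
  "conv f g x = (\<integral>y. f (x - y) * g y \<partial>M)"

text \<open>The involution of the algebra: convolution with \<open>star f\<close> is the L2 adjoint
  of convolution with \<open>f\<close>.\<close>

definition star :: "('g \<Rightarrow> complex) \<Rightarrow> 'g \<Rightarrow> complex" where
  "star f x = cnj (f (- x))"

definition sqnorm :: "('g \<Rightarrow> complex) \<Rightarrow> real" where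
  "sqnorm f = (\<integral>x. (cmod (f x))\<^sup>2 \<partial>M)"

lemma continuous_on_conv:
  assumes "continuous_on UNIV f" "continuous_on UNIV g"
  shows "continuous_on UNIV (conv f g)"
  unfolding conv_def
  by (rule continuous_integral)
    (intro continuous_on_mult continuous_on_shift[OF assms(1)] continuous_on_shift[OF assms(2)] continuous_intros)

lemma continuous_on_star:
  assumes "continuous_on UNIV f" shows "continuous_on UNIV (star f)"
  unfolding star_def by (intro continuous_on_cnj continuous_on_shift[OF assms] continuous_intros)

lemma integrable_conv:
  fixes f g :: "'g \<Rightarrow> complex"
  assumes "continuous_on UNIV f" "continuous_on UNIV g"
  shows "integrable M (\<lambda>y. f (x - y) * g y)"
  by (rule integrable_cont)
    (intro continuous_on_mult continuous_on_shift[OF assms(1)] assms(2) continuous_intros)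

lemma conv_commute:
  assumes "continuous_on UNIV f" "continuous_on UNIV g"
  shows "conv f g = conv g f"
proof
  fix x
  have c: "continuous_on UNIV (\<lambda>y. f (x - y) * g y)"
    by (intro continuous_on_mult continuous_on_shift[OF assms(1)] assms(2) continuous_intros)
  show "conv f g x = conv g f x"
    unfolding conv_def using integral_reflect[OF c, of x] by (simp add: mult.commute)
qed

lemma conv_assoc:
  assumes f: "continuous_on UNIV f" and g: "continuous_on UNIV g" and h: "continuous_on UNIV h"
  shows "conv (conv f g) h = conv f (conv g h)"
proof
  fix x
  have "conv f (conv g h) x = (\<integral>w. \<integral>y. f (x - w) * (g (w - y) * h y) \<partial>M \<partial>M)"
    unfolding conv_def by simp
  also have "\<dots> = (\<integral>y. \<integral>w. f (x - w) * (g (w - y) * h y) \<partial>M \<partial>M)"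
    by (intro integral_swap continuous_on_mult continuous_on_shift[OF f] continuous_on_shift[OF g] continuous_on_shift[OF h] continuous_intros)
  also have "\<dots> = (\<integral>y. conv f g (x - y) * h y \<partial>M)"
  proof (intro Bochner_Integration.integral_cong refl)
    fix y
    have c: "continuous_on UNIV (\<lambda>w. f (x - w) * (g (w - y) * h y))"
      by (intro continuous_on_mult continuous_on_shift[OF f] continuous_on_shift[OF g] continuous_intros)
    have "(\<integral>w. f (x - w) * (g (w - y) * h y) \<partial>M) = (\<integral>z. f (x - y - z) * g z * h y \<partial>M)"
      using integral_translate[OF c, of y] by (simp add: diff_diff_eq mult.assoc)
    then show "(\<integral>w. f (x - w) * (g (w - y) * h y) \<partial>M) = conv f g (x - y) * h y"
      by (simp add: conv_def)
  qed
  finally show "conv (conv f g) h x = conv f (conv g h) x" by (simp add: conv_def)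
qed

lemma conv_scale_right: "conv f (\<lambda>x. a * g x) = (\<lambda>x. a * conv f g x)"
  by (simp add: conv_def fun_eq_iff mult.left_commute)

lemma conv_scale_left: "conv (\<lambda>x. a * f x) g = (\<lambda>x. a * conv f g x)"
  by (simp add: conv_def fun_eq_iff mult.assoc)

lemma conv_diff_right:
  assumes "continuous_on UNIV f" "continuous_on UNIV g" "continuous_on UNIV h"
  shows "conv f (\<lambda>x. g x - h x) = (\<lambda>x. conv f g x - conv f h x)"
  using integrable_conv[OF assms(1,2)] integrable_conv[OF assms(1,3)]
  by (simp add: conv_def fun_eq_iff right_diff_distrib)

lemma conv_add_right:
  assumes "continuous_on UNIV f" "continuous_on UNIV g" "continuous_on UNIV h"
  shows "conv f (\<lambda>x. g x + h x) = (\<lambda>x. conv f g x + conv f h x)"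
  using integrable_conv[OF assms(1,2)] integrable_conv[OF assms(1,3)]
  by (simp add: conv_def fun_eq_iff distrib_left)

text \<open>Translations commute with convolution, so the translates of an idempotent stay in its
  ideal.\<close>

lemma conv_shift_left: "conv (\<lambda>y. f (y - z)) g = (\<lambda>x. conv f g (x - z))"
  by (simp add: conv_def fun_eq_iff diff_diff_eq add.commute)

lemma star_conv:
  assumes "continuous_on UNIV f" "continuous_on UNIV g"
  shows "star (conv f g) = conv (star f) (star g)"
proof
  fix x
  have c: "continuous_on UNIV (\<lambda>y. f (- x - y) * g y)"
    by (intro continuous_on_mult continuous_on_shift[OF assms(1)] assms(2) continuous_intros)
  have "conv f g (- x) = (\<integral>y. f (- x + y) * g (- y) \<partial>M)"
    unfolding conv_def using integral_reflect[OF c, of 0] by simp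
  then have "star (conv f g) x = (\<integral>y. cnj (f (- x + y) * g (- y)) \<partial>M)"
    by (simp only: star_def Bochner_Integration.integral_cnj)
  then show "star (conv f g) x = conv (star f) (star g) x"
    by (simp add: conv_def star_def)
qed

lemma sqnorm_nonneg: "sqnorm f \<ge> 0"
  by (simp add: sqnorm_def)

text \<open>Evaluation at 0 plays the role of a trace: L2 norms become values of continuous
  functions and are additive where the functions are.\<close>

lemma conv_star_zero:
  assumes "continuous_on UNIV f"
  shows "conv f (star f) 0 = of_real (sqnorm f)"
proof -
  have c: "continuous_on UNIV (\<lambda>y. complex_of_real ((cmod (f y))\<^sup>2))"
    by (intro continuous_on_of_real continuous_intros assms)
  have "conv f (star f) 0 = (\<integral>y. complex_of_real ((cmod (f (0 - y)))\<^sup>2) \<partial>M)"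
    by (simp only: conv_def star_def complex_norm_square diff_0)
  also have "\<dots> = of_real (sqnorm f)" unfolding integral_reflect[OF c] sqnorm_def by (rule integral_complex_of_real)
  finally show ?thesis .
qed

lemma sqnorm_pos:
  assumes "continuous_on UNIV f" "f \<noteq> (\<lambda>_. 0)"
  shows "sqnorm f > 0"
proof (rule ccontr)
  assume "\<not> sqnorm f > 0"
  then have z: "sqnorm f = 0" using sqnorm_nonneg[of f] by simp
  have "integrable M (\<lambda>x. (cmod (f x))\<^sup>2)"
    by (intro integrable_cont continuous_intros assms)
  then have "AE x in M. f x = 0"
    using z integral_nonneg_eq_0_iff_AE[of M "\<lambda>x. (cmod (f x))\<^sup>2"] by (simp add: sqnorm_def)
  moreover have op: "open {x. f x \<noteq> 0}"
    using assms(1) by (intro open_Collect_neq) auto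
  ultimately have "emeasure M {x. f x \<noteq> 0} = 0"
    using sets_M by (subst (asm) AE_iff_measurable[OF _ refl]) (auto simp: space_M)
  moreover obtain x0 where "f x0 \<noteq> 0" using assms(2) by auto
  ultimately show False using emeasure_open_pos[OF op, of x0] by simp
qed

lemma cauchy_schwarz:
  assumes f: "continuous_on UNIV f" and g: "continuous_on UNIV g"
  shows "(cmod (\<integral>x. f x * g x \<partial>M))\<^sup>2 \<le> sqnorm f * sqnorm g"
proof -
  define B where "B = (\<integral>x. cmod (f x) * cmod (g x) \<partial>M)"
  have i: "integrable M (\<lambda>x. (cmod (f x))\<^sup>2)" "integrable M (\<lambda>x. (cmod (g x))\<^sup>2)"
    "integrable M (\<lambda>x. cmod (f x) * cmod (g x))"
    by (intro integrable_cont continuous_intros f g)+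
  have quad: "0 \<le> t\<^sup>2 * sqnorm f - 2 * t * B + sqnorm g" for t
  proof -
    have "0 \<le> (\<integral>x. (t * cmod (f x) - cmod (g x))\<^sup>2 \<partial>M)" by simp
    also have "\<dots> = (\<integral>x. t\<^sup>2 * (cmod (f x))\<^sup>2 - 2 * t * (cmod (f x) * cmod (g x)) + (cmod (g x))\<^sup>2 \<partial>M)"
      by (intro Bochner_Integration.integral_cong refl) (simp add: power2_eq_square algebra_simps)
    also have "\<dots> = t\<^sup>2 * sqnorm f - 2 * t * B + sqnorm g"
      unfolding sqnorm_def B_def using i by simp
    finally show ?thesis .
  qed
  have "B\<^sup>2 \<le> sqnorm f * sqnorm g"
  proof (cases "sqnorm f = 0")
    case True
    have "B \<le> 0"
    proof (rule ccontr)
      assume "\<not> B \<le> 0"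
      \<comment> \<open>At this \<open>t\<close> the quadratic expression equals -1.\<close>
      then show False using quad[of "(sqnorm g + 1) / (2 * B)"] True by (simp add: field_simps)
    qed
    moreover have "B \<ge> 0" by (simp add: B_def)
    ultimately show ?thesis using True by simp
  next
    case False
    then have "sqnorm f > 0" using sqnorm_nonneg[of f] by simp
    \<comment> \<open>The minimiser of the quadratic expression.\<close>
    then show ?thesis using quad[of "B / sqnorm f"] by (simp add: field_simps power2_eq_square)
  qed
  moreover have "cmod (\<integral>x. f x * g x \<partial>M) \<le> B"
    unfolding B_def using integral_norm_bound[of M "\<lambda>x. f x * g x"] by (simp add: norm_mult)
  then have "(cmod (\<integral>x. f x * g x \<partial>M))\<^sup>2 \<le> B\<^sup>2" by (intro power_mono) auto
  ultimately show ?thesis by linarith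
qed

text \<open>A pointwise bound by L2 norms: one more convolution upgrades L2 convergence to uniform
  convergence.\<close>

lemma norm_conv_le:
  assumes f: "continuous_on UNIV f" and g: "continuous_on UNIV g"
  shows "(cmod (conv f g x))\<^sup>2 \<le> sqnorm f * sqnorm g"
proof -
  have fx: "continuous_on UNIV (\<lambda>y. f (x - y))" by (intro continuous_on_shift[OF f] continuous_intros)
  have c: "continuous_on UNIV (\<lambda>y. complex_of_real ((cmod (f y))\<^sup>2))"
    by (intro continuous_on_of_real continuous_intros f)
  have "complex_of_real (sqnorm (\<lambda>y. f (x - y))) = of_real (sqnorm f)"
    unfolding sqnorm_def using integral_reflect[OF c, of x] by (simp only: integral_complex_of_real)
  then have "sqnorm (\<lambda>y. f (x - y)) = sqnorm f" by simp
  then show ?thesis unfolding conv_def using cauchy_schwarz[OF fx g] by simp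
qed

lemma sqnorm_conv_le:
  assumes "continuous_on UNIV f" "continuous_on UNIV g"
  shows "sqnorm (conv f g) \<le> sqnorm f * sqnorm g"
proof -
  have "sqnorm (conv f g) \<le> (\<integral>x. sqnorm f * sqnorm g \<partial>M)"
    unfolding sqnorm_def[of "conv f g"]
  proof (rule integral_mono)
    show "integrable M (\<lambda>x. (cmod (conv f g x))\<^sup>2)"
      by (intro integrable_cont continuous_on_power continuous_on_norm continuous_on_conv assms)
    show "(cmod (conv f g x))\<^sup>2 \<le> sqnorm f * sqnorm g" for x by (rule norm_conv_le[OF assms])
  qed simp
  then show ?thesis by (simp add: space_M measure_space)
qed

end

text \<open>The quotients of consecutive terms increase by log-convexity and are bounded by
  \<open>s 0\<close>; \<Lambda> is their limit, so the normalised sequence decreases. If one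
  normalised term were below 1, submultiplicativity would keep every product of that many
  consecutive normalised quotients below it, whereas these products tend to 1. The bound 1 later
  keeps the limit idempotent from vanishing.\<close>

lemma log_convex_submultiplicative_growth:
  fixes s :: "nat \<Rightarrow> real"
  assumes pos: "\<And>n. s n > 0"
    and conv: "\<And>n. (s (Suc n))\<^sup>2 \<le> s n * s (Suc (Suc n))"
    and sub: "\<And>m n. s (Suc (m + n)) \<le> s m * s n"
  obtains \<Lambda> where "\<Lambda> > 0" "decseq (\<lambda>n. s n / \<Lambda> ^ Suc n)" "\<And>n. 1 \<le> s n / \<Lambda> ^ Suc n"
proof -
  define \<rho> where "\<rho> n = s (Suc n) / s n" for n
  have "incseq \<rho>"
    using conv pos by (intro incseq_SucI) (simp add: \<rho>_def field_simps power2_eq_square)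
  moreover have bd: "\<rho> n \<le> s 0" for n
    using sub[of 0 n] pos[of n] by (simp add: \<rho>_def field_simps)
  ultimately obtain \<Lambda> where lim: "\<rho> \<longlonglongrightarrow> \<Lambda>" and le: "\<And>n. \<rho> n \<le> \<Lambda>"
    using incseq_convergent[of \<rho> "s 0"] by blast
  have \<rho>0: "\<rho> n > 0" for n using pos by (simp add: \<rho>_def)
  have \<Lambda>0: "\<Lambda> > 0" using \<rho>0[of 0] le[of 0] by linarith
  define t where "t n = s n / \<Lambda> ^ Suc n" for n
  have t0: "t n > 0" for n using pos \<Lambda>0 by (simp add: t_def)
  have tS: "t (Suc n) = (\<rho> n / \<Lambda>) * t n" for n
    using pos[of n] \<Lambda>0 by (simp add: t_def \<rho>_def field_simps)
  have dec: "decseq t"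
  proof (rule decseq_SucI)
    fix n
    have "\<rho> n / \<Lambda> \<le> 1" using le[of n] \<Lambda>0 by simp
    then show "t (Suc n) \<le> t n" unfolding tS using mult_right_mono[of "\<rho> n / \<Lambda>" 1 "t n"] t0[of n] by simp
  qed
  have tsub: "t (Suc (m + n)) \<le> t m * t n" for m n
    using sub[of m n] \<Lambda>0 by (simp add: t_def power_add divide_right_mono mult_ac)
  have ge1: "1 \<le> t n" for n
  proof (rule ccontr)
    assume "\<not> 1 \<le> t n"
    have prod: "t (m + k) = (\<Prod>i<k. \<rho> (m + i) / \<Lambda>) * t m" for m k
      by (induction k) (simp_all add: tS)
    have "(\<lambda>m. \<Prod>i<Suc n. \<rho> (m + i) / \<Lambda>) \<longlonglongrightarrow> (\<Prod>i<Suc n. \<Lambda> / \<Lambda>)"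
      using \<Lambda>0 by (intro tendsto_prod tendsto_divide LIMSEQ_ignore_initial_segment[OF lim] tendsto_const) auto
    moreover have "(\<Prod>i<Suc n. \<rho> (m + i) / \<Lambda>) \<le> t n" for m
    proof -
      have "(\<Prod>i<Suc n. \<rho> (m + i) / \<Lambda>) * t m \<le> t n * t m"
        using tsub[of m n] prod[of m "Suc n"] by (simp add: mult.commute)
      then show ?thesis using t0[of m] by (rule mult_right_le_imp_le)
    qed
    ultimately have "(\<Prod>i<Suc n. \<Lambda> / \<Lambda>) \<le> t n"
      by (intro LIMSEQ_le_const2) blast+
    then show False using \<open>\<not> 1 \<le> t n\<close> \<Lambda>0 by simp
  qed
  show thesis using that[of \<Lambda>] \<Lambda>0 dec ge1 by (simp add: t_def[abs_def])
qed

section \<open>Power iteration\<close>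

context compact_haar
begin

lemma conv_tendsto:
  assumes g: "continuous_on UNIV g" and u: "\<And>n. continuous_on UNIV (u n)" and P: "continuous_on UNIV P"
    and lim: "uniform_limit UNIV u P sequentially"
  shows "(\<lambda>n. conv g (u n) x) \<longlonglongrightarrow> conv g P x"
proof (rule LIMSEQ_I)
  fix r :: real assume "r > 0"
  obtain B where B: "B > 0" "\<And>x. norm (g x) \<le> B" using bounded_cont[OF g] by blast
  have "\<forall>\<^sub>F n in sequentially. \<forall>y\<in>UNIV. dist (u n y) (P y) < r / (2 * B)"
    using lim B \<open>r > 0\<close> by (intro uniform_limitD) auto
  then obtain N where N: "\<And>n y. n \<ge> N \<Longrightarrow> dist (u n y) (P y) < r / (2 * B)"
    by (auto simp: eventually_sequentially)
  have "norm (conv g (u n) x - conv g P x) < r" if "n \<ge> N" for n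
  proof -
    have d: "continuous_on UNIV (\<lambda>y. u n y - P y)" by (intro continuous_on_diff u P)
    have "conv g (u n) x - conv g P x = conv g (\<lambda>y. u n y - P y) x"
      by (simp add: conv_diff_right[OF g u P])
    also have "norm \<dots> \<le> B * (r / (2 * B))"
      unfolding conv_def
    proof (rule norm_integral_le)
      show "continuous_on UNIV (\<lambda>y. g (x - y) * (u n y - P y))"
        by (intro continuous_on_mult continuous_on_shift[OF g] d continuous_intros)
      show "norm (g (x - y) * (u n y - P y)) \<le> B * (r / (2 * B))" for y
        unfolding norm_mult using B N[OF that, of y] by (intro mult_mono) (auto simp: dist_norm)
    qed
    also have "\<dots> < r" using B(1) \<open>r > 0\<close> by simp
    finally show ?thesis .
  qed
  then show "\<exists>no. \<forall>n\<ge>no. norm (conv g (u n) x - conv g P x) < r" by blast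
qed

lemma sqnorm_diff_hermitian:
  assumes f: "continuous_on UNIV f" "star f = f" and g: "continuous_on UNIV g" "star g = g"
  shows "complex_of_real (sqnorm (\<lambda>x. f x - g x)) = conv f f 0 - 2 * conv f g 0 + conv g g 0"
proof -
  have d: "continuous_on UNIV (\<lambda>x. f x - g x)" by (intro continuous_on_diff f g)
  have sd: "star (\<lambda>x. f x - g x) = (\<lambda>x. f x - g x)"
    using f(2) g(2) by (simp add: star_def fun_eq_iff)
  have "complex_of_real (sqnorm (\<lambda>x. f x - g x)) = conv (\<lambda>x. f x - g x) (\<lambda>x. f x - g x) 0"
    using conv_star_zero[OF d] sd by simp
  also have "\<dots> = conv f (\<lambda>x. f x - g x) 0 - conv g (\<lambda>x. f x - g x) 0"
    using conv_commute[OF d f(1)] conv_commute[OF d g(1)] conv_commute[OF d d] conv_diff_right[OF d f(1) g(1)] by simp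
  also have "\<dots> = conv f f 0 - 2 * conv f g 0 + conv g g 0"
    using conv_diff_right[OF f(1) f(1) g(1)] conv_diff_right[OF g(1) f(1) g(1)] conv_commute[OF f(1) g(1)] by simp
  finally show ?thesis .
qed

primrec cpow :: "('g \<Rightarrow> complex) \<Rightarrow> nat \<Rightarrow> 'g \<Rightarrow> complex" where
  "cpow q 0 = q"
| "cpow q (Suc n) = conv q (cpow q n)"

lemma cpow_cont: "continuous_on UNIV q \<Longrightarrow> continuous_on UNIV (cpow q n)"
  by (induction n) (auto intro: continuous_on_conv)

lemma cpow_star:
  assumes "continuous_on UNIV q" "star q = q"
  shows "star (cpow q n) = cpow q n"
  using assms by (induction n) (auto simp: star_conv cpow_cont)

lemma conv_cpow:
  assumes "continuous_on UNIV q"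
  shows "conv (cpow q m) (cpow q n) = cpow q (Suc (m + n))"
  by (induction m) (simp_all add: conv_assoc assms cpow_cont)

text \<open>Power iteration: \<open>q\<^bsup>2n\<^esup> / \<Lambda>\<^bsup>n\<^esup>\<close> converges uniformly to the spectral projection \<open>P\<close> of the largest
  eigenvalue \<open>\<Lambda>\<close> of convolution with \<open>q * q\<close>. (In the code the index is shifted: \<open>cpow q n\<close> is the power \<open>n + 1\<close>.) With \<open>t n = \<parallel>q\<^bsup>n\<^esup>\<parallel>\<^sup>2 / \<Lambda>\<^bsup>n\<^esup>\<close>, the squared distance of the
  \<open>m\<close>-th and \<open>n\<close>-th iterates is \<open>t (2n) - 2 t (n + m) + t (2m)\<close>, and \<open>t\<close> decreases.\<close>

lemma spectral_idempotent:
  assumes q: "continuous_on UNIV q" "star q = q" "q \<noteq> (\<lambda>_. 0)"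
  obtains P and \<Lambda> :: real where "continuous_on UNIV P" "star P = P" "conv P P = P" "P \<noteq> (\<lambda>_. 0)"
    "conv (conv q q) P = (\<lambda>x. of_real \<Lambda> * P x)"
    "\<And>R a. continuous_on UNIV R \<Longrightarrow> conv R q = (\<lambda>x. a * q x) \<Longrightarrow> conv R P = (\<lambda>x. a * P x)"
proof -
  define e where "e = cpow q"
  have ec: "continuous_on UNIV (e n)" for n using cpow_cont[OF q(1)] by (simp add: e_def)
  have es: "star (e n) = e n" for n using cpow_star[OF q(1,2)] by (simp add: e_def)
  have ee: "conv (e m) (e n) = e (Suc (m + n))" for m n using conv_cpow[OF q(1)] by (simp add: e_def)
  define s where "s n = sqnorm (e n)" for n
  have es0: "e (Suc (n + n)) 0 = of_real (s n)" for n
    using conv_star_zero[OF ec, of n] es[of n] ee[of n n] by (simp add: s_def)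
  \<comment> \<open>Cauchy-Schwarz: the convolution of \<open>e n\<close> with
    \<open>e (n + 2)\<close> is that of \<open>e (n + 1)\<close> with itself, whose value at 0 is
    \<open>s (n + 1)\<close>.\<close>
  have conv: "(s (Suc n))\<^sup>2 \<le> s n * s (Suc (Suc n))" for n
  proof -
    have "(cmod (conv (e n) (e (Suc (Suc n))) 0))\<^sup>2 \<le> s n * s (Suc (Suc n))"
      unfolding s_def by (rule norm_conv_le[OF ec ec])
    then show ?thesis using es0[of "Suc n"] by (simp add: ee)
  qed
  have sub: "s (Suc (m + n)) \<le> s m * s n" for m n
    unfolding s_def ee[symmetric] by (rule sqnorm_conv_le[OF ec ec])
  have pos: "s n > 0 \<and> s (Suc n) > 0" for n
  proof (induction n)
    case 0
    have "s 0 > 0" using sqnorm_pos[OF q(1,3)] by (simp add: s_def e_def)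
    moreover have "e 1 0 \<noteq> 0" using es0[of 0] \<open>s 0 > 0\<close> by simp
    then have "e 1 \<noteq> (\<lambda>_. 0)" by auto
    then have "s 1 > 0" unfolding s_def by (rule sqnorm_pos[OF ec])
    ultimately show ?case by simp
  next
    case (Suc n)
    then have "0 < s n * s (Suc (Suc n))" using conv[of n] by (smt (verit) zero_less_power)
    then show ?case using Suc by (simp add: zero_less_mult_iff)
  qed
  obtain \<Lambda> where \<Lambda>: "\<Lambda> > 0" "decseq (\<lambda>n. s n / \<Lambda> ^ Suc n)" "\<And>n. 1 \<le> s n / \<Lambda> ^ Suc n"
    using log_convex_submultiplicative_growth[of s] pos conv sub by metis
  define t where "t n = s n / \<Lambda> ^ Suc n" for n
  have "decseq t" "\<And>n. 1 \<le> t n" using \<Lambda>(2,3) by (simp_all only: t_def[abs_def])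
  then obtain L where L: "t \<longlonglongrightarrow> L" using decseq_convergent[of t 1] by blast
  have "1 \<le> L" using \<Lambda>(3) by (intro LIMSEQ_le_const[OF L]) (auto simp: t_def)
  \<comment> \<open>Only even powers of \<open>q\<close> occur: convolution with \<open>q\<close>
    may have eigenvalues of both signs, whose odd powers would not settle.\<close>
  define u where "u n = (\<lambda>x. of_real (1 / \<Lambda> ^ Suc n) * e (Suc (n + n)) x)" for n
  have uc: "continuous_on UNIV (u n)" for n
    unfolding u_def by (intro continuous_on_mult continuous_on_const ec)
  have us: "star (u n) = u n" for n
    using es[of "Suc (n + n)"] by (simp add: u_def star_def fun_eq_iff)
  have uu: "conv (u m) (u n) = u (Suc (m + n))" for m n
    unfolding u_def conv_scale_left conv_scale_right ee
    by (rule ext) (simp add: power_add add_ac field_simps)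
  have u0: "u n 0 = of_real (t n)" for n
    by (simp only: u_def es0 t_def of_real_mult[symmetric]) simp
  have ku: "conv (e 1) (u n) = (\<lambda>x. of_real \<Lambda> * u (Suc n) x)" for n
    unfolding u_def conv_scale_right ee using \<Lambda>(1) by (simp add: fun_eq_iff field_simps)
  have dist2: "sqnorm (\<lambda>x. u m x - u n x) = t (Suc (m + m)) - 2 * t (Suc (m + n)) + t (Suc (n + n))" for m n
  proof -
    have "complex_of_real (sqnorm (\<lambda>x. u m x - u n x)) = of_real (t (Suc (m + m)) - 2 * t (Suc (m + n)) + t (Suc (n + n)))"
      unfolding sqnorm_diff_hermitian[OF uc us uc us] uu u0 by simp
    then show ?thesis by (simp only: of_real_eq_iff)
  qed
  define K where "K = sqnorm (e 1) / \<Lambda>\<^sup>2"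
  have K0: "K \<ge> 0" by (simp add: K_def sqnorm_nonneg)
  \<comment> \<open>Convolution with \<open>e 1\<close> maps \<open>u n\<close> to \<Lambda> times
    the next iterate, so \<open>norm_conv_le\<close> bounds the uniform distance of the successors
    by the L2 distance.\<close>
  have sup: "(cmod (u (Suc m) x - u (Suc n) x))\<^sup>2 \<le> K * sqnorm (\<lambda>x. u m x - u n x)" for m n x
  proof -
    have "conv (e 1) (\<lambda>x. u m x - u n x) x = of_real \<Lambda> * (u (Suc m) x - u (Suc n) x)"
      unfolding conv_diff_right[OF ec uc uc] ku by (simp add: right_diff_distrib)
    then have "(\<Lambda> * cmod (u (Suc m) x - u (Suc n) x))\<^sup>2 \<le> sqnorm (e 1) * sqnorm (\<lambda>x. u m x - u n x)"
      using norm_conv_le[OF ec continuous_on_diff[OF uc uc], of 1 m n x] \<Lambda>(1) by (simp add: norm_mult)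
    then show ?thesis using \<Lambda>(1) by (simp add: K_def field_simps power_mult_distrib)
  qed
  have "uniformly_Cauchy_on UNIV (\<lambda>n. u (Suc n))"
    unfolding uniformly_Cauchy_on_def
  proof (intro allI impI)
    fix r :: real assume "r > 0"
    \<comment> \<open>The squared L2 distance combines values of \<open>t\<close> within
      \<open>d\<close> of \<open>L\<close>, with coefficients 1, -2 and 1, hence stays below
      \<open>4 * d\<close>; \<open>K + 1\<close> replaces \<open>K\<close> because only
      \<open>K \<ge> 0\<close> is known.\<close>
    define d where "d = r\<^sup>2 / (4 * (K + 1))"
    have "d > 0" using \<open>r > 0\<close> K0 by (simp add: d_def)
    then obtain N where N: "\<And>n. n \<ge> N \<Longrightarrow> \<bar>t n - L\<bar> < d"
      using LIMSEQ_D[OF L] by fastforce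
    have "dist (u (Suc m) x) (u (Suc n) x) < r" if mn: "m \<ge> N" "n \<ge> N" for m n x
    proof -
      have "\<bar>t (Suc (m + m)) - L\<bar> < d" "\<bar>t (Suc (m + n)) - L\<bar> < d" "\<bar>t (Suc (n + n)) - L\<bar> < d"
        using mn by (auto intro!: N)
      then have "sqnorm (\<lambda>x. u m x - u n x) \<le> 4 * d" unfolding dist2 by linarith
      then have "K * sqnorm (\<lambda>x. u m x - u n x) \<le> K * (4 * d)" using K0 by (rule mult_left_mono)
      also have "\<dots> < (K + 1) * (4 * d)" using \<open>d > 0\<close> by simp
      also have "\<dots> = r\<^sup>2"
      proof -
        have "K + 1 > 0" using K0 by simp
        then show ?thesis by (simp add: d_def field_simps)
      qed
      finally have "(cmod (u (Suc m) x - u (Suc n) x))\<^sup>2 < r\<^sup>2" using sup[of m x n] by linarith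
      then show ?thesis using \<open>r > 0\<close> by (simp add: dist_norm power_less_imp_less_base)
    qed
    then show "\<exists>N. \<forall>x\<in>UNIV. \<forall>m\<ge>N. \<forall>n\<ge>N. dist (u (Suc m) x) (u (Suc n) x) < r" by blast
  qed
  then obtain P where lim': "uniform_limit UNIV (\<lambda>n. u (Suc n)) P sequentially"
    using Cauchy_uniformly_convergent uniformly_convergent_on_def by blast
  have Pc: "continuous_on UNIV P"
    by (rule uniform_limit_theorem[OF _ lim']) (auto simp: uc)
  have lim: "(\<lambda>n. u n x) \<longlonglongrightarrow> P x" for x
    using tendsto_uniform_limitI[OF lim', of x] by (rule LIMSEQ_imp_Suc) simp
  have clim: "(\<lambda>n. conv R (u n) x) \<longlonglongrightarrow> conv R P x" if "continuous_on UNIV R" for R x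
    using conv_tendsto[OF that uc Pc lim', of x] by (rule LIMSEQ_imp_Suc)
  have uP: "conv (u n) P = P" for n
  proof
    fix x
    have "(\<lambda>m. conv (u n) (u m) x) \<longlonglongrightarrow> P x"
      unfolding uu using LIMSEQ_ignore_initial_segment[OF lim, of "Suc n"] by (simp add: add.commute)
    then show "conv (u n) P x = P x" using clim[OF uc] LIMSEQ_unique by blast
  qed
  have "star P = P"
  proof
    fix x
    have "(\<lambda>n. cnj (u n (- x))) \<longlonglongrightarrow> cnj (P (- x))" by (intro tendsto_cnj lim)
    moreover have "cnj (u n (- x)) = u n x" for n using us[of n] by (metis star_def)
    ultimately show "star P x = P x" using lim[of x] LIMSEQ_unique by (simp add: star_def)
  qed
  moreover have "conv P P = P"
  proof
    fix x
    have "(\<lambda>n. conv P (u n) x) \<longlonglongrightarrow> P x" using conv_commute[OF Pc uc] uP by simp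
    then show "conv P P x = P x" using clim[OF Pc] LIMSEQ_unique by blast
  qed
  moreover have "P \<noteq> (\<lambda>_. 0)"
  proof
    assume "P = (\<lambda>_. 0)"
    then have "(\<lambda>n. complex_of_real (t n)) \<longlonglongrightarrow> 0" using lim[of 0] u0 by simp
    moreover have "(\<lambda>n. complex_of_real (t n)) \<longlonglongrightarrow> of_real L" by (intro tendsto_of_real L)
    ultimately have "complex_of_real L = 0" using LIMSEQ_unique by blast
    then show False using \<open>1 \<le> L\<close> by simp
  qed
  moreover have "conv (conv q q) P = (\<lambda>x. of_real \<Lambda> * P x)"
  proof
    fix x
    have "conv q q = e 1" by (simp add: e_def)
    moreover have "(\<lambda>n. conv (e 1) (u n) x) \<longlonglongrightarrow> of_real \<Lambda> * P x"
      unfolding ku by (intro tendsto_mult tendsto_const LIMSEQ_Suc lim)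
    ultimately show "conv (conv q q) P x = of_real \<Lambda> * P x" using clim[OF ec] LIMSEQ_unique by metis
  qed
  \<comment> \<open>Transfers relations from \<open>q\<close> to \<open>P\<close>: the case
    \<open>a = 1\<close> places \<open>P\<close> in an ideal containing \<open>q\<close>, and
    \<open>a = 0\<close> with constant \<open>R\<close> gives \<open>P\<close> mean zero.\<close>
  moreover have "conv R P = (\<lambda>x. a * P x)" if R: "continuous_on UNIV R" "conv R q = (\<lambda>x. a * q x)" for R a
  proof
    fix x
    have Re: "conv R (e n) = (\<lambda>x. a * e n x)" for n
      using R by (cases n) (simp_all add: e_def conv_assoc[symmetric] cpow_cont q conv_scale_left)
    have "conv R (u n) = (\<lambda>x. a * u n x)" for n
      unfolding u_def conv_scale_right Re by (simp add: mult.left_commute)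
    then have "(\<lambda>n. conv R (u n) x) \<longlonglongrightarrow> a * P x" by (simp add: tendsto_mult lim)
    then show "conv R P x = a * P x" using clim[OF R(1)] LIMSEQ_unique by blast
  qed
  ultimately show thesis using that[of P \<Lambda>] Pc by blast
qed

section \<open>Minimal idempotents and the characters they yield\<close>

definition idempotent :: "('g \<Rightarrow> complex) \<Rightarrow> bool" where
  "idempotent P \<longleftrightarrow> continuous_on UNIV P \<and> star P = P \<and> conv P P = P \<and> P \<noteq> (\<lambda>_. 0) \<and> conv (\<lambda>_. 1) P = (\<lambda>_. 0)"

text \<open>The lower bound is submultiplicativity applied to \<open>P\<close> convolved with
  itself; this gap makes descent among idempotents terminate.\<close>

lemma idempotent_at_zero:
  assumes "continuous_on UNIV P" "star P = P" "conv P P = P" "P \<noteq> (\<lambda>_. 0)"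
  shows "P 0 = of_real (sqnorm P)" "sqnorm P \<ge> 1"
proof -
  show "P 0 = of_real (sqnorm P)" using conv_star_zero[OF assms(1)] assms(2,3) by simp
  have "sqnorm P \<le> sqnorm P * sqnorm P" using sqnorm_conv_le[OF assms(1,1)] assms(3) by simp
  then show "sqnorm P \<ge> 1" using sqnorm_pos[OF assms(1,4)] by simp
qed

lemma exists_continuous_nonconstant:
  assumes "\<exists>x::'g. x \<noteq> 0"
  obtains h :: "'g \<Rightarrow> real" and a b where "continuous_on UNIV h" "h a \<noteq> h b"
proof -
  obtain b :: 'g where b: "b \<noteq> 0" using assms by blast
  have "compact_space (euclidean :: 'g topology)"
    using compact_space by (simp add: compact_space_def)
  moreover have "Hausdorff_space (euclidean :: 'g topology)"
    unfolding Hausdorff_space_def by (simp add: disjnt_def) (metis hausdorff)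
  ultimately have "normal_space (euclidean :: 'g topology)"
    using compact_Hausdorff_or_regular_imp_normal_space by blast
  moreover have "closedin euclidean {0::'g}" "closedin euclidean {b}" "disjnt {0} {b}"
    using b by (auto simp: closed_closedin[symmetric])
  ultimately obtain h where "continuous_map euclidean (top_of_set {0..1::real}) h" "h ` {0} \<subseteq> {0}" "h ` {b} \<subseteq> {1}"
    using Urysohn_lemma[of euclidean "{0}" "{b}" 0 1] by auto
  then have "continuous_on UNIV h" "h 0 \<noteq> h b"
    by (auto simp: continuous_map_in_subtopology)
  then show thesis by (rule that)
qed

text \<open>Subtracting the mean from a nonconstant function gives a nonzero \<open>f\<close> of
  mean zero. Its convolution with \<open>star f\<close> is hermitian, still of mean zero, and
  nonzero because its value at 0 is \<open>sqnorm f\<close>; the spectral idempotent inherits the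
  mean.\<close>

lemma exists_idempotent:
  assumes "\<exists>x::'g. x \<noteq> 0"
  shows "\<exists>P. idempotent P"
proof -
  obtain h :: "'g \<Rightarrow> real" and a b where h: "continuous_on UNIV h" "h a \<noteq> h b"
    using exists_continuous_nonconstant[OF assms] by blast
  define f where "f x = complex_of_real (h x) - (\<integral>y. complex_of_real (h y) \<partial>M)" for x
  have hc: "continuous_on UNIV (\<lambda>x. complex_of_real (h x))" by (intro continuous_on_of_real h)
  have fc: "continuous_on UNIV f" unfolding f_def by (intro continuous_on_diff hc continuous_on_const)
  have "f a \<noteq> f b" using h(2) by (simp add: f_def)
  then have f0: "f \<noteq> (\<lambda>_. 0)" by auto
  have one: "conv (\<lambda>_. 1) f = (\<lambda>_. 0)"
    using integrable_cont[OF hc] by (simp add: conv_def f_def fun_eq_iff space_M measure_space)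
  define q where "q = conv f (star f)"
  note sc = continuous_on_star[OF fc]
  have "star (star f) = f" by (simp add: star_def fun_eq_iff)
  then have "star q = q" unfolding q_def using star_conv[OF fc sc] conv_commute[OF fc sc] by simp
  moreover have qc: "continuous_on UNIV q" unfolding q_def by (rule continuous_on_conv[OF fc sc])
  moreover have "q 0 \<noteq> 0" using conv_star_zero[OF fc] sqnorm_pos[OF fc f0] by (simp add: q_def)
  then have "q \<noteq> (\<lambda>_. 0)" by auto
  ultimately obtain P and \<Lambda> :: real where P: "continuous_on UNIV P" "star P = P" "conv P P = P" "P \<noteq> (\<lambda>_. 0)"
    and R: "\<And>R a. continuous_on UNIV R \<Longrightarrow> conv R q = (\<lambda>x. a * q x) \<Longrightarrow> conv R P = (\<lambda>x. a * P x)"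
    using spectral_idempotent[of q] by metis
  have c1: "continuous_on UNIV (\<lambda>_::'g. 1 :: complex)" by (rule continuous_on_const)
  have "conv (\<lambda>_. 1) q = (\<lambda>x. 0 * q x)"
    unfolding q_def conv_assoc[OF c1 fc sc, symmetric] one by (simp add: conv_def fun_eq_iff)
  from R[OF c1 this] have "conv (\<lambda>_. 1) P = (\<lambda>_. 0)" by simp
  then show ?thesis using P by (auto simp: idempotent_def)
qed

text \<open>If \<open>P'\<close> lies properly below \<open>P\<close>, the difference
  \<open>Q\<close> is again a nonzero hermitian idempotent, so evaluation at 0 shows that
  \<open>sqnorm P'\<close> is smaller than \<open>sqnorm P\<close> by at least 1.\<close>

lemma exists_minimal_idempotent:
  assumes "\<exists>x::'g. x \<noteq> 0"
  obtains P where "idempotent P"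
    "\<And>P'. idempotent P' \<Longrightarrow> conv P P' = P' \<Longrightarrow> P' = P"
proof -
  \<comment> \<open>In effect the dimension of the ideal of \<open>P\<close>; the floor avoids
    proving that \<open>sqnorm P\<close> is an integer.\<close>
  define rk where "rk P = nat \<lfloor>sqnorm P\<rfloor>" for P
  obtain P where P: "idempotent P" and min: "\<And>P'. idempotent P' \<Longrightarrow> rk P \<le> rk P'"
    using exists_idempotent[OF assms] ex_has_least_nat[of idempotent _ rk] by blast
  have "P' = P" if P': "idempotent P'" and sub: "conv P P' = P'" for P'
  proof (rule ccontr)
    assume ne: "P' \<noteq> P"
    note p = P[unfolded idempotent_def] and p' = P'[unfolded idempotent_def]
    define Q where "Q x = P x - P' x" for x
    have Pc: "continuous_on UNIV P" and P'c: "continuous_on UNIV P'" using p p' by auto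
    have Qc: "continuous_on UNIV Q" unfolding Q_def by (intro continuous_on_diff Pc P'c)
    have "star Q = Q" using p p' by (simp add: Q_def star_def fun_eq_iff)
    moreover have "conv Q Q = Q"
    proof -
      have "conv P Q = Q" unfolding Q_def conv_diff_right[OF Pc Pc P'c] using p sub by simp
      moreover have "conv P' Q = (\<lambda>_. 0)"
        unfolding Q_def conv_diff_right[OF P'c Pc P'c] using p' sub conv_commute[OF Pc P'c] by simp
      ultimately have "conv Q P = Q" "conv Q P' = (\<lambda>_. 0)"
        using conv_commute[OF Qc Pc] conv_commute[OF Qc P'c] by auto
      moreover have "conv Q Q = (\<lambda>x. conv Q P x - conv Q P' x)"
        using conv_diff_right[OF Qc Pc P'c] by (simp add: Q_def[abs_def])
      ultimately show ?thesis by simp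
    qed
    moreover have "Q \<noteq> (\<lambda>_. 0)"
    proof
      assume "Q = (\<lambda>_. 0)"
      then have "P' x = P x" for x by (simp add: Q_def fun_eq_iff)
      then show False using ne by blast
    qed
    ultimately have "Q 0 = of_real (sqnorm Q)" "sqnorm Q \<ge> 1"
      using idempotent_at_zero[OF Qc] by auto
    moreover have "P 0 = of_real (sqnorm P)" "P' 0 = of_real (sqnorm P')"
      using idempotent_at_zero(1) p p' by auto
    ultimately have "complex_of_real (sqnorm Q) = of_real (sqnorm P - sqnorm P')" by (simp add: Q_def)
    then have "sqnorm P' \<le> sqnorm P - 1" using \<open>sqnorm Q \<ge> 1\<close> by (simp only: of_real_eq_iff)
    moreover have "sqnorm P' \<ge> 0" by (rule sqnorm_nonneg)
    ultimately have "rk P' < rk P" unfolding rk_def by linarith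
    then show False using min[OF P'] by simp
  qed
  then show thesis using that P by blast
qed

text \<open>For hermitian \<open>q\<close> in the ideal of a minimal idempotent \<open>P\<close>, both \<open>q * q\<close> and \<open>(q + P) * (q + P)\<close>
  are multiples of \<open>P\<close>, hence so is \<open>q\<close>.\<close>

lemma minimal_idempotent_ideal:
  assumes P: "idempotent P" and min: "\<And>P'. idempotent P' \<Longrightarrow> conv P P' = P' \<Longrightarrow> P' = P"
    and q: "continuous_on UNIV q" "star q = q" "conv P q = q"
  shows "\<exists>a. q = (\<lambda>x. a * P x)"
proof -
  note p = P[unfolded idempotent_def]
  have Pc: "continuous_on UNIV P" using p by simp
  have c1: "continuous_on UNIV (\<lambda>_::'g. 1 :: complex)" by (rule continuous_on_const)
  have sq: "\<exists>a. conv q q = (\<lambda>x. a * P x)" if q: "continuous_on UNIV q" "star q = q" "conv P q = q" for q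
  proof (cases "q = (\<lambda>_. 0)")
    case True
    then have "conv q q = (\<lambda>x. 0 * P x)" by (simp add: conv_def fun_eq_iff)
    then show ?thesis by blast
  next
    case False
    obtain P' and \<Lambda> :: real where P': "continuous_on UNIV P'" "star P' = P'" "conv P' P' = P'" "P' \<noteq> (\<lambda>_. 0)"
      and ev: "conv (conv q q) P' = (\<lambda>x. of_real \<Lambda> * P' x)"
      and R: "\<And>R a. continuous_on UNIV R \<Longrightarrow> conv R q = (\<lambda>x. a * q x) \<Longrightarrow> conv R P' = (\<lambda>x. a * P' x)"
      using spectral_idempotent[OF q(1,2) False] by metis
    \<comment> \<open>The spectral idempotent of \<open>q\<close> lies in the ideal of
      \<open>P\<close>, so minimality identifies it with \<open>P\<close>, and the eigenvalue
      equation then describes the square of \<open>q\<close>.\<close>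
    have "conv P P' = P'" using R[OF Pc, of 1] q(3) by simp
    moreover have "conv (\<lambda>_. 1) P' = (\<lambda>_. 0)"
    proof -
      have "conv (\<lambda>_. 1) q = conv (conv (\<lambda>_. 1) P) q" using conv_assoc[OF c1 Pc q(1)] q(3) by simp
      also have "\<dots> = (\<lambda>x. 0 * q x)" using p by (simp add: conv_def fun_eq_iff)
      finally have "conv (\<lambda>_. 1) q = (\<lambda>x. 0 * q x)" .
      from R[OF c1 this] show ?thesis by simp
    qed
    ultimately have "P' = P" using P' by (intro min) (auto simp: idempotent_def)
    moreover have "conv (conv q q) P = conv q q"
      using conv_assoc[OF q(1,1) Pc] conv_commute[OF q(1) Pc] q(3) by simp
    ultimately show ?thesis using ev by auto
  qed
  define r where "r x = q x + P x" for x
  have rc: "continuous_on UNIV r" unfolding r_def by (intro continuous_on_add q Pc)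
  have "star r = r" using q(2) p by (simp add: r_def star_def fun_eq_iff)
  moreover have Pr: "conv P r = r" unfolding r_def conv_add_right[OF Pc q(1) Pc] using q(3) p by simp
  ultimately obtain b where b: "conv r r = (\<lambda>x. b * P x)" using sq[OF rc] by blast
  obtain a where a: "conv q q = (\<lambda>x. a * P x)" using sq[OF q] by blast
  have "conv r r = (\<lambda>x. conv r q x + conv r P x)"
    using conv_add_right[OF rc q(1) Pc] by (simp add: r_def[abs_def])
  also have "conv r q = (\<lambda>x. conv q q x + conv q P x)"
    unfolding conv_commute[OF rc q(1)] using conv_add_right[OF q(1) q(1) Pc] by (simp add: r_def[abs_def])
  also have "conv r P = r" using conv_commute[OF rc Pc] Pr by simp
  also have "conv q P = q" using conv_commute[OF q(1) Pc] q(3) by simp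
  finally have rr: "conv r r = (\<lambda>x. conv q q x + q x + r x)" .
  have eq: "b * P x = a * P x + q x + (q x + P x)" for x
    using fun_cong[OF rr[unfolded b a], of x] by (simp add: r_def)
  have "q x = (b - a - 1) / 2 * P x" for x
  proof -
    have "2 * q x = (b - a - 1) * P x" using eq[of x] by (simp add: algebra_simps)
    then show ?thesis by (simp add: field_simps)
  qed
  then show ?thesis by blast
qed

text \<open>All translates of a minimal \<open>P\<close> lie in its ideal and are therefore
  multiples of \<open>P\<close>. The resulting functional equation makes \<open>P / P 0\<close>
  multiplicative.\<close>

lemma exists_nontrivial_character:
  assumes "\<exists>x::'g. x \<noteq> 0"
  shows "\<exists>\<gamma> \<in> (characters :: ('g \<Rightarrow> complex) set). \<gamma> \<noteq> (\<lambda>_. 1)"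
proof -
  obtain P where P: "idempotent P" and min: "\<And>P'. idempotent P' \<Longrightarrow> conv P P' = P' \<Longrightarrow> P' = P"
    using exists_minimal_idempotent[OF assms] by blast
  note p = P[unfolded idempotent_def]
  have Pc: "continuous_on UNIV P" using p by simp
  have P0: "P 0 = of_real (sqnorm P)" "sqnorm P \<ge> 1" using idempotent_at_zero p by auto
  have Pcnj: "P (- x) = cnj (P x)" for x
    using p by (metis star_def add.inverse_inverse complex_cnj_cnj)
  have shiftc: "continuous_on UNIV (\<lambda>y. P (y - x))" for x
    by (intro continuous_on_shift[OF Pc] continuous_intros)
  have Pshift: "conv P (\<lambda>y. P (y - x)) = (\<lambda>y. P (y - x))" for x
    using conv_commute[OF Pc shiftc] conv_shift_left[of P x P] p by simp
  have "\<exists>c. \<forall>y. P (y - x) = c * P y" for x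
  proof -
    \<comment> \<open>A translate of \<open>P\<close> need not be hermitian, and the ideal lemma
      asks for that; \<open>star\<close> exchanges the translates by \<open>x\<close> and
      \<open>- x\<close>, so these two combinations are hermitian and recover the translate as half
      of \<open>q1 - \<i> * q2\<close>.\<close>
    define q1 where "q1 y = P (y - x) + P (y - - x)" for y
    define q2 where "q2 y = \<i> * (P (y - x) - P (y - - x))" for y
    have q1c: "continuous_on UNIV q1" unfolding q1_def by (intro continuous_on_add shiftc)
    have dc: "continuous_on UNIV (\<lambda>y. P (y - x) - P (y - - x))" by (intro continuous_on_diff shiftc)
    have q2c: "continuous_on UNIV q2" unfolding q2_def by (intro continuous_on_mult continuous_on_const dc)
    have neg: "cnj (P (- y - x)) = P (y + x)" "cnj (P (x - y)) = P (y - x)" for y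
      by (simp_all add: Pcnj[symmetric] add.commute)
    have "star q1 = q1" by (simp add: star_def q1_def fun_eq_iff neg)
    moreover have "conv P q1 = q1" unfolding q1_def conv_add_right[OF Pc shiftc shiftc] Pshift ..
    ultimately obtain a where a: "q1 = (\<lambda>y. a * P y)" using minimal_idempotent_ideal[OF P min q1c] by blast
    have "star q2 = q2" by (simp add: star_def q2_def fun_eq_iff neg algebra_simps)
    moreover have "conv P q2 = q2"
      unfolding q2_def conv_scale_right conv_diff_right[OF Pc shiftc shiftc] Pshift ..
    ultimately obtain b where b: "q2 = (\<lambda>y. b * P y)" using minimal_idempotent_ideal[OF P min q2c] by blast
    have "P (y - x) = (a - \<i> * b) / 2 * P y" for y
    proof -
      have "q1 y - \<i> * q2 y = 2 * P (y - x)" by (simp add: q1_def q2_def algebra_simps)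
      moreover have "q1 y - \<i> * q2 y = (a - \<i> * b) * P y" unfolding a b by (simp add: algebra_simps)
      ultimately show ?thesis by (simp add: field_simps)
    qed
    then show ?thesis by blast
  qed
  then obtain c where c: "\<And>x y. P (y - x) = c x * P y" by metis
  define \<gamma> where "\<gamma> x = P x / P 0" for x
  have Pnz: "P 0 \<noteq> 0" using P0 by auto
  have cx: "c x = \<gamma> (- x)" for x using c[of 0 x] Pnz by (simp add: \<gamma>_def)
  have mult: "\<gamma> (x + y) = \<gamma> x * \<gamma> y" for x y
    using c[of x "- y"] cx[of "- y"] by (simp add: \<gamma>_def)
  have "cnj (P 0) = P 0" using P0 by simp
  \<comment> \<open>Hermitian symmetry and the real value \<open>P 0\<close> make conjugation of
    \<open>\<gamma>\<close> the same as inversion of the argument, whence modulus 1.\<close>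
  then have "\<gamma> x * cnj (\<gamma> x) = \<gamma> (x + - x)" for x unfolding mult by (simp add: \<gamma>_def Pcnj)
  then have "complex_of_real ((cmod (\<gamma> x))\<^sup>2) = of_real 1" for x
    unfolding complex_norm_square using Pnz by (simp add: \<gamma>_def)
  then have "(cmod (\<gamma> x))\<^sup>2 = 1" for x by (simp only: of_real_eq_iff)
  then have "cmod (\<gamma> x) = 1" for x using power2_eq_1_iff[of "cmod (\<gamma> x)"] norm_ge_zero[of "\<gamma> x"] by (smt (verit))
  moreover have "continuous_on UNIV \<gamma>"
    unfolding \<gamma>_def using Pnz by (intro continuous_on_divide Pc continuous_on_const) auto
  ultimately have "\<gamma> \<in> characters" using mult by (simp add: characters_def)
  moreover have "\<gamma> \<noteq> (\<lambda>_. 1)"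
  proof
    assume "\<gamma> = (\<lambda>_. 1)"
    then have const: "P x = P 0" for x using Pnz by (metis \<gamma>_def divide_eq_1_iff)
    have "conv (\<lambda>_. 1) P 0 = (\<integral>y. P 0 \<partial>M)"
      unfolding conv_def mult_1 by (intro Bochner_Integration.integral_cong refl const)
    also have "\<dots> = P 0" by (simp add: space_M measure_space)
    finally have "conv (\<lambda>_. 1) P 0 = P 0" .
    then show False using p Pnz by simp
  qed
  ultimately show ?thesis by blast
qed

end

section \<open>Connected groups and the torus\<close>

lemma character_zero: "\<gamma> \<in> characters \<Longrightarrow> \<gamma> 0 = 1"
proof -
  assume \<gamma>: "\<gamma> \<in> characters"
  then have "\<gamma> (0 + 0) = \<gamma> 0 * \<gamma> 0" unfolding characters_def by blast
  then show "\<gamma> 0 = 1" using character_nonzero[OF \<gamma>, of 0] by simp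
qed

text \<open>A character of finite order takes values in a finite set of roots of unity; its
  connected image is then a single point, namely its value 1 at 0.\<close>

lemma connected_dual_torsion_free:
  fixes \<gamma> :: "'g::{ab_group_add, topological_space} \<Rightarrow> complex" and n :: int
  assumes "connected (UNIV :: 'g set)" and \<gamma>: "\<gamma> \<in> characters" and "n \<noteq> 0" and tors: "(\<lambda>x. \<gamma> x powi n) = (\<lambda>_. 1)"
  shows "\<gamma> = (\<lambda>_. 1)"
proof -
  define k where "k = nat \<bar>n\<bar>"
  have pow: "\<gamma> x ^ k = 1" for x
    using fun_cong[OF tors, of x] by (cases "n \<ge> 0") (auto simp: k_def power_int_def field_simps)
  have "finite {z::complex. z ^ k = 1}" using \<open>n \<noteq> 0\<close> by (intro finite_roots_unity) (simp add: k_def)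
  then have "finite (range \<gamma>)" by (rule finite_subset[rotated]) (use pow in auto)
  moreover have "connected (range \<gamma>)"
    using assms(1) \<gamma> by (intro connected_continuous_image) (auto simp: characters_def)
  ultimately obtain c where "range \<gamma> = {c}" using connected_finite_iff_sing by auto
  then have "\<gamma> x = \<gamma> 0" for x by (metis rangeI singletonD)
  then show ?thesis using character_zero[OF \<gamma>] by auto
qed

section \<open>The torus as a quotient of the real line\<close>

lemma open_vimage_torus: "open U \<Longrightarrow> open (abs_torus -` U)"
  by (simp add: open_torus_def vimage_def)

lemma continuous_abs_torus: "continuous_on UNIV abs_torus"
  by (simp add: continuous_on_open_vimage open_vimage_torus)

lemma continuous_from_torus:
  fixes f :: "torus \<Rightarrow> 'b::topological_space"
  assumes "continuous_on UNIV (\<lambda>x. f (abs_torus x))"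
  shows "continuous_on UNIV f"
proof -
  have "open (f -` B)" if "open B" for B
  proof -
    have "open ((\<lambda>x. f (abs_torus x)) -` B)"
      using assms that by (simp add: continuous_on_open_vimage)
    then show ?thesis by (simp add: open_torus_def vimage_def)
  qed
  then show ?thesis by (simp add: continuous_on_open_vimage)
qed

lemma torus_abs_surj: obtains a where "x = abs_torus a"
  by (metis Quotient3_abs_rep Quotient3_torus)

lemma continuous_torus_translation: "continuous_on UNIV ((+) (x :: torus))"
proof (rule continuous_from_torus)
  obtain a where a: "x = abs_torus a" by (rule torus_abs_surj)
  have "x + abs_torus y = abs_torus (a + y)" for y
    unfolding a by (rule plus_torus.abs_eq)
  then show "continuous_on UNIV (\<lambda>y. x + abs_torus y)"
    by (simp add: continuous_on_compose2[OF continuous_abs_torus] continuous_on_add continuous_on_const continuous_on_id)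
qed

lemma connected_torus: "connected (UNIV :: torus set)"
proof -
  have "range abs_torus = UNIV" using torus_abs_surj by (metis UNIV_eq_I rangeI)
  then show ?thesis using connected_continuous_image[OF continuous_abs_torus connected_UNIV] by simp
qed

definition torus_char :: "torus \<Rightarrow> complex" where
  "torus_char x = cis (2 * pi * rep_torus x)"

text \<open>The chosen representative differs from \<open>x\<close> by an integer, which the
  exponential does not see; afterwards any representative may be used.\<close>

lemma torus_char_abs: "torus_char (abs_torus x) = cis (2 * pi * x)"
proof -
  have "torus_rel (rep_torus (abs_torus x)) x"
    using Quotient3_rep_abs[OF Quotient3_torus] by (simp add: torus_rel_refl)
  then obtain n :: int where "rep_torus (abs_torus x) - x = of_int n"
    by (auto simp: torus_rel_def elim: Ints_cases)
  then have "2 * pi * rep_torus (abs_torus x) = 2 * pi * x + 2 * pi * of_int n"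
    by (simp add: algebra_simps)
  then have "torus_char (abs_torus x) = cis (2 * pi * x) * cis (2 * pi * of_int n)"
    by (simp only: torus_char_def cis_mult)
  also have "cis (2 * pi * of_int n) = 1" by (rule cis_multiple_2pi) simp
  finally show ?thesis by simp
qed

lemma torus_char_character: "torus_char \<in> characters"
proof -
  have "continuous_on UNIV torus_char"
    by (rule continuous_from_torus) (unfold torus_char_abs, intro continuous_intros)
  moreover have "torus_char (x + y) = torus_char x * torus_char y" for x y
  proof -
    obtain a b where ab: "x = abs_torus a" "y = abs_torus b" using torus_abs_surj by metis
    show ?thesis unfolding ab plus_torus.abs_eq torus_char_abs by (simp add: cis_mult distrib_left)
  qed
  ultimately show ?thesis by (simp add: characters_def torus_char_def)
qed

lemma torus_char_infinite_order:
  fixes n :: int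
  assumes "n \<noteq> 0"
  shows "(\<lambda>x. torus_char x powi n) \<noteq> (\<lambda>_. 1)"
proof
  assume "(\<lambda>x. torus_char x powi n) = (\<lambda>_. 1)"
  \<comment> \<open>At this point the \<open>n\<close>-th power is \<open>cis pi\<close>, that is
    -1.\<close>
  then have "torus_char (abs_torus (1 / (2 * of_int n))) powi n = 1" by (rule fun_cong)
  then show False using assms by (simp add: torus_char_abs cis_power_int)
qed

theorem theorem3p2:
  fixes M :: "'g::{topological_ab_group_add, t2_space} measure"
    and N :: "torus measure"
  assumes "compact (UNIV :: 'g set)"
    and "connected (UNIV :: 'g set)"
    and "\<exists>x::'g. x \<noteq> 0"
    and "is_haar M"
    and "is_haar N"
  shows "lehmer M = lehmer N"
proof (rule antisym)
  have tr: "continuous_on UNIV ((+) x)" for x :: 'g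
    by (intro continuous_intros)
  interpret compact_haar M
    by unfold_locales
      (use assms in \<open>auto simp: is_haar_def haar_translation_invariant[OF assms(4) tr]\<close>)
  obtain \<gamma> :: "'g \<Rightarrow> complex" where \<gamma>: "\<gamma> \<in> characters" "\<gamma> \<noteq> (\<lambda>_. 1)"
    using exists_nontrivial_character[OF assms(3)] by blast
  show "lehmer M \<le> lehmer N"
  proof (rule lehmer_le[OF assms(5) continuous_torus_translation _ assms(4) tr \<gamma>(1)])
    show "\<forall>(\<gamma> :: torus \<Rightarrow> complex)\<in>characters. \<forall>n::int. n \<noteq> 0 \<longrightarrow> (\<lambda>x. \<gamma> x powi n) = (\<lambda>_. 1) \<longrightarrow> \<gamma> = (\<lambda>_. 1)"
      using connected_dual_torsion_free[OF connected_torus] by blast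
    \<comment> \<open>In a torsion-free dual every nontrivial character has infinite order, so any
      nontrivial \<open>\<gamma>\<close> serves as \<open>\<eta>\<close>.\<close>
    show "\<forall>n::int. n \<noteq> 0 \<longrightarrow> (\<lambda>x. \<gamma> x powi n) \<noteq> (\<lambda>_. 1)"
      using connected_dual_torsion_free[OF assms(2) \<gamma>(1)] \<gamma>(2) by blast
  qed
  show "lehmer N \<le> lehmer M"
  proof (rule lehmer_le[OF assms(4) tr _ assms(5) continuous_torus_translation torus_char_character])
    show "\<forall>(\<gamma> :: 'g \<Rightarrow> complex)\<in>characters. \<forall>n::int. n \<noteq> 0 \<longrightarrow> (\<lambda>x. \<gamma> x powi n) = (\<lambda>_. 1) \<longrightarrow> \<gamma> = (\<lambda>_. 1)"
      using connected_dual_torsion_free[OF assms(2)] by blast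
    show "\<forall>n::int. n \<noteq> 0 \<longrightarrow> (\<lambda>x. torus_char x powi n) \<noteq> (\<lambda>_. 1)"
      using torus_char_infinite_order by blast
  qed
qed

end
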